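(* Let $q$ be a prime power, let $n\ge 2$ be an integer, and let $\delta\ge 0$ be an integer with $\delta \leq \frac{q-7}{2}$ if $q$ is odd and $\delta \leq \frac{q-8}{2}$ if $q$ is even. Let $\mathcal{F}$ be a set of $\frac{q^{n+1}-1}{q-1}-\delta$ different $n$-dimensional subspaces of $PG(\frac{n(n+3)}{2},q)$ with the following properties: (1) Each two elements of $\mathcal{F}$ intersect in a point. (2) Each three elements of $\mathcal{F}$ are skew (have no common point). (3) The elements of $\mathcal{F}$ span $PG(\frac{n(n+3)}{2},q)$. (4) Any proper subspace of $PG(\frac{n(n+3)}{2},q)$ that is spanned by a collection of elements of $\mathcal{F}$ has dimension $\frac{i(2n-i+3)}{2}-1$ for some $i \in \{0,\ldots,n\}$. (5) If $q$ is even, at least one space spanned by two elements of $\mathcal{F}$ contains more than two elements of $\mathcal{F}$. Then $\mathcal{F}$ is extendable to (i.e. contained in) a regular generalised dual arc of size $\frac{q^{n+1}-1}{q-1}$ in $PG(\frac{n(n+3)}{2},q)$ (of order $1$, with parameters $(\frac{n(n+3)}{2},n,0)$). Moreover, if $q$ is even, this dual arc of size $\frac{q^{n+1}-1}{q-1}$ is even extendable to an $n$-dimensional dual hyperoval.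
   Context: All dimensions are projective dimensions (the empty subspace has dimension $-1$). A generalised dual arc of order $d$ with parameters $(m=m_0,m_1,\ldots,m_{d+1})$, $m_0>m_1>\cdots>m_{d+1}>-1$, in $PG(m,q)$ is a set of $m_1$-dimensional subspaces of $PG(m,q)$ such that each $j$ of these subspaces intersect in a subspace of dimension $m_j$, $1\le j\le d+1$, and each $d+2$ of them have no common intersection. It is regular if, in addition, its elements span $PG(m,q)$ and, whenever $\pi$ is the intersection of $j$ elements, $j\le d$, $\pi$ is spanned by the subspaces of dimension $m_{j+1}$ which are the intersections of $\pi$ with the remaining elements. A family of $\frac{q^{l+1}-1}{q-1}+1$ $l$-dimensional subspaces of $PG(m,q)$, $m\ge 2$, is an $l$-dimensional dual hyperoval if every two members intersect in a point, no three members have a common point, and the members span $PG(m,q)$. *)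

theory Defs
  imports "HOL-Analysis.Cartesian_Space"
begin

text \<open>
  The projective space PG(m,q) is the lattice of linear subspaces of the vector space
  \<open>'a ^ 'v\<close> over a finite field \<open>'a\<close> with \<open>CARD('a) = q\<close> and \<open>CARD('v) = m + 1\<close>.
  In particular, the empty subspace of PG(m,q) is \<open>{0}\<close>.
\<close>

definition pdim :: "('a::field ^ 'v) set \<Rightarrow> int" where
  "pdim U = int (vec.dim U) - 1"

definition proj_subspace :: "int \<Rightarrow> ('a::field ^ 'v) set \<Rightarrow> bool" where
  "proj_subspace k U \<longleftrightarrow> vec.subspace U \<and> pdim U = k"

definition proj_span :: "('a::field ^ 'v) set set \<Rightarrow> ('a ^ 'v) set" where
  "proj_span \<U> = vec.span (\<Union>\<U>)"

text \<open>
  The list \<open>ms\<close> consists of the \<open>d + 2\<close> parameters \<open>m\<^sub>0, \<dots>, m\<^sub>d\<^sub>+\<^sub>1\<close>.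
\<close>

definition generalised_dual_arc ::
  "nat \<Rightarrow> int list \<Rightarrow> ('a::{field,finite} ^ 'v) set set \<Rightarrow> bool" where
  "generalised_dual_arc d ms D \<longleftrightarrow>
     length ms = d + 2 \<and>
     ms ! 0 = int CARD('v) - 1 \<and>
     (\<forall>j\<le>d. ms ! j > ms ! (j + 1)) \<and>
     ms ! (d + 1) > -1 \<and>
     (\<forall>U\<in>D. proj_subspace (ms ! 1) U) \<and>
     (\<forall>j\<in>{1..d + 1}. \<forall>G\<subseteq>D. card G = j \<longrightarrow> proj_subspace (ms ! j) (\<Inter>G)) \<and>
     (\<forall>G\<subseteq>D. card G = d + 2 \<longrightarrow> proj_subspace (-1) (\<Inter>G))"

text \<open>
  In the last clause, the intersections of \<open>\<Inter>G\<close> with the remaining elements have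
  dimension \<open>ms ! (card G + 1)\<close> because \<open>D\<close> is a generalised dual arc.
\<close>

definition regular_generalised_dual_arc ::
  "nat \<Rightarrow> int list \<Rightarrow> ('a::{field,finite} ^ 'v) set set \<Rightarrow> bool" where
  "regular_generalised_dual_arc d ms D \<longleftrightarrow>
     generalised_dual_arc d ms D \<and>
     proj_span D = UNIV \<and>
     (\<forall>j\<in>{1..d}. \<forall>G\<subseteq>D. card G = j \<longrightarrow> \<Inter>G = proj_span {\<Inter>G \<inter> U | U. U \<in> D - G})"

definition dual_hyperoval :: "nat \<Rightarrow> ('a::{field,finite} ^ 'v) set set \<Rightarrow> bool" where
  "dual_hyperoval l H \<longleftrightarrow>
     int CARD('v) - 1 \<ge> 2 \<and>
     real (card H) = (real CARD('a) ^ (l + 1) - 1) / (real CARD('a) - 1) + 1 \<and>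
     (\<forall>U\<in>H. proj_subspace (int l) U) \<and>
     (\<forall>U\<in>H. \<forall>V\<in>H. U \<noteq> V \<longrightarrow> proj_subspace 0 (U \<inter> V)) \<and>
     (\<forall>U\<in>H. \<forall>V\<in>H. \<forall>W\<in>H. U \<noteq> V \<and> U \<noteq> W \<and> V \<noteq> W \<longrightarrow> proj_subspace (-1) (U \<inter> V \<inter> W)) \<and>
     proj_span H = UNIV"

end

theory Submission imports Defs begin

text \<open>
  The model is the symmetric square \<open>S\<^sup>2V\<close> of a vector space \<open>V\<close> of dimension \<open>n + 1\<close>, with the
  elements \<open>uV = {uy | y \<in> V}\<close> for the points \<open>u\<close> of \<open>PG(V)\<close>.  Two of them meet in \<open>uv\<close>, and each
  \<open>uV\<close> has one point, the contact point \<open>u\<^sup>2\<close>, on no other element.  In characteristic two the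
  squares form a subspace, which meets every element in its contact point and completes the family
  to a dual hyperoval.  The proof recovers \<open>V\<close> and its product from the given family; the missing
  elements can then be written down.  Dimensions are vector space dimensions throughout.

  The members of the family in the span of two of them form a line.  A member off the line meets the
  span in a projective line only, and the members on the line cut this in distinct points, so a
  line has at most \<open>q + 1\<close> members.  The points of one member are nearly all on other members, which
  leaves few ways to distribute the members over lines: if some line through \<open>U0\<close> has three members,
  then all but at most two members are on lines through \<open>U0\<close> with four or more
  (\<open>ex_long_line\<close>, \<open>few_short_lines\<close>).  For odd \<open>q\<close> a line with three members exists because a
  projective plane of order \<open>q\<close> has no dual arc of \<open>q + 2\<close> lines (\<open>ex_three_on_line\<close>).

  Two such lines through \<open>U0\<close>, one of them with at least \<open>q\<close> members, cut out the two rulings of a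
  hyperbolic quadric, and \<open>U0\<close> has too many points on it to meet it in a conic.  Hence the members of a line cut \<open>U0\<close> in collinear points
  (\<open>regulus_collinear\<close>).  With this, four members of a line determine linear maps \<open>uy \<mapsto> sy\<close> from
  \<open>U0 = uV\<close> to the others, which are compatible with all other members (\<open>line_map\<close>).  The preimage
  of the point on \<open>U0\<close> is the contact point \<open>u\<^sup>2\<close>; it is the same for all lines (\<open>common_contact\<close>).
  Normalised by it, the maps form a symmetric bilinear product on \<open>U0\<close>, and all but two members
  are of the form \<open>xU0\<close> (\<open>coordinates\<close>).

  For reasons of dimension the product makes the ambient space the symmetric square of \<open>U0\<close>
  (locale \<open>symmetric_square\<close>).  A remaining member meets each known \<open>xU0\<close> in a point \<open>xg\<close> whose
  second factor is unknown or equal to \<open>x\<close>, and counting shows that it is \<open>gU0\<close> for one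
  fixed \<open>g\<close>, or the space of squares in characteristic two (\<open>recognise\<close>).  So the family lies in
  the model, with the squares added if \<open>q\<close> is even.
\<close>

section \<open>Counting in finite vector spaces\<close>

definition join :: "('a::field ^ 'v) set \<Rightarrow> ('a ^ 'v) set \<Rightarrow> ('a ^ 'v) set" where
  "join A B = vec.span (A \<union> B)"

definition points :: "('a::field ^ 'v) set \<Rightarrow> ('a ^ 'v) set set" where
  "points X = {L. vec.subspace L \<and> vec.dim L = 1 \<and> L \<subseteq> X}"

text \<open>
  The number \<open>(q\<^sup>k - 1) / (q - 1)\<close> of points of a space of vector dimension \<open>k\<close>, without a division.
\<close>

definition num_points :: "nat \<Rightarrow> nat \<Rightarrow> nat" where
  "num_points q k = (\<Sum>i<k. q ^ i)"

lemma num_points_Suc: "num_points q (Suc k) = 1 + q * num_points q k"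
  by (simp add: num_points_def sum.lessThan_Suc_shift sum_distrib_left del: sum.lessThan_Suc)

lemma num_points_simps [simp]:
  "num_points q 0 = 0" "num_points q (Suc 0) = 1"
  by (simp_all add: num_points_def)

lemma num_points_2: "num_points q 2 = q + 1"
  by (simp add: num_points_def numeral_2_eq_2)

lemma num_points_mono: "j \<le> k \<Longrightarrow> num_points q j \<le> num_points q k"
  unfolding num_points_def by (rule sum_mono2) auto

lemma num_points_mult: "q \<ge> 1 \<Longrightarrow> (q - 1) * num_points q k + 1 = q ^ k"
proof (induction k)
  case (Suc k)
  have "(q - 1) * num_points q (Suc k) + 1 = (q - 1) + q * ((q - 1) * num_points q k) + 1"
    by (simp add: num_points_Suc algebra_simps)
  also have "\<dots> = q * ((q - 1) * num_points q k + 1)"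
    using Suc.prems by (cases q) (simp_all add: algebra_simps)
  finally show ?case using Suc by (simp only: power_Suc)
qed simp

lemma join_mem_iff:
  assumes "vec.subspace A" "vec.subspace B"
  shows "x \<in> join A B \<longleftrightarrow> (\<exists>a\<in>A. \<exists>b\<in>B. x = a + b)"
  using assms unfolding join_def vec.span_Un by (auto simp: vec.span_eq_iff[THEN iffD2])

lemma subspace_join [simp]: "vec.subspace (join A B)"
  by (simp add: join_def)

lemma join_upper: "A \<subseteq> join A B" "B \<subseteq> join A B"
  unfolding join_def by (meson Un_upper1 Un_upper2 order_trans vec.span_superset)+

lemma join_least: "vec.subspace C \<Longrightarrow> A \<subseteq> C \<Longrightarrow> B \<subseteq> C \<Longrightarrow> join A B \<subseteq> C"
  unfolding join_def by (simp add: vec.span_minimal)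

lemma join_commute: "join A B = join B A"
  by (simp add: join_def Un_commute)

lemma dim_join:
  assumes "vec.subspace A" "vec.subspace B"
  shows "vec.dim (join A B) + vec.dim (A \<inter> B) = vec.dim A + vec.dim B"
proof -
  have "join A B = {x + y |x y. x \<in> A \<and> y \<in> B}"
    using join_mem_iff[OF assms] by blast
  then show ?thesis using vec.dim_sums_Int[OF assms] by simp
qed

lemma subspace_eqI:
  "vec.subspace A \<Longrightarrow> vec.subspace B \<Longrightarrow> A \<subseteq> B \<Longrightarrow> vec.dim B \<le> vec.dim A \<Longrightarrow> A = B"
  by (rule vec.subspace_dim_equal)

lemma dim_pos_ex:
  assumes "vec.subspace A" "vec.dim A \<ge> 1"
  shows "\<exists>x\<in>A. x \<noteq> (0 :: 'a::field ^ 'v)"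
  using assms(2) vec.dim_eq_0[of A] by fastforce

lemma lin_comb_mem:
  "vec.subspace A \<Longrightarrow> x \<in> A \<Longrightarrow> y \<in> A \<Longrightarrow> c *s x + d *s y \<in> A"
  by (simp add: vec.subspace_add vec.subspace_scale)

lemma span_singleton_mem: "x \<in> vec.span {y} \<longleftrightarrow> (\<exists>c. x = c *s y)"
  by (auto simp: vec.span_singleton)

lemma dim_span_singleton: "x \<noteq> 0 \<Longrightarrow> vec.dim (vec.span {x}) = 1"
  by (simp add: vec.dim_span)

lemma span_singleton_subset: "vec.subspace A \<Longrightarrow> x \<in> A \<Longrightarrow> vec.span {x} \<subseteq> A"
  by (simp add: vec.span_minimal)

lemma dim1_span:
  assumes "vec.subspace L" "vec.dim L = 1" "x \<in> L" "x \<noteq> 0"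
  shows "L = vec.span {x}"
proof (rule subspace_eqI[symmetric])
  show "vec.span {x} \<subseteq> L" using assms by (intro span_singleton_subset)
  show "vec.dim L \<le> vec.dim (vec.span {x})"
    using dim_span_singleton[of x] assms by linarith
qed (use assms in \<open>simp_all\<close>)

lemma dim1_multiple:
  assumes "vec.subspace L" "vec.dim L = 1" "x \<in> L" "x \<noteq> 0" "y \<in> L"
  obtains c where "y = c *s x"
  using dim1_span[OF assms(1-4)] assms(5) by (auto simp: span_singleton_mem)

lemma dim1_eqI:
  assumes "vec.subspace L" "vec.dim L = 1" "vec.subspace M" "vec.dim M = 1"
    and "x \<in> L" "x \<in> M" "x \<noteq> 0"
  shows "L = M"
  using dim1_span assms by metis

lemma not_span_nonzero: "x \<notin> vec.span {y} \<Longrightarrow> x \<noteq> 0"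
  by (metis vec.span_zero)

lemma not_span_sym: "x \<notin> vec.span {y} \<Longrightarrow> y \<noteq> 0 \<Longrightarrow> y \<notin> vec.span {x}"
proof
  assume a: "x \<notin> vec.span {y}" "y \<noteq> 0" "y \<in> vec.span {x}"
  then obtain c where c: "y = c *s x" by (auto simp: span_singleton_mem)
  then have "c \<noteq> 0" using a by auto
  then have "x = inverse c *s y" using c by simp
  then show False using a(1) by (auto simp: span_singleton_mem)
qed

lemma indep_comb_zero:
  assumes "x \<noteq> 0" "y \<notin> vec.span {x}" "a *s x + b *s y = 0"
  shows "a = 0 \<and> b = 0"
proof -
  have "b = 0"
  proof (rule ccontr)
    assume "b \<noteq> 0"
    have "b *s y = (- a) *s x" using assms(3)
      by (metis add.commute add_eq_0_iff vec.scale_minus_left)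
    then have "y = inverse b *s ((- a) *s x)" using \<open>b \<noteq> 0\<close>
      by (metis vec.scale_one vec.scale_scale left_inverse)
    then show False using assms(2)
      by (metis vec.scale_scale span_singleton_mem)
  qed
  then show ?thesis using assms by simp
qed

lemma indep_comb_eq:
  assumes "x \<noteq> 0" "y \<notin> vec.span {x}" "a *s x + b *s y = c *s x + d *s y"
  shows "a = c \<and> b = d"
proof -
  have "(a - c) *s x + (b - d) *s y = 0"
    using assms(3) by (simp add: algebra_simps vec.scale_left_diff_distrib)
  then show ?thesis using indep_comb_zero[OF assms(1,2)] by force
qed

lemma dim_span_pair:
  assumes "x \<noteq> 0" "y \<notin> vec.span {x}"
  shows "vec.dim (vec.span {x, y}) = 2"
  using assms not_span_nonzero[OF assms(2)] vec.dim_insert[of y "{x}"]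
  by (simp add: insert_commute del: vec.dim_insert)

lemma span_pair_mem: "z \<in> vec.span {x, y} \<longleftrightarrow> (\<exists>a b. z = a *s x + b *s y)"
proof
  assume "z \<in> vec.span {x, y}"
  then obtain k where "z - k *s x \<in> vec.span {y}" using vec.span_breakdown_eq[of z x "{y}"] by auto
  then obtain c where "z - k *s x = c *s y" by (auto simp: span_singleton_mem)
  then have "z = k *s x + c *s y" by (simp add: algebra_simps)
  then show "\<exists>a b. z = a *s x + b *s y" by blast
next
  assume "\<exists>a b. z = a *s x + b *s y"
  then show "z \<in> vec.span {x, y}"
    by (metis insertI1 insertI2 lin_comb_mem singletonI vec.span_base vec.subspace_span)
qed

lemma dim2_span:
  assumes "vec.subspace l" "vec.dim l = 2" "x \<in> l" "y \<in> l" "x \<noteq> 0" "y \<notin> vec.span {x}"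
  shows "l = vec.span {x, y}"
proof (rule subspace_eqI[symmetric])
  show "vec.span {x, y} \<subseteq> l" using assms by (intro vec.span_minimal) simp_all
  show "vec.dim l \<le> vec.dim (vec.span {x, y})"
    using dim_span_pair[of x y] assms by linarith
qed (use assms in \<open>simp_all\<close>)

lemma dim2_comb:
  assumes "vec.subspace l" "vec.dim l = 2" "x \<in> l" "y \<in> l" "x \<noteq> 0" "y \<notin> vec.span {x}" "z \<in> l"
  obtains a b where "z = a *s x + b *s y"
  using dim2_span[OF assms(1-6)] assms(7) by (auto simp: span_pair_mem)

lemma dim2_subset:
  assumes "vec.subspace l" "vec.dim l = 2" "x \<in> l" "y \<in> l" "x \<noteq> 0" "y \<notin> vec.span {x}"
    and "vec.subspace A" "x \<in> A" "y \<in> A"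
  shows "l \<subseteq> A"
  using dim2_span[OF assms(1-6)] vec.span_minimal[of "{x,y}" A] assms(7-) by simp

lemma card_subspace:
  fixes X :: "('a::{field,finite} ^ 'v) set"
  assumes "vec.subspace X"
  shows "card X = CARD('a) ^ vec.dim X"
proof -
  have "card (vec.span B) = CARD('a) ^ card B" if "vec.independent B" for B :: "('a ^ 'v) set"
  proof -
    have "finite B" by simp
    then show ?thesis using that
    proof (induction B)
      case (insert b B)
      have nb: "b \<notin> vec.span B" and ind: "vec.independent B"
        using insert.prems insert.hyps by (auto simp: vec.independent_insert)
      have "vec.span (insert b B) = (\<lambda>(k, v). k *s b + v) ` (UNIV \<times> vec.span B)"
        (is "_ = ?f ` _")
      proof (intro set_eqI iffI)
        fix x assume "x \<in> vec.span (insert b B)"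
        then obtain k where "x - k *s b \<in> vec.span B" using vec.span_breakdown_eq by blast
        then show "x \<in> ?f ` (UNIV \<times> vec.span B)"
          by (intro image_eqI[of _ _ "(k, x - k *s b)"]) auto
      next
        fix x assume "x \<in> ?f ` (UNIV \<times> vec.span B)"
        then obtain k v where "x = k *s b + v" "v \<in> vec.span B" by auto
        then show "x \<in> vec.span (insert b B)" using vec.span_breakdown_eq[of x b B]
          by (metis add_diff_cancel_left')
      qed
      moreover have "inj_on ?f (UNIV \<times> vec.span B)"
      proof (rule inj_onI, clarsimp)
        fix k v k' v' assume v: "v \<in> vec.span B" "v' \<in> vec.span B"
          and eq: "k *s b + v = k' *s b + v'"
        have "(k - k') *s b = v' - v"
          using eq by (simp add: vec.scale_left_diff_distrib algebra_simps)
        then have in_span: "(k - k') *s b \<in> vec.span B" using v by (simp add: vec.span_diff)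
        have "k = k'"
        proof (rule ccontr)
          assume "k \<noteq> k'"
          then have "inverse (k - k') *s ((k - k') *s b) = b" by simp
          then show False using nb vec.span_scale[OF in_span] by metis
        qed
        then show "k = k' \<and> v = v'" using eq by simp
      qed
      ultimately show ?case using insert ind
        by (simp add: card_image card_cartesian_product)
    qed simp
  qed
  moreover obtain B where "B \<subseteq> X" "vec.independent B" "X \<subseteq> vec.span B" "card B = vec.dim X"
    using vec.basis_exists by blast
  moreover from this have "vec.span B = X" using assms
    by (simp add: vec.span_minimal subset_antisym)
  ultimately show ?thesis by metis
qed

lemma CARD_field_ge2: "CARD('a::{field,finite}) \<ge> 2"
proof -
  have "card {0, 1 :: 'a} \<le> CARD('a)" by (intro card_mono) auto
  then show ?thesis by simp
qed

lemma points_disjoint: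
  assumes "L \<in> points X" "M \<in> points Y" "x \<in> L" "x \<in> M" "x \<noteq> 0"
  shows "L = M"
  using assms dim1_eqI unfolding points_def by blast

lemma card_vectors_of_points:
  fixes P :: "('a::{field,finite} ^ 'v) set set"
  assumes "P \<subseteq> points X"
  shows "card (\<Union>L\<in>P. L - {0}) = (CARD('a) - 1) * card P"
proof -
  have "card (\<Union>L\<in>P. L - {0}) = (\<Sum>L\<in>P. card (L - {0}))"
  proof (rule card_UN_disjoint)
    show "\<forall>L\<in>P. \<forall>M\<in>P. L \<noteq> M \<longrightarrow> (L - {0}) \<inter> (M - {0}) = {}"
    proof (intro ballI impI, rule ccontr)
      fix L M assume "L \<in> P" "M \<in> P" "L \<noteq> M" "(L - {0}) \<inter> (M - {0}) \<noteq> {}"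
      then show False using points_disjoint[of L X M X] assms by blast
    qed
  qed auto
  also have "\<dots> = (\<Sum>L\<in>P. CARD('a) - 1)"
  proof (rule sum.cong[OF refl])
    fix L assume "L \<in> P"
    then have "vec.subspace L" "vec.dim L = 1" using assms by (auto simp: points_def)
    then show "card (L - {0}) = CARD('a) - 1"
      by (simp add: card_subspace card_Diff_singleton vec.subspace_0)
  qed
  finally show ?thesis by simp
qed

lemma union_points:
  assumes "vec.subspace X"
  shows "(\<Union>L\<in>points X. L - {0}) = X - {0 :: 'a::field ^ 'v}"
proof (intro equalityI subsetI)
  fix x assume "x \<in> X - {0}"
  then have "vec.span {x} \<in> points X" "x \<in> vec.span {x} - {0}"
    using assms by (auto simp: points_def vec.span_base vec.span_minimal)
  then show "x \<in> (\<Union>L\<in>points X. L - {0})" by blast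
qed (auto simp: points_def)

lemma card_points:
  fixes X :: "('a::{field,finite} ^ 'v) set"
  assumes "vec.subspace X"
  shows "card (points X) = num_points CARD('a) (vec.dim X)"
proof -
  have q: "CARD('a) \<ge> 2" by (rule CARD_field_ge2)
  have "(CARD('a) - 1) * card (points X) = card (X - {0})"
    using card_vectors_of_points[of "points X" X] union_points[OF assms] by simp
  also have "\<dots> = CARD('a) ^ vec.dim X - 1"
    using assms by (simp add: card_subspace vec.subspace_0 card_Diff_singleton)
  also have "\<dots> = (CARD('a) - 1) * num_points CARD('a) (vec.dim X)"
    using num_points_mult[of "CARD('a)" "vec.dim X"] q by linarith
  finally show ?thesis using q by simp
qed

lemma card_le_points:
  fixes X :: "('a::{field,finite} ^ 'v) set"
  assumes "vec.subspace X" "inj_on f G" "f ` G \<subseteq> points X"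
  shows "card G \<le> num_points CARD('a) (vec.dim X)"
proof -
  have "card G = card (f ` G)" using assms(2) by (simp add: card_image)
  also have "\<dots> \<le> card (points X)" by (rule card_mono[OF _ assms(3)]) simp
  finally show ?thesis using card_points[OF assms(1)] by simp
qed

text \<open>A proper subspace of \<open>X\<close> has too few points to contain all \<open>f g\<close>.\<close>

lemma many_points_span:
  fixes X :: "('a::{field,finite} ^ 'v) set"
  assumes "vec.subspace X" "vec.subspace Y" "vec.dim X = Suc k"
    and "inj_on f G" "f ` G \<subseteq> points X" "\<And>g. g \<in> G \<Longrightarrow> f g \<subseteq> Y"
    and "card G > num_points CARD('a) k"
  shows "X \<subseteq> Y"
proof (rule ccontr)
  assume "\<not> X \<subseteq> Y"
  then have "X \<inter> Y \<subset> X" by auto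
  then have "vec.dim (X \<inter> Y) < vec.dim X"
    using assms(1,2) by (intro vec.dim_psubset)
      (simp add: vec.span_eq_iff[THEN iffD2] vec.subspace_inter)
  then have "vec.dim (X \<inter> Y) \<le> k" using assms(3) by simp
  moreover have "f ` G \<subseteq> points (X \<inter> Y)"
    using assms(5,6) by (fastforce simp: points_def)
  then have "card G \<le> num_points CARD('a) (vec.dim (X \<inter> Y))"
    by (intro card_le_points[OF _ assms(4)] vec.subspace_inter assms)
  ultimately show False using assms(7) num_points_mono[of "vec.dim (X \<inter> Y)" k "CARD('a)"] by linarith
qed

definition pencil :: "('a::field ^ 'v) set \<Rightarrow> ('a ^ 'v) set \<Rightarrow> ('a ^ 'v) set set" where
  "pencil e X = {l. vec.subspace l \<and> vec.dim l = 2 \<and> e \<subseteq> l \<and> l \<subseteq> X}"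

lemma join_points_dim:
  assumes "e \<in> points X" "p \<in> points X" "p \<noteq> e"
  shows "vec.dim (join e p) = 2" "e \<inter> p = {0}"
proof -
  have ep: "vec.subspace e" "vec.dim e = 1" "vec.subspace p" "vec.dim p = 1"
    using assms by (auto simp: points_def)
  show "e \<inter> p = {0}" using points_disjoint[OF assms(1,2)] assms(3) ep
    by (auto simp: vec.subspace_0)
  then show "vec.dim (join e p) = 2" using dim_join[of e p] ep by simp
qed

lemma pencil_join:
  assumes "vec.subspace X" "e \<in> points X" "p \<in> points X" "p \<noteq> e"
  shows "join e p \<in> pencil e X"
proof -
  have "join e p \<subseteq> X" using assms by (intro join_least) (auto simp: points_def)
  then show ?thesis
    using join_points_dim(1)[OF assms(2-4)] join_upper(1)[of e p] by (simp add: pencil_def)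
qed

lemma pencil_unique:
  assumes "l \<in> pencil e X" "e \<in> points X" "p \<in> points X" "p \<noteq> e" "p \<subseteq> l"
  shows "l = join e p"
proof -
  have "join e p \<subseteq> l" using assms by (intro join_least) (auto simp: pencil_def)
  then show ?thesis
    using join_points_dim(1)[OF assms(2-4)] assms(1)
    by (intro subspace_eqI[symmetric]) (auto simp: pencil_def)
qed

text \<open>
  The lines through \<open>e\<close> partition the other points.
\<close>

lemma sum_pencil:
  fixes X :: "('a::{field,finite} ^ 'v) set"
  assumes "vec.subspace X" "e \<in> points X" "inj_on f G" "\<And>g. g \<in> G \<Longrightarrow> f g \<in> points X - {e}"
  shows "(\<Sum>l\<in>pencil e X. card {g\<in>G. f g \<subseteq> l}) = card G"
proof -
  have fin: "finite G" using assms(3) finite_imageD finite by blast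
  have "G = (\<Union>l\<in>pencil e X. {g\<in>G. f g \<subseteq> l})"
  proof (intro equalityI subsetI)
    fix g assume "g \<in> G"
    then have "join e (f g) \<in> pencil e X" using pencil_join[OF assms(1,2)] assms(4) by auto
    then show "g \<in> (\<Union>l\<in>pencil e X. {g\<in>G. f g \<subseteq> l})"
      using \<open>g \<in> G\<close> join_upper(2)[of "f g" e] by blast
  qed auto
  moreover have "card (\<Union>l\<in>pencil e X. {g\<in>G. f g \<subseteq> l}) = (\<Sum>l\<in>pencil e X. card {g\<in>G. f g \<subseteq> l})"
  proof (rule card_UN_disjoint)
    show "\<forall>l\<in>pencil e X. finite {g\<in>G. f g \<subseteq> l}" using fin by simp
    show "\<forall>l\<in>pencil e X. \<forall>m\<in>pencil e X. l \<noteq> m \<longrightarrow> {g\<in>G. f g \<subseteq> l} \<inter> {g\<in>G. f g \<subseteq> m} = {}"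
    proof (intro ballI impI, rule ccontr)
      fix l m assume lm: "l \<in> pencil e X" "m \<in> pencil e X" "l \<noteq> m"
        and "{g\<in>G. f g \<subseteq> l} \<inter> {g\<in>G. f g \<subseteq> m} \<noteq> {}"
      then obtain g where "g \<in> G" "f g \<subseteq> l" "f g \<subseteq> m" by blast
      moreover have "f g \<in> points X" "f g \<noteq> e" using assms(4) \<open>g \<in> G\<close> by auto
      ultimately show False using pencil_unique[OF _ assms(2), of _ "f g"] lm by metis
    qed
  qed simp
  ultimately show ?thesis by simp
qed

lemma card_points_on_pencil_line:
  fixes X :: "('a::{field,finite} ^ 'v) set"
  assumes "l \<in> pencil e X" "e \<in> points X"
  shows "card {p \<in> points X - {e}. p \<subseteq> l} = CARD('a)"
proof -
  have "{p \<in> points X - {e}. p \<subseteq> l} = points l - {e}" "e \<in> points l"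
    using assms by (auto simp: points_def pencil_def)
  moreover have "card (points l) = CARD('a) + 1"
    using assms card_points[of l] by (simp add: pencil_def num_points_2)
  ultimately show ?thesis by simp
qed

lemma card_pencil:
  fixes X :: "('a::{field,finite} ^ 'v) set"
  assumes "vec.subspace X" "e \<in> points X" "vec.dim X = Suc k"
  shows "card (pencil e X) = num_points CARD('a) k"
proof -
  have "(\<Sum>l\<in>pencil e X. card {p \<in> points X - {e}. p \<subseteq> l}) = card (points X - {e})"
    by (intro sum_pencil assms) auto
  then have "card (pencil e X) * CARD('a) = card (points X) - 1"
    using card_points_on_pencil_line[OF _ assms(2)] assms(2) by simp
  then have "card (pencil e X) * CARD('a) = num_points CARD('a) k * CARD('a)"
    using card_points[OF assms(1)] assms(3) by (simp add: num_points_Suc)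
  then show ?thesis using CARD_field_ge2[where 'a='a] by simp
qed

section \<open>Lines of a partial dual arc\<close>

text \<open>
  The number \<open>d\<close> of missing elements satisfies \<open>2d + 7 \<le> q\<close> for both parities of \<open>q\<close>.  The last
  assumption is what the condition on the dimensions of spans says about three elements.
\<close>

locale partial_dual_arc =
  fixes F :: "('a::{field,finite} ^ 'v) set set" and n d :: nat
  assumes n2: "n \<ge> 2"
    and q_bound: "2 * d + 7 \<le> CARD('a)"
    and ambient: "CARD('v) = n * (n + 3) div 2 + 1"
    and card_F: "card F + d = num_points CARD('a) (n + 1)"
    and subF: "\<And>U. U \<in> F \<Longrightarrow> vec.subspace U"
    and dimF: "\<And>U. U \<in> F \<Longrightarrow> vec.dim U = n + 1"
    and dim_meet: "\<And>U V. U \<in> F \<Longrightarrow> V \<in> F \<Longrightarrow> U \<noteq> V \<Longrightarrow> vec.dim (U \<inter> V) = 1"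
    and skew: "\<And>U V W. U \<in> F \<Longrightarrow> V \<in> F \<Longrightarrow> W \<in> F \<Longrightarrow> U \<noteq> V \<Longrightarrow> U \<noteq> W \<Longrightarrow> V \<noteq> W \<Longrightarrow>
                 U \<inter> V \<inter> W = {0}"
    and span_F: "vec.span (\<Union>F) = UNIV"
    and dim_meet_join: "\<And>U V W. U \<in> F \<Longrightarrow> V \<in> F \<Longrightarrow> W \<in> F \<Longrightarrow> U \<noteq> V \<Longrightarrow>
                 \<not> W \<subseteq> join U V \<Longrightarrow> vec.dim (W \<inter> join U V) = 2"
begin

definition line :: "('a ^ 'v) set \<Rightarrow> ('a ^ 'v) set \<Rightarrow> ('a ^ 'v) set set" where
  "line U V = {S \<in> F. S \<subseteq> join U V}"

lemma line_mem: "S \<in> line U V \<longleftrightarrow> S \<in> F \<and> S \<subseteq> join U V"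
  by (simp add: line_def)

lemma ends_in_line: "U \<in> F \<Longrightarrow> V \<in> F \<Longrightarrow> U \<in> line U V \<and> V \<in> line U V"
  using join_upper[of U V] join_upper[of V U] by (auto simp: line_mem join_def)

lemma subspace_meet: "U \<in> F \<Longrightarrow> V \<in> F \<Longrightarrow> vec.subspace (U \<inter> V)"
  by (simp add: subF vec.subspace_inter)

lemma meet_points: "U \<in> F \<Longrightarrow> V \<in> F \<Longrightarrow> U \<noteq> V \<Longrightarrow> U \<inter> V \<in> points V"
  by (simp add: points_def subspace_meet dim_meet)

lemma skewD:
  "U \<in> F \<Longrightarrow> V \<in> F \<Longrightarrow> W \<in> F \<Longrightarrow> U \<noteq> V \<Longrightarrow> U \<noteq> W \<Longrightarrow> V \<noteq> W \<Longrightarrow>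
    x \<in> U \<Longrightarrow> x \<in> V \<Longrightarrow> x \<in> W \<Longrightarrow> x = 0"
  using skew[of U V W] by blast

lemma ex_meet: "U \<in> F \<Longrightarrow> V \<in> F \<Longrightarrow> \<exists>x. x \<in> U \<and> x \<in> V \<and> x \<noteq> 0"
proof -
  assume UV: "U \<in> F" "V \<in> F"
  have "vec.dim (U \<inter> V) \<ge> 1" using UV dim_meet[of U V] dimF[of U] by (cases "U = V") simp_all
  then show ?thesis using dim_pos_ex[OF subspace_meet[OF UV]] by blast
qed

lemma meet_multiple:
  assumes "U \<in> F" "V \<in> F" "U \<noteq> V" "x \<in> U" "x \<in> V" "x \<noteq> 0" "y \<in> U" "y \<in> V"
  obtains c where "y = c *s x"
  using dim1_multiple[OF subspace_meet dim_meet, of U V x y] assms by blast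

lemma meet_indep:
  assumes "U \<in> F" "V \<in> F" "W \<in> F" "U \<noteq> V" "U \<noteq> W" "V \<noteq> W"
    and "x \<in> U" "x \<in> V" "x \<noteq> 0" "y \<in> U" "y \<in> W" "y \<noteq> 0"
  shows "y \<notin> vec.span {x}"
proof
  assume "y \<in> vec.span {x}"
  then have "y \<in> V" using span_singleton_subset[of V x] assms subF by blast
  then show False using skewD[of U V W y] assms by blast
qed

lemma inj_meet: "W \<in> F \<Longrightarrow> inj_on (\<lambda>S. S \<inter> W) (F - {W})"
proof (rule inj_onI)
  fix S R assume *: "W \<in> F" "S \<in> F - {W}" "R \<in> F - {W}" "S \<inter> W = R \<inter> W"
  obtain x where "x \<in> S" "x \<in> W" "x \<noteq> 0" using ex_meet[of S W] * by blast
  then show "S = R" using skewD[of S R W x] * by blast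
qed

lemma dim_join_F: "U \<in> F \<Longrightarrow> V \<in> F \<Longrightarrow> U \<noteq> V \<Longrightarrow> vec.dim (join U V) = 2 * n + 1"
  using dim_join[of U V] by (simp add: subF dimF dim_meet)

lemma join_eq:
  assumes "U \<in> F" "V \<in> F" "U \<noteq> V" "S \<in> line U V" "S \<noteq> U"
  shows "join U S = join U V"
  using assms dim_join_F[of U S] dim_join_F[of U V] join_upper(1)[of U V]
  by (intro subspace_eqI join_least) (auto simp: line_mem)

lemma line_eq:
  assumes "U \<in> F" "V \<in> F" "U \<noteq> V" "S \<in> line U V" "S \<noteq> U"
  shows "line U S = line U V"
  using join_eq[OF assms] by (simp add: line_def)

lemma line_commute: "line U V = line V U"
  by (simp add: line_def join_commute)

lemma ex_off_line:
  assumes "U \<in> F" "V \<in> F" "U \<noteq> V"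
  shows "\<exists>S\<in>F. \<not> S \<subseteq> join U V"
proof (rule ccontr)
  assume "\<not> ?thesis"
  then have "vec.span (\<Union>F) \<subseteq> join U V" by (intro vec.span_minimal) auto
  then have "join U V = UNIV" using span_F by auto
  then have "2 * n + 1 = CARD('v)"
    using dim_join_F[OF assms] by (simp add: card_cart_basis)
  then have "n * (n + 3) div 2 = 2 * n" using ambient by simp
  moreover have "n * (n + 3) = 2 * (n * (n + 3) div 2)"
    by simp
  ultimately have "n * (n + 3) = n * 4" by linarith
  then have "n = 0 \<or> n + 3 = 4" by (metis mult_cancel1)
  then show False using n2 by linarith
qed

lemma card_line_le:
  assumes "U \<in> F" "V \<in> F" "U \<noteq> V"
  shows "card (line U V) \<le> CARD('a) + 1"
proof -
  obtain S where S: "S \<in> F" "\<not> S \<subseteq> join U V" using ex_off_line[OF assms] by blast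
  have "card (line U V) \<le> num_points CARD('a) (vec.dim (S \<inter> join U V))"
  proof (rule card_le_points[where f = "\<lambda>R. R \<inter> S"])
    show "vec.subspace (S \<inter> join U V)" using S subF by (simp add: vec.subspace_inter)
    show "inj_on (\<lambda>R. R \<inter> S) (line U V)"
      by (rule inj_on_subset[OF inj_meet[OF S(1)]]) (use S in \<open>auto simp: line_mem\<close>)
    show "(\<lambda>R. R \<inter> S) ` line U V \<subseteq> points (S \<inter> join U V)"
    proof (rule image_subsetI)
      fix R assume "R \<in> line U V"
      then show "R \<inter> S \<in> points (S \<inter> join U V)"
        using meet_points[of R S] S by (auto simp: points_def line_mem)
    qed
  qed
  then show ?thesis using dim_meet_join[OF assms(1,2) S(1) assms(3) S(2)]
    by (simp add: num_points_2)
qed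

text \<open>
  In the model the two line spaces are \<open>uV + vV\<close> and \<open>uV + wV\<close>; they meet in \<open>uV\<close> and the
  point \<open>vw\<close>.
\<close>

lemma dim_join_meet:
  assumes "U \<in> F" "V \<in> F" "W \<in> F" "U \<noteq> V" "\<not> W \<subseteq> join U V"
  shows "vec.dim (join U V \<inter> join U W) = n + 2"
proof -
  have WU: "W \<noteq> U" using assms join_upper by blast
  have "join (join U V) (join U W) = join (join U V) W"
  proof (intro equalityI join_least subspace_join)
    have "join U V \<subseteq> join (join U V) W" "join U V \<subseteq> join (join U V) (join U W)"
      by (rule join_upper)+
    then show "U \<subseteq> join (join U V) W" "V \<subseteq> join (join U V) W"
      "U \<subseteq> join (join U V) (join U W)" "V \<subseteq> join (join U V) (join U W)"
      using join_upper(1)[of U V] join_upper(2)[of V U] by blast+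
    show "W \<subseteq> join (join U V) W" by (rule join_upper)
    show "W \<subseteq> join (join U V) (join U W)"
      using join_upper(2)[of W U] join_upper(2)[of "join U W" "join U V"] by blast
  qed (use join_upper(1)[of U V] join_upper(1)[of "join U V" W] in blast)
  moreover have "vec.dim (join (join U V) W) + 2 = 2 * n + 1 + (n + 1)"
    using dim_join[of "join U V" W] dim_meet_join[OF assms(1-5)] assms
    by (simp add: subF dimF dim_join_F Int_commute)
  ultimately show ?thesis
    using dim_join[of "join U V" "join U W"] dim_join_F[of U V] dim_join_F[of U W] assms WU n2
    by simp
qed

lemma join_point_pencil_dim:
  assumes "U0 \<in> F" "U1 \<in> F" "U0 \<noteq> U1" "l \<in> pencil (U0 \<inter> U1) U1"
  shows "vec.dim (join U0 l) = n + 2"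
proof -
  have "U0 \<inter> l = U0 \<inter> U1" using assms(4) by (auto simp: pencil_def)
  then show ?thesis using dim_join[of U0 l] assms by (simp add: subF dimF dim_meet pencil_def)
qed

end

text \<open>
  The line spaces \<open>join U0 S\<close> of the members of \<open>G\<close> share one space \<open>T\<close> that is larger than \<open>U0\<close> by one
  dimension; in the model \<open>T = uV + \<langle>vw\<rangle>\<close>.  Members on different lines through \<open>U0\<close> then meet inside
  \<open>T\<close>, and if there are several lines, \<open>T\<close> contains a projective line of each member.
\<close>

locale star = partial_dual_arc +
  fixes U0 G T
  assumes U0: "U0 \<in> F" and G: "G \<subseteq> F - {U0}"
    and T: "vec.subspace T" "vec.dim T = n + 2" "U0 \<subseteq> T" "\<And>S. S \<in> G \<Longrightarrow> T \<subseteq> join U0 S"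
begin

lemma GF: "S \<in> G \<Longrightarrow> S \<in> F" "S \<in> G \<Longrightarrow> S \<noteq> U0"
  using G by auto

lemma off_sym:
  assumes "S \<in> G" "R \<in> G" "\<not> S \<subseteq> join U0 R"
  shows "\<not> R \<subseteq> join U0 S"
proof
  assume "R \<subseteq> join U0 S"
  then have "join U0 R = join U0 S" using join_eq[of U0 S R] U0 GF assms by (auto simp: line_mem)
  then show False using assms(3) join_upper(2)[of S U0] by simp
qed

lemma meet_joins:
  assumes "S \<in> G" "R \<in> G" "\<not> S \<subseteq> join U0 R"
  shows "join U0 R \<inter> join U0 S = T"
proof (rule subspace_eqI[symmetric])
  have "U0 \<noteq> R" using GF(2) assms(2) by blast
  then show "vec.dim (join U0 R \<inter> join U0 S) \<le> vec.dim T"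
    using dim_join_meet[of U0 R S] assms GF(1) U0 T(2) by simp
qed (use assms T in \<open>auto simp: vec.subspace_inter\<close>)

lemma meet_in_T:
  assumes "S \<in> G" "R \<in> G" "\<not> S \<subseteq> join U0 R"
  shows "S \<inter> R \<subseteq> T"
  using meet_joins[OF assms] join_upper(2)[of S U0] join_upper(2)[of R U0] by blast

lemma dim_trace:
  assumes "S \<in> G" "R \<in> G" "\<not> S \<subseteq> join U0 R"
  shows "vec.dim (S \<inter> T) = 2"
proof -
  have "S \<inter> T = S \<inter> join U0 R" using meet_joins[OF assms] join_upper(2)[of S U0] by blast
  then show ?thesis using dim_meet_join[of U0 R S] U0 GF assms by auto
qed

lemma subspace_trace: "S \<in> G \<Longrightarrow> vec.subspace (S \<inter> T)"
  using GF T subF by (simp add: vec.subspace_inter)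

lemma trace_subset:
  assumes "S \<in> G" "R1 \<in> G" "R2 \<in> G" "R1 \<noteq> R2" "\<not> S \<subseteq> join U0 R1" "\<not> S \<subseteq> join U0 R2"
    and "vec.subspace E" "R1 \<inter> T \<subseteq> E" "R2 \<inter> T \<subseteq> E"
  shows "S \<inter> T \<subseteq> E"
proof -
  have ne: "S \<noteq> R1" "S \<noteq> R2" using assms(5,6) join_upper(2) by blast+
  obtain x where x: "x \<in> S" "x \<in> R1" "x \<noteq> 0" using ex_meet[of S R1] GF(1) assms(1,2) by blast
  obtain y where y: "y \<in> S" "y \<in> R2" "y \<noteq> 0" using ex_meet[of S R2] GF(1) assms(1,3) by blast
  have xy: "x \<in> T" "y \<in> T"
    using meet_in_T[OF assms(1,2,5)] meet_in_T[OF assms(1,3,6)] x y by auto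
  have "y \<notin> vec.span {x}"
    by (rule meet_indep[of S R1 R2]) (use ne assms(1-4) GF x y in auto)
  then show ?thesis
    by (intro dim2_subset[of "S \<inter> T" x y E] subspace_trace[OF assms(1)] dim_trace[OF assms(1,2,5)])
      (use x y xy assms in auto)
qed

lemma coplanar:
  assumes "S1 \<in> G" "S2 \<in> G" "S3 \<in> G"
    and "\<not> S2 \<subseteq> join U0 S1" "\<not> S3 \<subseteq> join U0 S1" "\<not> S3 \<subseteq> join U0 S2"
  obtains E where "vec.subspace E" "vec.dim E = 3" "E \<subseteq> T" "\<And>S. S \<in> G \<Longrightarrow> S \<inter> T \<subseteq> E"
proof -
  define E where "E = join (S1 \<inter> T) (S2 \<inter> T)"
  have ne: "S1 \<noteq> S2" "S1 \<noteq> S3" "S2 \<noteq> S3" using assms join_upper(2) by blast+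
  have off: "\<not> S1 \<subseteq> join U0 S2" "\<not> S1 \<subseteq> join U0 S3" "\<not> S2 \<subseteq> join U0 S3"
    using off_sym assms by blast+
  have "S1 \<inter> T \<inter> (S2 \<inter> T) = S1 \<inter> S2" using meet_in_T[of S2 S1] assms by blast
  then have dE: "vec.dim E = 3"
    using dim_join[of "S1 \<inter> T" "S2 \<inter> T"] dim_trace[of S1 S2] dim_trace[of S2 S1]
      assms off ne dim_meet[of S1 S2] GF subspace_trace
    by (simp add: E_def)
  have E: "vec.subspace E" "S1 \<inter> T \<subseteq> E" "S2 \<inter> T \<subseteq> E"
    unfolding E_def by (rule subspace_join join_upper)+
  have S3: "S3 \<inter> T \<subseteq> E"
    by (rule trace_subset[OF assms(3,1,2) ne(1) assms(5,6) E])
  have "S \<inter> T \<subseteq> E" if S: "S \<in> G" for S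
  proof -
    have one: "\<not> (S \<subseteq> join U0 R \<and> S \<subseteq> join U0 R')"
      if "R \<in> G" "R' \<in> G" "\<not> R \<subseteq> join U0 R'" for R R'
    proof
      assume *: "S \<subseteq> join U0 R \<and> S \<subseteq> join U0 R'"
      then have "join U0 S = join U0 R" "join U0 S = join U0 R'"
        using join_eq[of U0 R S] join_eq[of U0 R' S] U0 GF S that by (auto simp: line_mem)
      then show False using that(3) join_upper(2)[of R U0] by simp
    qed
    consider "\<not> S \<subseteq> join U0 S1 \<and> \<not> S \<subseteq> join U0 S2"
      | "\<not> S \<subseteq> join U0 S1 \<and> \<not> S \<subseteq> join U0 S3"
      | "\<not> S \<subseteq> join U0 S2 \<and> \<not> S \<subseteq> join U0 S3"
      using one[of S2 S1] one[of S3 S1] one[of S3 S2] assms by blast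
    then show ?thesis
    proof cases
      case 1
      then show ?thesis using trace_subset[OF S assms(1,2) ne(1) _ _ E(1)] E S3 by simp
    next
      case 2
      then show ?thesis using trace_subset[OF S assms(1,3) ne(2) _ _ E(1)] E S3 by simp
    next
      case 3
      then show ?thesis using trace_subset[OF S assms(2,3) ne(3) _ _ E(1)] E S3 by simp
    qed
  qed
  moreover have "E \<subseteq> T" unfolding E_def using T(1) by (intro join_least) auto
  ultimately show ?thesis using that[OF E(1) dE] by blast
qed

text \<open>
  If the traces \<open>S \<inter> T\<close> are in one plane, they form a dual arc together with the trace of \<open>U0\<close>: the
  others cut one of them in distinct points.
\<close>

lemma planar_meets:
  assumes "vec.subspace E" "vec.dim E = 3" "\<And>S. S \<in> G \<Longrightarrow> S \<inter> T \<subseteq> E"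
    and "\<And>S. S \<in> G \<Longrightarrow> vec.dim (S \<inter> T) = 2" "S \<in> G" "R \<in> G" "R \<noteq> S"
  shows "R \<inter> S \<subseteq> T"
proof -
  have "join (R \<inter> T) (S \<inter> T) \<subseteq> E" using assms by (intro join_least) auto
  then have "vec.dim (join (R \<inter> T) (S \<inter> T)) \<le> 3" using assms(2) vec.dim_subset by metis
  then have "vec.dim ((R \<inter> T) \<inter> (S \<inter> T)) \<ge> 1"
    using dim_join[of "R \<inter> T" "S \<inter> T"] assms subspace_trace by simp
  then obtain x where x: "x \<in> R" "x \<in> S" "x \<in> T" "x \<noteq> 0"
    using dim_pos_ex[of "(R \<inter> T) \<inter> (S \<inter> T)"] assms subspace_trace
    by (auto simp: vec.subspace_inter)
  show ?thesis
  proof (intro subsetI)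
    fix y assume "y \<in> R \<inter> S"
    then obtain c where "y = c *s x"
      using meet_multiple[of R S x y] GF assms(5-7) x by blast
    then show "y \<in> T" using x(3) T(1) by (simp add: vec.subspace_scale)
  qed
qed

lemma planar_points:
  assumes "vec.subspace E" "vec.dim E = 3" "\<And>S. S \<in> G \<Longrightarrow> S \<inter> T \<subseteq> E"
    and "\<And>S. S \<in> G \<Longrightarrow> vec.dim (S \<inter> T) = 2" "S \<in> G"
  shows "inj_on (\<lambda>R. R \<inter> S) (insert U0 G - {S})"
    "(\<lambda>R. R \<inter> S) ` (insert U0 G - {S}) \<subseteq> points (S \<inter> T)"
proof -
  show "inj_on (\<lambda>R. R \<inter> S) (insert U0 G - {S})"
    by (rule inj_on_subset[OF inj_meet]) (use U0 GF assms(5) in auto)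
  have sub_T: "R \<inter> S \<subseteq> T" if "R \<in> insert U0 G - {S}" for R
    using planar_meets[OF assms, of R] T(3) that by blast
  show "(\<lambda>R. R \<inter> S) ` (insert U0 G - {S}) \<subseteq> points (S \<inter> T)"
  proof (intro image_subsetI)
    fix R assume R: "R \<in> insert U0 G - {S}"
    then have "R \<inter> S \<in> points S" using meet_points[of R S] U0 GF(1) assms(5) by auto
    then show "R \<inter> S \<in> points (S \<inter> T)" using sub_T[OF R] by (simp add: points_def)
  qed
qed

lemma planar_card:
  assumes "vec.subspace E" "vec.dim E = 3" "\<And>S. S \<in> G \<Longrightarrow> S \<inter> T \<subseteq> E"
    and "\<And>S. S \<in> G \<Longrightarrow> vec.dim (S \<inter> T) = 2" "S \<in> G"
  shows "card G \<le> CARD('a) + 1"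
proof -
  have "card (insert U0 G - {S}) \<le> num_points CARD('a) (vec.dim (S \<inter> T))"
    using planar_points[OF assms] subspace_trace[OF assms(5)] by (intro card_le_points)
  moreover have "card (insert U0 G - {S}) = card G"
    using assms(5) GF U0 by (auto simp: card_insert_if)
  ultimately show ?thesis using assms by (simp add: num_points_2)
qed

end

section \<open>Existence of long lines\<close>

lemma even_card_involution:
  assumes "finite A" "\<And>x. x \<in> A \<Longrightarrow> h x \<in> A" "\<And>x. x \<in> A \<Longrightarrow> h (h x) = x" "\<And>x. x \<in> A \<Longrightarrow> h x \<noteq> x"
  shows "even (card A)"
  using assms
proof (induction A rule: finite_psubset_induct)
  case (psubset A)
  show ?case
  proof (cases "A = {}")
    case False
    then obtain x where x: "x \<in> A" by blast
    define B where "B = A - {x, h x}"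
    have "even (card B)"
    proof (rule psubset.IH)
      show "B \<subset> A" using x by (auto simp: B_def)
      show "h y \<in> B" if "y \<in> B" for y
        using that psubset.prems x unfolding B_def by (metis Diff_iff insert_iff empty_iff)
    qed (use psubset.prems in \<open>auto simp: B_def\<close>)
    moreover have "card A = card B + 2"
    proof -
      have "card {x, h x} = 2" using psubset.prems(3)[OF x] by simp
      moreover have "{x, h x} \<subseteq> A" using x psubset.prems by auto
      ultimately show ?thesis
        using card_Diff_subset[of "{x, h x}" A] card_mono[OF psubset.hyps(1), of "{x, h x}"]
        by (simp add: B_def)
    qed
    ultimately show ?thesis by simp
  qed simp
qed

context partial_dual_arc
begin

text \<open>
  The members off the line of \<open>U0\<close> and \<open>U1\<close>, sorted by their point on \<open>U1\<close>: they are distributed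
  over the lines \<open>l\<close> of \<open>U1\<close> through \<open>U0 \<inter> U1\<close>.  Members on one line through \<open>U0\<close> are in one portion.
\<close>

definition off :: "('a ^ 'v) set \<Rightarrow> ('a ^ 'v) set \<Rightarrow> ('a ^ 'v) set \<Rightarrow> ('a ^ 'v) set set" where
  "off U0 U1 l = {S \<in> F. \<not> S \<subseteq> join U0 U1 \<and> S \<inter> U1 \<subseteq> l}"

lemma num_points_n_ge: "num_points CARD('a) n \<ge> CARD('a) + 1"
  using num_points_mono[OF n2] by (simp add: num_points_2)

lemma off_neq: "S \<in> off U0 U1 l \<Longrightarrow> S \<in> F" "S \<in> off U0 U1 l \<Longrightarrow> S \<noteq> U0" "S \<in> off U0 U1 l \<Longrightarrow> S \<noteq> U1"
  using join_upper[of U0 U1] join_upper(2)[of U1 U0] by (auto simp: off_def)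

lemma off_point:
  assumes "U0 \<in> F" "U1 \<in> F" "U0 \<noteq> U1" "S \<in> F" "\<not> S \<subseteq> join U0 U1"
  shows "S \<inter> U1 \<in> points U1 - {U0 \<inter> U1}"
proof -
  have ne: "S \<noteq> U0" "S \<noteq> U1" using assms(5) join_upper(1)[of U0 U1] join_upper(2)[of U1 U0] by auto
  have "S \<inter> U1 \<noteq> U0 \<inter> U1" using inj_onD[OF inj_meet[OF assms(2)], of S U0] ne assms by auto
  then show ?thesis using meet_points[of S U1] ne assms by simp
qed

lemma sum_off:
  assumes "U0 \<in> F" "U1 \<in> F" "U0 \<noteq> U1"
  shows "(\<Sum>l\<in>pencil (U0 \<inter> U1) U1. card (off U0 U1 l)) + d + card (line U0 U1)
           = CARD('a) * num_points CARD('a) n + 1"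
proof -
  let ?G = "F - line U0 U1"
  have "(\<Sum>l\<in>pencil (U0 \<inter> U1) U1. card {S \<in> ?G. S \<inter> U1 \<subseteq> l}) = card ?G"
  proof (rule sum_pencil[OF subF[OF assms(2)] meet_points[OF assms]])
    have "U1 \<notin> ?G" using ends_in_line[OF assms(1,2)] by simp
    then show "inj_on (\<lambda>S. S \<inter> U1) ?G" by (intro inj_on_subset[OF inj_meet[OF assms(2)]]) auto
    show "S \<inter> U1 \<in> points U1 - {U0 \<inter> U1}" if "S \<in> ?G" for S
      using off_point[OF assms] that by (simp add: line_mem)
  qed
  moreover have "{S \<in> ?G. S \<inter> U1 \<subseteq> l} = off U0 U1 l" for l
    by (auto simp: off_def line_mem)
  ultimately have "(\<Sum>l\<in>pencil (U0 \<inter> U1) U1. card (off U0 U1 l)) = card ?G" by simp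
  moreover have "card ?G + card (line U0 U1) = card F"
  proof -
    have "line U0 U1 \<subseteq> F" by (auto simp: line_def)
    then show ?thesis using card_mono[of F "line U0 U1"] by (simp add: card_Diff_subset)
  qed
  moreover have "card F + d = CARD('a) * num_points CARD('a) n + 1"
    using card_F by (simp add: num_points_Suc)
  ultimately show ?thesis by linarith
qed

lemma card_pencil_F:
  assumes "U0 \<in> F" "U1 \<in> F" "U0 \<noteq> U1"
  shows "card (pencil (U0 \<inter> U1) U1) = num_points CARD('a) n"
  using card_pencil[OF subF[OF assms(2)] meet_points[OF assms]] dimF[OF assms(2)] by simp

lemma card_off_le:
  assumes "U0 \<in> F" "U1 \<in> F" "U0 \<noteq> U1" "l \<in> pencil (U0 \<inter> U1) U1"
  shows "card (off U0 U1 l) \<le> CARD('a)"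
proof -
  let ?P = "{p \<in> points U1 - {U0 \<inter> U1}. p \<subseteq> l}"
  have "card (off U0 U1 l) = card ((\<lambda>S. S \<inter> U1) ` off U0 U1 l)"
    by (rule card_image[symmetric], rule inj_on_subset[OF inj_meet[OF assms(2)]])
      (use off_neq in blast)
  also have "\<dots> \<le> card ?P"
  proof (rule card_mono)
    show "(\<lambda>S. S \<inter> U1) ` off U0 U1 l \<subseteq> ?P"
    proof (rule image_subsetI)
      fix S assume "S \<in> off U0 U1 l"
      then show "S \<inter> U1 \<in> ?P" using off_point[OF assms(1-3), of S] by (simp add: off_def)
    qed
  qed simp
  also have "\<dots> = CARD('a)"
    by (rule card_points_on_pencil_line[OF assms(4) meet_points[OF assms(1-3)]])
  finally show ?thesis .
qed

lemma star_off:
  assumes "U0 \<in> F" "U1 \<in> F" "U0 \<noteq> U1" "l \<in> pencil (U0 \<inter> U1) U1"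
  shows "star F n d U0 (off U0 U1 l \<union> (line U0 U1 - {U0})) (join U0 l)"
proof unfold_locales
  show "U0 \<in> F" by fact
  show "off U0 U1 l \<union> (line U0 U1 - {U0}) \<subseteq> F - {U0}"
    using off_neq(1,2)[of _ U0 U1 l] by (auto simp: line_mem)
  show "vec.subspace (join U0 l)" by simp
  show "vec.dim (join U0 l) = n + 2" by (rule join_point_pencil_dim[OF assms])
  show "U0 \<subseteq> join U0 l" by (rule join_upper)
  fix S assume S: "S \<in> off U0 U1 l \<union> (line U0 U1 - {U0})"
  have "l \<subseteq> join U0 S"
  proof (cases "S \<in> off U0 U1 l")
    case True
    then have S': "S \<in> F" "\<not> S \<subseteq> join U0 U1" "S \<inter> U1 \<subseteq> l" by (auto simp: off_def)
    have "l = join (U0 \<inter> U1) (S \<inter> U1)"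
      using pencil_unique[OF assms(4) meet_points[OF assms(1-3)]] off_point[OF assms(1-3) S'(1,2)] S'(3)
      by blast
    moreover have "join (U0 \<inter> U1) (S \<inter> U1) \<subseteq> join U0 S"
      using join_upper(1)[of U0 S] join_upper(2)[of S U0] by (intro join_least) auto
    ultimately show ?thesis by simp
  next
    case False
    then have "join U0 S = join U0 U1" using S join_eq[OF assms(1-3)] by blast
    moreover have "l \<subseteq> U1" using assms(4) by (simp add: pencil_def)
    ultimately show ?thesis using join_upper(2)[of U1 U0] by blast
  qed
  then show "join U0 l \<subseteq> join U0 S" using join_upper(1)[of U0 S] by (intro join_least) simp_all
qed

lemma coplanar_off:
  assumes "U0 \<in> F" "U1 \<in> F" "U0 \<noteq> U1" "l \<in> pencil (U0 \<inter> U1) U1"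
    and SR: "S \<in> off U0 U1 l" "R \<in> off U0 U1 l" "\<not> R \<subseteq> join U0 S"
  obtains E where "vec.subspace E" "vec.dim E = 3" "E \<subseteq> join U0 l"
    "\<And>X. X \<in> off U0 U1 l \<union> (line U0 U1 - {U0}) \<Longrightarrow> X \<inter> join U0 l \<subseteq> E"
    "\<And>X. X \<in> off U0 U1 l \<union> (line U0 U1 - {U0}) \<Longrightarrow> vec.dim (X \<inter> join U0 l) = 2"
proof -
  interpret s: star F n d U0 "off U0 U1 l \<union> (line U0 U1 - {U0})" "join U0 l"
    by (rule star_off[OF assms(1-4)])
  have U1: "U1 \<in> off U0 U1 l \<union> (line U0 U1 - {U0})" using ends_in_line[OF assms(1,2)] assms(3) by simp
  have offS: "\<not> X \<subseteq> join U0 U1" if "X \<in> off U0 U1 l" for X using that by (simp add: off_def)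
  obtain E where E: "vec.subspace E" "vec.dim E = 3" "E \<subseteq> join U0 l"
    "\<And>X. X \<in> off U0 U1 l \<union> (line U0 U1 - {U0}) \<Longrightarrow> X \<inter> join U0 l \<subseteq> E"
    by (rule s.coplanar[OF U1 UnI1[OF SR(1)] UnI1[OF SR(2)] offS[OF SR(1)] offS[OF SR(2)] SR(3)])
      simp
  have "vec.dim (X \<inter> join U0 l) = 2" if X: "X \<in> off U0 U1 l \<union> (line U0 U1 - {U0})" for X
  proof (cases "X \<in> off U0 U1 l")
    case True
    then show ?thesis using s.dim_trace[OF X U1 offS] by simp
  next
    case False
    then have "join U0 X = join U0 U1" using X join_eq[OF assms(1-3)] by blast
    then have "\<not> S \<subseteq> join U0 X" using offS[OF SR(1)] by simp
    then have "\<not> X \<subseteq> join U0 S" by (rule s.off_sym[OF UnI1[OF SR(1)] X])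
    then show ?thesis by (rule s.dim_trace[OF X UnI1[OF SR(1)]])
  qed
  then show ?thesis using that[OF E] by simp
qed

lemma card_off_line:
  assumes "U0 \<in> F" "U1 \<in> F"
  shows "card (off U0 U1 l \<union> (line U0 U1 - {U0})) + 1 = card (off U0 U1 l) + card (line U0 U1)"
proof -
  have "off U0 U1 l \<inter> (line U0 U1 - {U0}) = {}" by (auto simp: off_def line_mem)
  moreover have "card (line U0 U1 - {U0}) + 1 = card (line U0 U1)"
    using ends_in_line[OF assms] card_Suc_Diff1[of "line U0 U1" U0] by simp
  ultimately show ?thesis by (simp add: card_Un_disjoint)
qed

text \<open>
  If a portion meets several lines through \<open>U0\<close>, it is planar, and a dual arc has at most \<open>q + 2\<close>
  lines.
\<close>

lemma off_several:
  assumes "U0 \<in> F" "U1 \<in> F" "U0 \<noteq> U1" "l \<in> pencil (U0 \<inter> U1) U1"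
    and "S \<in> off U0 U1 l" "R \<in> off U0 U1 l" "\<not> R \<subseteq> join U0 S"
  shows "card (off U0 U1 l) + card (line U0 U1) \<le> CARD('a) + 2"
proof -
  interpret s: star F n d U0 "off U0 U1 l \<union> (line U0 U1 - {U0})" "join U0 l"
    by (rule star_off[OF assms(1-4)])
  obtain E where "vec.subspace E" "vec.dim E = 3" "E \<subseteq> join U0 l"
    "\<And>X. X \<in> off U0 U1 l \<union> (line U0 U1 - {U0}) \<Longrightarrow> X \<inter> join U0 l \<subseteq> E"
    "\<And>X. X \<in> off U0 U1 l \<union> (line U0 U1 - {U0}) \<Longrightarrow> vec.dim (X \<inter> join U0 l) = 2"
    by (rule coplanar_off[OF assms]) simp
  then have "card (off U0 U1 l \<union> (line U0 U1 - {U0})) \<le> CARD('a) + 1"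
    using s.planar_card[OF _ _ _ _ UnI1[OF assms(5)]] by simp
  then show ?thesis using card_off_line[OF assms(1,2), of l] by linarith
qed

lemma off_single:
  assumes "U0 \<in> F" "S \<in> off U0 U1 l" "\<And>R. R \<in> off U0 U1 l \<Longrightarrow> R \<subseteq> join U0 S"
  shows "card (off U0 U1 l) + 1 \<le> card (line U0 S)"
proof -
  have "U0 \<notin> off U0 U1 l" using off_neq(2)[of U0] by blast
  then have "card (off U0 U1 l) + 1 = card (insert U0 (off U0 U1 l))" by simp
  also have "\<dots> \<le> card (line U0 S)"
  proof (rule card_mono)
    show "insert U0 (off U0 U1 l) \<subseteq> line U0 S"
      using assms off_neq(1)[of _ U0 U1 l] join_upper(1)[of U0 S] by (auto simp: line_mem)
  qed simp
  finally show ?thesis .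
qed

text \<open>
  The members off a line through \<open>U0\<close> are too numerous for all portions to be smaller than \<open>q - 1\<close>,
  or smaller than \<open>q\<close> if the given line has just three members.  A portion of that size is not
  planar, so it lies on one line through \<open>U0\<close>.
\<close>

lemma ex_long_line:
  assumes "U0 \<in> F" "U1 \<in> F" "U0 \<noteq> U1" "card (line U0 U1) \<ge> 3"
  shows "\<exists>U2\<in>F. U2 \<noteq> U0 \<and> card (line U0 U2) \<ge> CARD('a)"
proof (rule ccontr)
  assume no: "\<not> ?thesis"
  let ?N = "num_points CARD('a) n" and ?P = "pencil (U0 \<inter> U1) U1"
  have bound: "card (off U0 U1 l) + 2 \<le> CARD('a) \<or>
      card (off U0 U1 l) + card (line U0 U1) \<le> CARD('a) + 2" if l: "l \<in> ?P" for l
  proof (cases "\<exists>S\<in>off U0 U1 l. \<exists>R\<in>off U0 U1 l. \<not> R \<subseteq> join U0 S")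
    case True
    then show ?thesis using off_several[OF assms(1-3) l] by blast
  next
    case single: False
    show ?thesis
    proof (cases "off U0 U1 l = {}")
      case True
      then show ?thesis using q_bound by simp
    next
      case False
      then obtain S where S: "S \<in> off U0 U1 l" by blast
      have "card (line U0 S) < CARD('a)" using no off_neq(1,2)[OF S] by auto
      moreover have "card (off U0 U1 l) + 1 \<le> card (line U0 S)"
        using off_single[OF assms(1) S] single S by blast
      ultimately show ?thesis by linarith
    qed
  qed
  show False
  proof (cases "card (line U0 U1) = 3")
    case True
    have "card (off U0 U1 l) \<le> CARD('a) - 1" if "l \<in> ?P" for l
      using bound[OF that] True by linarith
    then have "(\<Sum>l\<in>?P. card (off U0 U1 l)) \<le> card ?P * (CARD('a) - 1)"
      by (metis (no_types, lifting) sum_bounded_above of_nat_id)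
    then have "CARD('a) * ?N + 1 \<le> ?N * (CARD('a) - 1) + d + 3"
      using sum_off[OF assms(1-3)] card_pencil_F[OF assms(1-3)] True by simp
    moreover have "?N * (CARD('a) - 1) + ?N = CARD('a) * ?N"
      using q_bound by (cases "CARD('a)") auto
    ultimately show False using num_points_n_ge q_bound by linarith
  next
    case False
    have "card (off U0 U1 l) \<le> CARD('a) - 2" if "l \<in> ?P" for l
      using bound[OF that] False assms(4) by linarith
    then have "(\<Sum>l\<in>?P. card (off U0 U1 l)) \<le> card ?P * (CARD('a) - 2)"
      by (metis (no_types, lifting) sum_bounded_above of_nat_id)
    then have "CARD('a) * ?N + 1 \<le> ?N * (CARD('a) - 2) + d + (CARD('a) + 1)"
      using sum_off[OF assms(1-3)] card_pencil_F[OF assms(1-3)] card_line_le[OF assms(1-3)] by simp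
    moreover have "?N * (CARD('a) - 2) + 2 * ?N = CARD('a) * ?N"
    proof -
      obtain k where "CARD('a) = k + 2" using q_bound le_Suc_ex[of 2 "CARD('a)"] by auto
      then show ?thesis by (simp add: algebra_simps)
    qed
    ultimately show False using num_points_n_ge q_bound by linarith
  qed
qed

text \<open>
  A member on a short line through \<open>U0\<close> is in a portion of at most two, whether the portion is
  planar or on one line.  Such a portion leaves at least \<open>q - 2\<close> points of its line in \<open>U1\<close> to the long line
  and to the points on no other member, and these are at most \<open>q + d\<close> points: there is no second such portion.
\<close>

lemma few_short_lines:
  assumes "U0 \<in> F" "U1 \<in> F" "U0 \<noteq> U1" "card (line U0 U1) \<ge> CARD('a)"
  shows "card {S \<in> F - {U0}. card (line U0 S) \<le> 3} \<le> 2"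
proof -
  let ?L = "{S \<in> F - {U0}. card (line U0 S) \<le> 3}"
  let ?P = "pencil (U0 \<inter> U1) U1" and ?N = "num_points CARD('a) n"
  define Z where "Z = {l \<in> ?P. card (off U0 U1 l) \<le> 2}"
  have L_sub: "\<exists>l\<in>Z. S \<in> off U0 U1 l" if S: "S \<in> ?L" for S
  proof -
    have "S \<notin> line U0 U1"
    proof
      assume "S \<in> line U0 U1"
      then have "line U0 S = line U0 U1" using line_eq[OF assms(1-3)] S by blast
      then show False using S assms(4) q_bound by auto
    qed
    then have S': "S \<in> F" "\<not> S \<subseteq> join U0 U1" using S by (auto simp: line_mem)
    define l where "l = join (U0 \<inter> U1) (S \<inter> U1)"
    have l: "l \<in> ?P" unfolding l_def
      using pencil_join[OF subF[OF assms(2)] meet_points[OF assms(1-3)]]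
        off_point[OF assms(1-3) S'] by blast
    have S_off: "S \<in> off U0 U1 l" using S' join_upper(2)[of "S \<inter> U1" "U0 \<inter> U1"]
      by (simp add: off_def l_def)
    have "card (off U0 U1 l) \<le> 2"
    proof (cases "\<exists>R\<in>off U0 U1 l. \<not> R \<subseteq> join U0 S")
      case True
      then show ?thesis using off_several[OF assms(1-3) l S_off] assms(4) by fastforce
    next
      case False
      then have "card (off U0 U1 l) + 1 \<le> card (line U0 S)"
        using off_single[OF assms(1) S_off] by blast
      then show ?thesis using S by simp
    qed
    then show ?thesis using S_off l by (auto simp: Z_def)
  qed
  have "(\<Sum>l\<in>?P. card (off U0 U1 l) + (if l \<in> Z then CARD('a) - 2 else 0)) \<le> (\<Sum>l\<in>?P. CARD('a))"
  proof (rule sum_mono)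
    fix l assume "l \<in> ?P"
    then show "card (off U0 U1 l) + (if l \<in> Z then CARD('a) - 2 else 0) \<le> CARD('a)"
      using card_off_le[OF assms(1-3)] q_bound by (auto simp: Z_def)
  qed
  moreover have "(\<Sum>l\<in>?P. if l \<in> Z then CARD('a) - 2 else 0) = card Z * (CARD('a) - 2)"
  proof -
    have "?P \<inter> Z = Z" by (auto simp: Z_def)
    then show ?thesis by (simp add: sum.If_cases Int_def[symmetric] Collect_mem_eq)
  qed
  ultimately have "(\<Sum>l\<in>?P. card (off U0 U1 l)) + card Z * (CARD('a) - 2) \<le> ?N * CARD('a)"
    using card_pencil_F[OF assms(1-3)] by (simp add: sum.distrib)
  then have Zb: "card Z * (CARD('a) - 2) + 1 \<le> d + (CARD('a) + 1)"
    using sum_off[OF assms(1-3)] card_line_le[OF assms(1-3)] by (simp add: mult.commute)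
  have "card Z \<le> 1"
  proof (rule ccontr)
    assume "\<not> ?thesis"
    then have "2 * (CARD('a) - 2) \<le> card Z * (CARD('a) - 2)" by (intro mult_right_mono) auto
    then show False using Zb q_bound by linarith
  qed
  show ?thesis
  proof (cases "Z = {}")
    case True
    then have "?L = {}" using L_sub by blast
    then show ?thesis by (simp only: card.empty)
  next
    case False
    then have "card Z = 1" using \<open>card Z \<le> 1\<close> by (metis card_0_eq finite le_neq_implies_less less_one)
    then obtain l where l: "Z = {l}" by (meson card_1_singletonE)
    then have "?L \<subseteq> off U0 U1 l" using L_sub by blast
    then have "card ?L \<le> card (off U0 U1 l)" by (intro card_mono) auto
    then show ?thesis using l by (auto simp: Z_def)
  qed
qed

text \<open>
  If every line had only two members, some portion would consist of \<open>q\<close> members and give, with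
  \<open>U0\<close> and \<open>U1\<close>, a dual arc of \<open>q + 2\<close> lines in a plane.  Each point on such a dual arc is on
  exactly two of its lines, which pairs off the lines that meet a further line through the point
  of \<open>U0\<close> and \<open>U1\<close>.  Apart from \<open>U0\<close> and \<open>U1\<close> themselves there are \<open>q\<close> of them, so \<open>q\<close> is even.
\<close>

lemma ex_three_on_line:
  assumes "odd CARD('a)"
  shows "\<exists>U0\<in>F. \<exists>U1\<in>F. U0 \<noteq> U1 \<and> card (line U0 U1) \<ge> 3"
proof (rule ccontr)
  assume no: "\<not> ?thesis"
  let ?N = "num_points CARD('a) n"
  have "card F \<ge> 2"
    using card_F num_points_n_ge q_bound num_points_mono[of n "n + 1" "CARD('a)"] by linarith
  then obtain U0 U1 where U: "U0 \<in> F" "U1 \<in> F" "U0 \<noteq> U1"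
    by (metis card_le_Suc0_iff_eq finite not_less_eq_eq numeral_2_eq_2)
  have line2: "S \<in> line U0 R \<Longrightarrow> R \<in> F \<Longrightarrow> R \<noteq> U0 \<Longrightarrow> S = U0 \<or> S = R" for S R
  proof (rule ccontr)
    assume *: "S \<in> line U0 R" "R \<in> F" "R \<noteq> U0" "\<not> (S = U0 \<or> S = R)"
    then have "card {U0, R, S} \<le> card (line U0 R)"
      using ends_in_line[OF U(1), of R] by (intro card_mono) auto
    moreover have "card {U0, R, S} = 3" using *(3,4) by (metis card_3_iff)
    ultimately show False using no U(1) *(2,3) by (metis order_refl)
  qed
  let ?P = "pencil (U0 \<inter> U1) U1"
  have l01: "line U0 U1 = {U0, U1}" using line2[of _ U1] U ends_in_line[OF U(1,2)] by auto
  have "\<exists>l\<in>?P. card (off U0 U1 l) \<ge> CARD('a)"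
  proof (rule ccontr)
    assume a: "\<not> ?thesis"
    have "card (off U0 U1 l) \<le> CARD('a) - 1" if "l \<in> ?P" for l
    proof -
      have "\<not> CARD('a) \<le> card (off U0 U1 l)" using a that by blast
      then show ?thesis by linarith
    qed
    then have "(\<Sum>l\<in>?P. card (off U0 U1 l)) \<le> card ?P * (CARD('a) - 1)"
      by (metis (no_types, lifting) sum_bounded_above of_nat_id)
    then have "CARD('a) * ?N + 1 \<le> ?N * (CARD('a) - 1) + d + 2"
      using sum_off[OF U] card_pencil_F[OF U] l01 U by simp
    moreover have "?N * (CARD('a) - 1) + ?N = CARD('a) * ?N"
      using q_bound by (cases "CARD('a)") auto
    ultimately show False using num_points_n_ge q_bound by linarith
  qed
  then obtain l where l: "l \<in> ?P" and "card (off U0 U1 l) \<ge> CARD('a)" by blast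
  then have card_off: "card (off U0 U1 l) = CARD('a)" using card_off_le[OF U l] by simp
  have distinct_lines: "\<not> R \<subseteq> join U0 S" if "S \<in> off U0 U1 l" "R \<in> off U0 U1 l" "R \<noteq> S" for R S
    using line2[of R S] off_neq[OF that(1)] off_neq[OF that(2)] that by (auto simp: line_mem)
  obtain S where S: "S \<in> off U0 U1 l" using card_off q_bound by (metis card.empty ex_in_conv le_zero_eq zero_neq_numeral add_is_0)
  obtain R where R: "R \<in> off U0 U1 l" "R \<noteq> S"
  proof -
    have "\<not> off U0 U1 l \<subseteq> {S}" using card_off q_bound card_mono[of "{S}" "off U0 U1 l"] by auto
    then show ?thesis using that by blast
  qed
  let ?G = "off U0 U1 l \<union> (line U0 U1 - {U0})" and ?T = "join U0 l"
  interpret s: star F n d U0 ?G ?T by (rule star_off[OF U l])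
  obtain E where E: "vec.subspace E" "vec.dim E = 3" "E \<subseteq> ?T"
    "\<And>X. X \<in> ?G \<Longrightarrow> X \<inter> ?T \<subseteq> E"
    "\<And>X. X \<in> ?G \<Longrightarrow> vec.dim (X \<inter> ?T) = 2"
    by (rule coplanar_off[OF U l S R(1) distinct_lines[OF S R]]) simp
  have G: "?G = insert U1 (off U0 U1 l)" using l01 U by auto
  have U1G: "U1 \<in> ?G" using G by blast
  have covered: "\<exists>Y. Y \<in> insert U0 ?G - {X} \<and> Y \<inter> X = p"
    if X: "X \<in> ?G" and p: "p \<in> points (X \<inter> ?T)" for X p
  proof -
    let ?f = "\<lambda>Y. Y \<inter> X" and ?D = "insert U0 ?G - {X}"
    have "card (?f ` ?D) = card ?D" using s.planar_points(1)[OF E(1,2,4,5) X] by (rule card_image)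
    also have "\<dots> = card ?G" using X s.GF(2)[of U0] by (auto simp: card_insert_if)
    also have "\<dots> = CARD('a) + 1" using card_off_line[OF U(1,2), of l] card_off l01 U by simp
    also have "\<dots> = card (points (X \<inter> ?T))"
      using card_points[OF s.subspace_trace[OF X]] E(5)[OF X] by (simp add: num_points_2)
    finally have "?f ` ?D = points (X \<inter> ?T)"
      using s.planar_points(2)[OF E(1,2,4,5) X] by (intro card_subset_eq) auto
    then have "p \<in> ?f ` ?D" using p by simp
    then show ?thesis by blast
  qed
  define X where "X = U0 \<inter> U1"
  have X: "X \<in> points E"
    using E(4)[OF U1G] s.T(3) meet_points[OF U] by (auto simp: X_def points_def)
  have "\<exists>g\<in>pencil X E. g \<noteq> U1 \<inter> ?T \<and> \<not> g \<subseteq> U0"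
  proof -
    have sub0: "vec.subspace (U0 \<inter> E)" using subF[OF U(1)] E(1) by (rule vec.subspace_inter)
    have dim0: "vec.dim (U0 \<inter> E) \<le> 2"
    proof (rule ccontr)
      assume "\<not> ?thesis"
      then have "U0 \<inter> E = E" using sub0 E by (intro subspace_eqI) auto
      then have "U1 \<inter> ?T \<subseteq> U0 \<inter> U1" using E(4)[OF U1G] by blast
      then have "vec.dim (U1 \<inter> ?T) \<le> 1" using vec.dim_subset dim_meet[OF U] by metis
      then show False using E(5)[OF U1G] by simp
    qed
    have "\<not> pencil X E \<subseteq> {U1 \<inter> ?T, U0 \<inter> E}"
    proof
      assume "pencil X E \<subseteq> {U1 \<inter> ?T, U0 \<inter> E}"
      then have "card (pencil X E) \<le> card {U1 \<inter> ?T, U0 \<inter> E}" by (intro card_mono) auto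
      also have "\<dots> \<le> 2" by (simp add: card_insert_if)
      finally show False
        using card_pencil[OF E(1) X, of 2] E(2) q_bound by (simp add: num_points_2)
    qed
    then obtain g where g: "g \<in> pencil X E" "g \<noteq> U1 \<inter> ?T" "g \<noteq> U0 \<inter> E" by blast
    have "\<not> g \<subseteq> U0"
    proof
      assume "g \<subseteq> U0"
      then have "g = U0 \<inter> E" using g sub0 dim0 by (intro subspace_eqI) (auto simp: pencil_def)
      then show False using g by simp
    qed
    then show ?thesis using g by blast
  qed
  then obtain g where g: "g \<in> pencil X E" "g \<noteq> U1 \<inter> ?T" "\<not> g \<subseteq> U0" by blast
  then have g': "vec.subspace g" "vec.dim g = 2" "X \<subseteq> g" "g \<subseteq> E" by (auto simp: pencil_def)
  obtain x where x: "x \<in> U0" "x \<in> U1" "x \<noteq> 0" using ex_meet[OF U(1,2)] by blast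
  have not_X: "x \<notin> R" if "R \<in> off U0 U1 l" for R
    using skewD[OF U(1,2) off_neq(1)[OF that]] off_neq(2,3)[OF that] x U(3) by metis
  have g_point: "g \<inter> R \<in> points (R \<inter> ?T)" if R: "R \<in> off U0 U1 l" for R
  proof -
    have RG: "R \<in> ?G" using R by blast
    have eq: "g \<inter> (R \<inter> ?T) = g \<inter> R" using g' E(3) by blast
    have sub: "vec.subspace (g \<inter> R)"
      using g' subF[OF off_neq(1)[OF R]] by (simp add: vec.subspace_inter)
    have "join g (R \<inter> ?T) \<subseteq> E" using g' E(1) E(4)[OF RG] by (intro join_least)
    then have "vec.dim (join g (R \<inter> ?T)) \<le> 3" using vec.dim_subset E(2) by metis
    then have ge: "vec.dim (g \<inter> R) \<ge> 1"
      using dim_join[OF g'(1) s.subspace_trace[OF RG]] E(5)[OF RG] g'(2) by (simp add: eq)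
    have "vec.dim (g \<inter> R) \<noteq> 2"
    proof
      assume "vec.dim (g \<inter> R) = 2"
      then have "g \<inter> R = g" using sub g' by (intro subspace_eqI) auto
      then have "X \<subseteq> R" using g'(3) by blast
      then show False using not_X[OF R] x by (auto simp: X_def)
    qed
    moreover have "vec.dim (g \<inter> R) \<le> 2" using vec.dim_subset[of "g \<inter> R" g] g' by simp
    ultimately have "vec.dim (g \<inter> R) = 1" using ge by simp
    then show ?thesis using sub g' E(3) by (auto simp: points_def)
  qed
  have partner: "\<exists>Y. Y \<in> off U0 U1 l \<and> Y \<noteq> R \<and> Y \<inter> R = g \<inter> R" if R: "R \<in> off U0 U1 l" for R
  proof -
    have RG: "R \<in> ?G" using R by blast
    obtain Y where Y: "Y \<in> insert U0 ?G - {R}" "Y \<inter> R = g \<inter> R"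
      using covered[OF RG g_point[OF R]] by blast
    obtain y where y: "y \<in> g" "y \<in> R" "y \<noteq> 0"
      using dim_pos_ex[of "g \<inter> R"] g_point[OF R] by (auto simp: points_def)
    have "y \<in> Y" using Y(2) y by blast
    have y_ind: "y \<notin> vec.span {x}"
    proof
      assume "y \<in> vec.span {x}"
      then obtain c where c: "y = c *s x" by (auto simp: span_singleton_mem)
      then have "c \<noteq> 0" using y by auto
      then have "x = inverse c *s y" using c by simp
      then have "x \<in> R" using y(2) subF[OF off_neq(1)[OF R]] by (simp add: vec.subspace_scale)
      then show False using not_X[OF R] by simp
    qed
    have xg: "x \<in> g" using g'(3) x by (auto simp: X_def)
    have g_sub: "g \<subseteq> W" if "W \<in> F" "x \<in> W" "y \<in> W" for W
      using dim2_subset[OF g'(1,2) xg y(1) x(3) y_ind subF[OF that(1)] that(2,3)] .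
    have "Y \<noteq> U0" using g_sub[OF U(1)] g(3) x \<open>y \<in> Y\<close> by blast
    moreover have "Y \<noteq> U1"
    proof
      assume "Y = U1"
      then have "g \<subseteq> U1 \<inter> ?T" using g_sub[OF U(2)] x \<open>y \<in> Y\<close> g'(4) E(3) by blast
      then have "g = U1 \<inter> ?T" using g' E(5)[OF U1G] s.subspace_trace[OF U1G]
        by (intro subspace_eqI) auto
      then show False using g(2) by simp
    qed
    ultimately show ?thesis using Y G by blast
  qed
  define h where "h R = (SOME Y. Y \<in> off U0 U1 l \<and> Y \<noteq> R \<and> Y \<inter> R = g \<inter> R)" for R
  have h: "h R \<in> off U0 U1 l" "h R \<noteq> R" "h R \<inter> R = g \<inter> R" if "R \<in> off U0 U1 l" for R
    using someI_ex[OF partner[OF that]] by (auto simp: h_def)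
  have "h (h R) = R" if R: "R \<in> off U0 U1 l" for R
  proof -
    obtain y where y: "y \<in> g" "y \<in> R" "y \<noteq> 0"
      using dim_pos_ex[of "g \<inter> R"] g_point[OF R] by (auto simp: points_def)
    have "y \<in> h R" using h(3)[OF R] y by blast
    then have "y \<in> h (h R)" using h(3)[OF h(1)[OF R]] y(1) by blast
    then show ?thesis
      using skewD[OF off_neq(1)[OF R] off_neq(1)[OF h(1)[OF R]] off_neq(1)[OF h(1)[OF h(1)[OF R]]]]
        h(2)[OF R] h(2)[OF h(1)[OF R]] y \<open>y \<in> h R\<close> by metis
  qed
  then have "even (card (off U0 U1 l))"
    using h by (intro even_card_involution[of _ h]) auto
  then show False using card_off assms by simp
qed

end

section \<open>The regulus of two lines\<close>

text \<open>
  Maps between subspaces are functions on the ambient space that are constrained on a subspace only.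
\<close>

definition lin_on :: "('a::field ^ 'v) set \<Rightarrow> ('a ^ 'v \<Rightarrow> 'a ^ 'v) \<Rightarrow> bool" where
  "lin_on X f \<longleftrightarrow> (\<forall>x\<in>X. \<forall>y\<in>X. \<forall>c d. f (c *s x + d *s y) = c *s f x + d *s f y)"

lemma lin_onD: "lin_on X f \<Longrightarrow> x \<in> X \<Longrightarrow> y \<in> X \<Longrightarrow> f (c *s x + d *s y) = c *s f x + d *s f y"
  by (simp add: lin_on_def)

lemma three_distinct:
  assumes "card A \<ge> 3"
  obtains x y z where "x \<in> A" "y \<in> A" "z \<in> A" "x \<noteq> y" "x \<noteq> z" "y \<noteq> z"
proof -
  obtain B where B: "B \<subseteq> A" "card B = 3" using obtain_subset_with_card_n[OF assms] by blast
  obtain x y z where "B = {x, y, z}" "x \<noteq> y" "x \<noteq> z" "y \<noteq> z"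
    using B(2) unfolding card_3_iff by blast
  then show ?thesis using that[of x y z] B(1) by simp
qed

context partial_dual_arc
begin

lemma star_two_lines:
  assumes "U0 \<in> F" "U1 \<in> F" "U2 \<in> F" "U0 \<noteq> U1" "\<not> U2 \<subseteq> join U0 U1"
  shows "star F n d U0 ((line U0 U1 - {U0}) \<union> (line U0 U2 - {U0})) (join U0 U1 \<inter> join U0 U2)"
proof unfold_locales
  have ne: "U0 \<noteq> U2" using assms(5) join_upper(1)[of U0 U1] by blast
  show "U0 \<in> F" by fact
  show "(line U0 U1 - {U0}) \<union> (line U0 U2 - {U0}) \<subseteq> F - {U0}" by (auto simp: line_mem)
  show "vec.subspace (join U0 U1 \<inter> join U0 U2)" by (simp add: vec.subspace_inter)
  show "vec.dim (join U0 U1 \<inter> join U0 U2) = n + 2"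
    by (rule dim_join_meet[OF assms])
  show "U0 \<subseteq> join U0 U1 \<inter> join U0 U2" using join_upper(1) by blast
  fix S assume "S \<in> (line U0 U1 - {U0}) \<union> (line U0 U2 - {U0})"
  then have "join U0 S = join U0 U1 \<or> join U0 S = join U0 U2"
    using join_eq[OF assms(1,2,4), of S] join_eq[OF assms(1,3) ne, of S] by blast
  then show "join U0 U1 \<inter> join U0 U2 \<subseteq> join U0 S" by blast
qed

lemma cross_lines:
  assumes "U0 \<in> F" "U1 \<in> F" "U2 \<in> F" "U0 \<noteq> U1" "\<not> U2 \<subseteq> join U0 U1"
    and "S \<in> line U0 U1 - {U0}" "R \<in> line U0 U2 - {U0}"
  shows "\<not> S \<subseteq> join U0 R" "\<not> R \<subseteq> join U0 S"
proof -
  have ne: "U0 \<noteq> U2" using assms(5) join_upper(1)[of U0 U1] by blast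
  have eq: "join U0 S = join U0 U1" "join U0 R = join U0 U2"
    using join_eq[OF assms(1,2,4), of S] join_eq[OF assms(1,3) ne, of R] assms(6,7) by auto
  have SR: "S \<in> F" "S \<noteq> U0" "R \<in> F" "R \<noteq> U0" using assms(6,7) by (auto simp: line_mem)
  show "\<not> S \<subseteq> join U0 R"
  proof
    assume "S \<subseteq> join U0 R"
    then have "join U0 S = join U0 R" using join_eq[of U0 R S] assms(1) SR by (auto simp: line_mem)
    then show False using eq assms(5) join_upper(2)[of U2 U0] by simp
  qed
  show "\<not> R \<subseteq> join U0 S"
  proof
    assume "R \<subseteq> join U0 S"
    then have "join U0 R = join U0 S" using join_eq[of U0 S R] assms(1) SR by (auto simp: line_mem)
    then show False using eq assms(5) join_upper(2)[of U2 U0] by simp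
  qed
qed

text \<open>
  If two members of one line met inside the common space \<open>join U0 U1 \<inter> join U0 U2\<close>, all traces on it
  would lie in the plane of these two, and there would be too many for a dual arc.
\<close>

lemma traces_skew:
  assumes "U0 \<in> F" "U1 \<in> F" "U2 \<in> F" "U0 \<noteq> U1" "\<not> U2 \<subseteq> join U0 U1"
    and "card (line U0 U2) \<ge> 3" "card (line U0 U1) + card (line U0 U2) \<ge> CARD('a) + 4"
    and SR: "S \<in> line U0 U1 - {U0}" "R \<in> line U0 U1 - {U0}" "S \<noteq> R"
    and x: "x \<in> S" "x \<in> R" "x \<in> join U0 U1 \<inter> join U0 U2"
  shows "x = 0"
proof (rule ccontr)
  assume "x \<noteq> 0"
  let ?A = "line U0 U1 - {U0}" and ?B = "line U0 U2 - {U0}" and ?T = "join U0 U1 \<inter> join U0 U2"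
  interpret s: star F n d U0 "?A \<union> ?B" ?T by (rule star_two_lines[OF assms(1-5)])
  note cross = cross_lines[OF assms(1-5)]
  have cardA: "card ?A + 1 = card (line U0 U1)" and cardB: "card ?B + 1 = card (line U0 U2)"
    using ends_in_line[OF assms(1,2)] ends_in_line[OF assms(1,3)]
      card_Suc_Diff1[of "line U0 U1" U0] card_Suc_Diff1[of "line U0 U2" U0] by simp_all
  have "\<not> card ?B \<le> Suc 0" using cardB assms(6) by linarith
  then obtain K1 K2 where K: "K1 \<in> ?B" "K2 \<in> ?B" "K1 \<noteq> K2"
    by (meson card_le_Suc0_iff_eq finite)
  define E where "E = join (S \<inter> ?T) (R \<inter> ?T)"
  have F: "S \<in> F" "R \<in> F" using SR by (auto simp: line_mem)
  have SG: "S \<in> ?A \<union> ?B" "R \<in> ?A \<union> ?B" using SR by blast+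
  have dimA: "vec.dim (X \<inter> ?T) = 2" if "X \<in> ?A" for X
    using s.dim_trace[OF UnI1[OF that] UnI2[OF K(1)] cross(1)[OF that K(1)]] .
  have dimB: "vec.dim (X \<inter> ?T) = 2" if "X \<in> ?B" for X
    using s.dim_trace[OF UnI2[OF that] SG(1) cross(2)[OF SR(1) that]] .
  have "S \<inter> ?T \<inter> (R \<inter> ?T) = S \<inter> R"
  proof -
    have "y \<in> ?T" if y: "y \<in> S" "y \<in> R" for y
    proof -
      obtain c where "y = c *s x"
        using meet_multiple[OF F SR(3) x(1,2) \<open>x \<noteq> 0\<close> y] by blast
      then show ?thesis using x(3) s.T(1) by (simp only: vec.subspace_scale)
    qed
    then show ?thesis by blast
  qed
  then have dE: "vec.dim E = 3"
    using dim_join[OF s.subspace_trace[OF SG(1)] s.subspace_trace[OF SG(2)]]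
      dimA[OF SR(1)] dimA[OF SR(2)] dim_meet[OF F SR(3)] by (simp add: E_def)
  have E: "vec.subspace E" "S \<inter> ?T \<subseteq> E" "R \<inter> ?T \<subseteq> E"
    unfolding E_def by (rule subspace_join join_upper)+
  have EB: "K \<inter> ?T \<subseteq> E" if K: "K \<in> ?B" for K
  proof (rule s.trace_subset)
    show "K \<in> ?A \<union> ?B" using K by (rule UnI2)
    show "S \<in> ?A \<union> ?B" "R \<in> ?A \<union> ?B" by (rule SG)+
    show "S \<noteq> R" by (rule SR(3))
    show "\<not> K \<subseteq> join U0 S" by (rule cross(2)[OF SR(1) K])
    show "\<not> K \<subseteq> join U0 R" by (rule cross(2)[OF SR(2) K])
    show "vec.subspace E" "S \<inter> ?T \<subseteq> E" "R \<inter> ?T \<subseteq> E" by (rule E)+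
  qed
  have EA: "X \<inter> ?T \<subseteq> E" if X: "X \<in> ?A" for X
  proof (rule s.trace_subset)
    show "X \<in> ?A \<union> ?B" using X by (rule UnI1)
    show "K1 \<in> ?A \<union> ?B" "K2 \<in> ?A \<union> ?B" by (rule UnI2, rule K)+
    show "K1 \<noteq> K2" by (rule K(3))
    show "\<not> X \<subseteq> join U0 K1" by (rule cross(1)[OF X K(1)])
    show "\<not> X \<subseteq> join U0 K2" by (rule cross(1)[OF X K(2)])
    show "vec.subspace E" by (rule E)
    show "K1 \<inter> ?T \<subseteq> E" "K2 \<inter> ?T \<subseteq> E" by (rule EB, rule K)+
  qed
  have "card (?A \<union> ?B) \<le> CARD('a) + 1"
  proof (rule s.planar_card[OF E(1) dE _ _ SG(1)])
    fix X assume X: "X \<in> ?A \<union> ?B"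
    show "X \<inter> ?T \<subseteq> E" using X by (rule UnE) (rule EA EB, assumption)+
    show "vec.dim (X \<inter> ?T) = 2" using X by (rule UnE) (rule dimA dimB, assumption)+
  qed
  moreover have "?A \<inter> ?B = {}" using cross(1) join_upper(2) by blast
  then have "card (?A \<union> ?B) = card ?A + card ?B" by (simp add: card_Un_disjoint)
  ultimately show False using cardA cardB assms(7) by linarith
qed

text \<open>
  The traces of the two lines are the rulings of a hyperbolic quadric.  If \<open>U0\<close> met it in a
  conic, parametrising the conic by \<open>PG(1,q)\<close> would send the members of both lines to distinct
  parameters, which is impossible for more than \<open>q + 1\<close> members.  So \<open>U0\<close> meets the quadric
  in two of its lines, and the members of one line cut \<open>U0\<close> in collinear points.
\<close>

lemma regulus_collinear:
  assumes U: "U0 \<in> F" "U1 \<in> F" "U2 \<in> F" "U0 \<noteq> U1" "\<not> U2 \<subseteq> join U0 U1"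
    and cA: "card (line U0 U1) \<ge> 4" and cB: "card (line U0 U2) \<ge> 4"
    and cAB: "card (line U0 U1) + card (line U0 U2) \<ge> CARD('a) + 4"
  shows "\<exists>m. vec.subspace m \<and> vec.dim m = 2 \<and> m \<subseteq> U0 \<and> (\<forall>S\<in>line U0 U1 - {U0}. S \<inter> U0 \<subseteq> m)"
proof -
  let ?A = "line U0 U1 - {U0}" and ?B = "line U0 U2 - {U0}" and ?T = "join U0 U1 \<inter> join U0 U2"
  interpret s: star F n d U0 "?A \<union> ?B" ?T by (rule star_two_lines[OF U])
  note cross = cross_lines[OF U]
  have ne: "U0 \<noteq> U2" using U(5) join_upper(1)[of U0 U1] by blast
  have off': "\<not> U1 \<subseteq> join U0 U2"
    using cross(1)[of U1 U2] ends_in_line[OF U(1,2)] ends_in_line[OF U(1,3)] ne U(4) by simp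
  have cardA: "card ?A + 1 = card (line U0 U1)" and cardB: "card ?B + 1 = card (line U0 U2)"
    using ends_in_line[OF U(1,2)] ends_in_line[OF U(1,3)]
      card_Suc_Diff1[of "line U0 U1" U0] card_Suc_Diff1[of "line U0 U2" U0] by simp_all
  have AF: "S \<in> F" "S \<noteq> U0" if "S \<in> ?A" for S using that by (auto simp: line_mem)
  have BF: "S \<in> F" "S \<noteq> U0" if "S \<in> ?B" for S using that by (auto simp: line_mem)
  have AB: "S \<noteq> K" if "S \<in> ?A" "K \<in> ?B" for S K using cross(1)[OF that] join_upper(2) by blast
  have skewB: "x = 0" if "K \<in> ?B" "K' \<in> ?B" "K \<noteq> K'" "x \<in> K" "x \<in> K'" "x \<in> ?T" for K K' x
    by (rule traces_skew[OF U(1,3,2) ne off', of K K'])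
      (use that cA cAB in \<open>auto simp: Int_commute\<close>)
  have "card ?B \<ge> 3" using cardB cB by linarith
  then obtain K1 K2 K3 where K: "K1 \<in> ?B" "K2 \<in> ?B" "K3 \<in> ?B" "K1 \<noteq> K2" "K1 \<noteq> K3" "K2 \<noteq> K3"
    by (rule three_distinct)
  have inT: "x \<in> ?T" if "S \<in> ?A" "K' \<in> ?B" "x \<in> S" "x \<in> K'" for S K' x
    using s.meet_in_T[OF UnI1[OF that(1)] UnI2[OF that(2)] cross(1)[OF that(1,2)]] that(3,4) by blast
  have dimA: "vec.dim (S \<inter> ?T) = 2" if "S \<in> ?A" for S
    using s.dim_trace[OF UnI1[OF that] UnI2[OF K(1)] cross(1)[OF that K(1)]] .
  have dimB: "vec.dim (K' \<inter> ?T) = 2" if "K' \<in> ?B" for K'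
  proof -
    have U1A: "U1 \<in> ?A" using ends_in_line[OF U(1,2)] U(4) by simp
    show ?thesis using s.dim_trace[OF UnI2[OF that] UnI1[OF U1A] cross(2)[OF U1A that]] .
  qed
  have "\<exists>x y. x \<in> S \<and> x \<in> K1 \<and> x \<noteq> 0 \<and> y \<in> S \<and> y \<in> K2 \<and> y \<noteq> 0 \<and> x + y \<in> K3" if S: "S \<in> ?A" for S
  proof -
    obtain x where x: "x \<in> S" "x \<in> K1" "x \<noteq> 0" using ex_meet[OF AF(1)[OF S] BF(1)[OF K(1)]] by blast
    obtain y where y: "y \<in> S" "y \<in> K2" "y \<noteq> 0" using ex_meet[OF AF(1)[OF S] BF(1)[OF K(2)]] by blast
    obtain z where z: "z \<in> S" "z \<in> K3" "z \<noteq> 0" using ex_meet[OF AF(1)[OF S] BF(1)[OF K(3)]] by blast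
    have yx: "y \<notin> vec.span {x}"
      using meet_indep[OF AF(1)[OF S] BF(1)[OF K(1)] BF(1)[OF K(2)] AB[OF S K(1)] AB[OF S K(2)] K(4) x y] .
    obtain a b where ab: "z = a *s x + b *s y"
      using dim2_comb[OF s.subspace_trace[OF UnI1[OF S]] dimA[OF S] _ _ x(3) yx]
        x y z inT[OF S K(1) x(1,2)] inT[OF S K(2) y(1,2)] inT[OF S K(3) z(1,2)] by blast
    have "a \<noteq> 0"
    proof
      assume "a = 0"
      then have "z \<in> K2" using ab y subF[OF BF(1)[OF K(2)]] by (simp add: vec.subspace_scale)
      then show False
        using skewD[OF AF(1)[OF S] BF(1)[OF K(2)] BF(1)[OF K(3)] AB[OF S K(2)] AB[OF S K(3)] K(6)] z
        by blast
    qed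
    moreover have "b \<noteq> 0"
    proof
      assume "b = 0"
      then have "z \<in> K1" using ab x subF[OF BF(1)[OF K(1)]] by (simp add: vec.subspace_scale)
      then show False
        using skewD[OF AF(1)[OF S] BF(1)[OF K(1)] BF(1)[OF K(3)] AB[OF S K(1)] AB[OF S K(3)] K(5)] z
        by blast
    qed
    moreover have "a *s x \<in> S" "a *s x \<in> K1" "b *s y \<in> S" "b *s y \<in> K2"
      using x y subF[OF AF(1)[OF S]] subF[OF BF(1)[OF K(1)]] subF[OF BF(1)[OF K(2)]]
      by (simp_all add: vec.subspace_scale)
    ultimately show ?thesis using ab z x(3) y(3) by (intro exI[of _ "a *s x"] exI[of _ "b *s y"]) simp
  qed
  then obtain X Y where XY: "\<And>S. S \<in> ?A \<Longrightarrow> X S \<in> S \<and> X S \<in> K1 \<and> X S \<noteq> 0 \<and> Y S \<in> S \<and> Y S \<in> K2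
      \<and> Y S \<noteq> 0 \<and> X S + Y S \<in> K3"
    by metis
  have XT: "X S \<in> ?T" "Y S \<in> ?T" if "S \<in> ?A" for S
    using inT[OF that K(1)] inT[OF that K(2)] XY[OF that] by blast+
  have YX: "Y S \<notin> vec.span {X S}" if "S \<in> ?A" for S
    by (rule meet_indep[OF AF(1)[OF that] BF(1)[OF K(1)] BF(1)[OF K(2)]
          AB[OF that K(1)] AB[OF that K(2)] K(4)]) (use XY[OF that] in simp_all)
  \<comment> \<open>Members other than \<open>K2\<close> do not contain \<open>Y S\<close>, so their points on \<open>S\<close> get affine parameters.\<close>
  have comb: "\<exists>\<nu>. X S + \<nu> *s Y S \<in> W" if S: "S \<in> ?A" and W: "W \<in> F" "W \<noteq> S" "W \<noteq> K2"
    and WT: "\<And>x. x \<in> S \<Longrightarrow> x \<in> W \<Longrightarrow> x \<in> ?T" for S W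
  proof -
    obtain z where z: "z \<in> S" "z \<in> W" "z \<noteq> 0" using ex_meet[OF AF(1)[OF S] W(1)] by blast
    obtain a b where ab: "z = a *s X S + b *s Y S"
      using dim2_comb[OF s.subspace_trace[OF UnI1[OF S]] dimA[OF S] _ _ _ YX[OF S]]
        XY[OF S] XT[OF S] z WT by blast
    have "a \<noteq> 0"
    proof
      assume "a = 0"
      then have "z \<in> K2" using ab XY[OF S] subF[OF BF(1)[OF K(2)]] by (simp add: vec.subspace_scale)
      then show False
        using skewD[OF AF(1)[OF S] BF(1)[OF K(2)] W(1) AB[OF S K(2)]] W z by blast
    qed
    then have "X S + (b / a) *s Y S = inverse a *s z"
      by (simp add: ab vec.scale_right_distrib divide_inverse mult.commute)
    then show ?thesis using z subF[OF W(1)] by (metis vec.subspace_scale)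
  qed
  \<comment> \<open>The parametrisation of \<open>K1\<close> by the members of the first line carries over to \<open>K2\<close>.\<close>
  have rel: "\<exists>\<alpha> \<beta>. \<alpha> \<noteq> 0 \<and> \<beta> \<noteq> 0 \<and> X Q = \<alpha> *s X S + \<beta> *s X R \<and> Y Q = \<alpha> *s Y S + \<beta> *s Y R"
    if SRQ: "S \<in> ?A" "R \<in> ?A" "Q \<in> ?A" "S \<noteq> R" "S \<noteq> Q" "R \<noteq> Q" for S R Q
  proof -
    note A = SRQ(1-3)
    have ind: "X R \<notin> vec.span {X S}"
      by (rule meet_indep[of K1 S R])
        (use XY[OF A(1)] XY[OF A(2)] AF(1)[OF A(1)] AF(1)[OF A(2)] BF(1)[OF K(1)]
           AB[OF A(1) K(1)] AB[OF A(2) K(1)] SRQ(4) in auto)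
    obtain \<alpha> \<beta> where eq: "X Q = \<alpha> *s X S + \<beta> *s X R"
      using dim2_comb[OF s.subspace_trace[OF UnI2[OF K(1)]] dimB[OF K(1)] _ _ _ ind]
        XY[OF A(1)] XY[OF A(2)] XY[OF A(3)] XT(1)[OF A(1)] XT(1)[OF A(2)] XT(1)[OF A(3)] by blast
    have "\<alpha> \<noteq> 0"
    proof
      assume "\<alpha> = 0"
      then have "X Q \<in> R" using eq XY[OF A(2)] subF[OF AF(1)[OF A(2)]] by (simp add: vec.subspace_scale)
      then show False
        using skewD[OF AF(1)[OF A(2)] AF(1)[OF A(3)] BF(1)[OF K(1)] SRQ(6) AB[OF A(2) K(1)]
            AB[OF A(3) K(1)]] XY[OF A(3)] by blast
    qed
    moreover have "\<beta> \<noteq> 0"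
    proof
      assume "\<beta> = 0"
      then have "X Q \<in> S" using eq XY[OF A(1)] subF[OF AF(1)[OF A(1)]] by (simp add: vec.subspace_scale)
      then show False
        using skewD[OF AF(1)[OF A(1)] AF(1)[OF A(3)] BF(1)[OF K(1)] SRQ(5) AB[OF A(1) K(1)]
            AB[OF A(3) K(1)]] XY[OF A(3)] by blast
    qed
    moreover have "Y Q - (\<alpha> *s Y S + \<beta> *s Y R) = 0"
    proof (rule skewB[OF K(2,3,6)])
      show "Y Q - (\<alpha> *s Y S + \<beta> *s Y R) \<in> K2"
        using XY[OF A(1)] XY[OF A(2)] XY[OF A(3)] subF[OF BF(1)[OF K(2)]]
        by (intro vec.subspace_diff lin_comb_mem) simp_all
      show "Y Q - (\<alpha> *s Y S + \<beta> *s Y R) \<in> ?T"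
        using XT(2)[OF A(1)] XT(2)[OF A(2)] XT(2)[OF A(3)] s.T(1)
        by (intro vec.subspace_diff lin_comb_mem) simp_all
      have "Y Q - (\<alpha> *s Y S + \<beta> *s Y R)
          = (X Q + Y Q) - (\<alpha> *s (X S + Y S) + \<beta> *s (X R + Y R))"
        by (simp add: eq vec.scale_right_distrib)
      also have "\<dots> \<in> K3"
        using XY[OF A(1)] XY[OF A(2)] XY[OF A(3)] subF[OF BF(1)[OF K(3)]]
        by (intro vec.subspace_diff lin_comb_mem) simp_all
      finally show "Y Q - (\<alpha> *s Y S + \<beta> *s Y R) \<in> K3" .
    qed
    ultimately show ?thesis using eq by (intro exI[of _ \<alpha>] exI[of _ \<beta>]) simp
  qed
  have cardA3: "card ?A \<ge> 3" using cardA cA by linarith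
  have third: "\<exists>Q\<in>?A. Q \<noteq> S \<and> Q \<noteq> R" for S R
  proof (rule ccontr)
    assume "\<not> ?thesis"
    then have "?A \<subseteq> {S, R}" by blast
    then have "card ?A \<le> card {S, R}" by (intro card_mono) auto
    also have "\<dots> \<le> 2" by (simp add: card_insert_if)
    finally show False using cardA3 by simp
  qed
  have YY: "Y R \<notin> vec.span {Y S}" if "S \<in> ?A" "R \<in> ?A" "S \<noteq> R" for S R
    by (rule meet_indep[of K2 S R])
      (use XY[OF that(1)] XY[OF that(2)] AF(1)[OF that(1)] AF(1)[OF that(2)] BF(1)[OF K(2)]
         AB[OF that(1) K(2)] AB[OF that(2) K(2)] that(3) in auto)
  \<comment> \<open>The parameter of the point on a member \<open>K'\<close> of the second line depends on \<open>K'\<close> alone.\<close>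
  have same: "\<nu>S = \<nu>R"
    if K': "K' \<in> ?B" "K' \<noteq> K2" and SR: "S \<in> ?A" "R \<in> ?A" "S \<noteq> R"
      and \<nu>: "X S + \<nu>S *s Y S \<in> K'" "X R + \<nu>R *s Y R \<in> K'" for K' S R \<nu>S \<nu>R
  proof -
    obtain Q where Q: "Q \<in> ?A" "S \<noteq> Q" "R \<noteq> Q" using third[of S R] by metis
    obtain \<alpha> \<beta> where ab: "\<alpha> \<noteq> 0" "\<beta> \<noteq> 0" "X Q = \<alpha> *s X S + \<beta> *s X R" "Y Q = \<alpha> *s Y S + \<beta> *s Y R"
      using rel[OF SR(1,2) Q(1) SR(3) Q(2,3)] by blast
    obtain \<nu>Q where \<nu>Q: "X Q + \<nu>Q *s Y Q \<in> K'"
      using comb[OF Q(1) BF(1)[OF K'(1)] AB[OF Q(1) K'(1), symmetric] K'(2) inT[OF Q(1) K'(1)]] by blast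
    let ?v = "(\<alpha> * (\<nu>Q - \<nu>S)) *s Y S + (\<beta> * (\<nu>Q - \<nu>R)) *s Y R"
    have "?v = 0"
    proof (rule skewB[OF K'(1) K(2) K'(2)])
      show "?v \<in> K2" using XY[OF SR(1)] XY[OF SR(2)] subF[OF BF(1)[OF K(2)]]
        by (intro lin_comb_mem) simp_all
      show "?v \<in> ?T" using XT(2)[OF SR(1)] XT(2)[OF SR(2)] s.T(1)
        by (intro lin_comb_mem) simp_all
      have "?v = (X Q + \<nu>Q *s Y Q) - (\<alpha> *s (X S + \<nu>S *s Y S) + \<beta> *s (X R + \<nu>R *s Y R))"
        by (simp add: ab(3,4) vec_eq_iff algebra_simps)
      also have "\<dots> \<in> K'"
        using \<nu> \<nu>Q subF[OF BF(1)[OF K'(1)]] by (intro vec.subspace_diff lin_comb_mem) simp_all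
      finally show "?v \<in> K'" .
    qed
    then have "\<alpha> * (\<nu>Q - \<nu>S) = 0 \<and> \<beta> * (\<nu>Q - \<nu>R) = 0"
      using indep_comb_zero[OF _ YY[OF SR]] XY[OF SR(1)] by blast
    then show ?thesis using ab(1,2) by auto
  qed
  have "\<exists>\<nu>. \<forall>S\<in>?A. X S + \<nu> *s Y S \<in> K'" if K': "K' \<in> ?B - {K2}" for K'
  proof -
    have K'': "K' \<in> ?B" "K' \<noteq> K2" using K' by blast+
    obtain S where S: "S \<in> ?A" using third[of U0 U0] by metis
    have ex: "\<exists>\<nu>. X R + \<nu> *s Y R \<in> K'" if "R \<in> ?A" for R
      using comb[OF that BF(1)[OF K''(1)] AB[OF that K''(1), symmetric] K''(2) inT[OF that K''(1)]] .
    then obtain \<nu> where \<nu>: "X S + \<nu> *s Y S \<in> K'" using S by blast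
    have "X R + \<nu> *s Y R \<in> K'" if R: "R \<in> ?A" for R
    proof (cases "R = S")
      case False
      obtain \<nu>' where "X R + \<nu>' *s Y R \<in> K'" using ex[OF R] by blast
      then show ?thesis using same[OF K'' S R _ \<nu>] False by metis
    qed (use \<nu> in simp)
    then show ?thesis by blast
  qed
  then obtain N where N: "\<And>K' S. K' \<in> ?B - {K2} \<Longrightarrow> S \<in> ?A \<Longrightarrow> X S + N K' *s Y S \<in> K'"
    by metis
  have XYS: "X S + c *s Y S \<in> S" "X S + c *s Y S \<noteq> 0" if "S \<in> ?A" for S c
  proof -
    show "X S + c *s Y S \<in> S"
      using XY[OF that] subF[OF AF(1)[OF that]] by (simp add: vec.subspace_add vec.subspace_scale)
    show "X S + c *s Y S \<noteq> 0"
      using indep_comb_zero[OF _ YX[OF that], of 1 c] XY[OF that] by auto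
  qed
  have "inj_on N (?B - {K2})"
  proof (rule inj_onI, rule ccontr)
    fix K' K'' assume *: "K' \<in> ?B - {K2}" "K'' \<in> ?B - {K2}" "N K' = N K''" "K' \<noteq> K''"
    obtain S where S: "S \<in> ?A" using third[of U0 U0] by metis
    have B: "K' \<in> ?B" "K'' \<in> ?B" using * by blast+
    show False
      using skewD[OF AF(1)[OF S] BF(1)[OF B(1)] BF(1)[OF B(2)] AB[OF S B(1)] AB[OF S B(2)] *(4)
          XYS(1)[OF S] N[OF *(1) S]] N[OF *(2) S] XYS(2)[OF S] *(3) by metis
  qed
  then have cardN: "card (N ` (?B - {K2})) + 2 = card (line U0 U2)"
    using cardB K(2) card_Suc_Diff1[of ?B K2] by (simp add: card_image)
  have "\<exists>\<tau>. X S + \<tau> *s Y S \<in> U0" if S: "S \<in> ?A" for S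
    using comb[OF S U(1) AF(2)[OF S, symmetric]] BF(2)[OF K(2)] s.T(3) by blast
  then obtain t where t: "\<And>S. S \<in> ?A \<Longrightarrow> X S + t S *s Y S \<in> U0" by metis
  \<comment> \<open>Equal parameters would give a point on \<open>U0\<close>, \<open>S\<close> and \<open>K'\<close>.  The parameters left do not suffice
      for distinct values \<open>t S\<close>, and one coincidence makes \<open>t\<close> constant.\<close>
  have "t ` ?A \<subseteq> UNIV - N ` (?B - {K2})"
  proof (rule image_subsetI, rule DiffI[OF UNIV_I], rule notI)
    fix S assume S: "S \<in> ?A" and "t S \<in> N ` (?B - {K2})"
    then obtain K' where K': "K' \<in> ?B - {K2}" "t S = N K'" by blast
    have B: "K' \<in> ?B" using K' by blast
    show False
      using skewD[OF AF(1)[OF S] BF(1)[OF B] U(1) AB[OF S B] AF(2)[OF S] BF(2)[OF B]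
          XYS(1)[OF S] N[OF K'(1) S]] t[OF S] XYS(2)[OF S] K'(2) by metis
  qed
  then have "card (t ` ?A) \<le> CARD('a) - card (N ` (?B - {K2}))"
    by (metis card_Diff_subset card_mono finite subset_UNIV)
  then have "card (t ` ?A) < card ?A" using cardN cardA cardA3 cAB by arith
  then have "\<not> inj_on t ?A" using card_image by fastforce
  then obtain S R where SR: "S \<in> ?A" "R \<in> ?A" "S \<noteq> R" "t S = t R" unfolding inj_on_def by blast
  define p where "p Q = X Q + t S *s Y Q" for Q
  have pU: "p S \<in> U0" "p R \<in> U0" using t[OF SR(1)] t[OF SR(2)] SR(4) by (simp_all add: p_def)
  have pS: "p Q \<in> Q" "p Q \<noteq> 0" if "Q \<in> ?A" for Q using XYS[OF that] by (simp_all add: p_def)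
  have ind: "p R \<notin> vec.span {p S}"
    by (rule meet_indep[of U0 S R])
      (use pU pS[OF SR(1)] pS[OF SR(2)] U(1) AF[OF SR(1)] AF[OF SR(2)] SR(3) in auto)
  define m where "m = vec.span {p S, p R}"
  have m: "vec.subspace m" "vec.dim m = 2" "m \<subseteq> U0"
    using dim_span_pair[OF pS(2)[OF SR(1)] ind] vec.span_minimal[OF _ subF[OF U(1)], of "{p S, p R}"] pU
    by (simp_all add: m_def)
  have pm: "p Q \<in> m" if Q: "Q \<in> ?A" for Q
  proof (cases "Q = S \<or> Q = R")
    case True
    then show ?thesis by (auto simp: m_def intro: vec.span_base)
  next
    case False
    then obtain \<alpha> \<beta> where "X Q = \<alpha> *s X S + \<beta> *s X R" "Y Q = \<alpha> *s Y S + \<beta> *s Y R"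
      using rel[OF SR(1,2) Q SR(3)] by auto
    then have "p Q = \<alpha> *s p S + \<beta> *s p R" by (simp add: p_def vec_eq_iff algebra_simps)
    then show ?thesis by (auto simp: m_def span_pair_mem)
  qed
  have "Q \<inter> U0 \<subseteq> m" if Q: "Q \<in> ?A" for Q
  proof
    fix x assume x: "x \<in> Q \<inter> U0"
    have "p Q \<in> U0" using pm[OF Q] m(3) by blast
    then obtain c where "x = c *s p Q"
      using meet_multiple[OF AF(1)[OF Q] U(1) AF(2)[OF Q] pS(1)[OF Q] _ pS(2)[OF Q]] x by blast
    then show "x \<in> m" using pm[OF Q] m(1) by (simp add: vec.subspace_scale)
  qed
  then show ?thesis using m by blast
qed

lemma card_F_ge: "card F \<ge> CARD('a) * CARD('a) + CARD('a) + 1 - d"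
proof -
  have "CARD('a) * num_points CARD('a) n \<ge> CARD('a) * (CARD('a) + 1)"
    using num_points_n_ge by (rule mult_le_mono2)
  then show ?thesis using card_F by (simp add: num_points_Suc)
qed

text \<open>
  The regulus needs a second line through \<open>U0\<close> such that both together have enough members.  Either
  a longest line serves, or the given line is a longest one and any line with four members does.
\<close>

lemma collinear_meets:
  assumes U: "U0 \<in> F" "U1 \<in> F" "U0 \<noteq> U1" and c: "card (line U0 U1) \<ge> 4"
  obtains m where "vec.subspace m" "vec.dim m = 2" "m \<subseteq> U0"
    "\<And>S. S \<in> line U0 U1 - {U0} \<Longrightarrow> S \<inter> U0 \<subseteq> m"
proof -
  obtain U2 where U2: "U2 \<in> F" "U2 \<noteq> U0" "card (line U0 U2) \<ge> CARD('a)"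
    using ex_long_line[OF U] c by auto
  have "\<exists>W\<in>F. \<not> W \<subseteq> join U0 U1 \<and> card (line U0 W) \<ge> 4 \<and>
      card (line U0 U1) + card (line U0 W) \<ge> CARD('a) + 4"
  proof (cases "U2 \<subseteq> join U0 U1")
    case False
    then show ?thesis using U2 c q_bound by (intro bexI[of _ U2]) auto
  next
    case True
    then have "line U0 U2 = line U0 U1" using line_eq[OF U] U2 by (simp add: line_mem)
    then have c1: "card (line U0 U1) \<ge> CARD('a)" using U2 by simp
    let ?L = "{S \<in> F - {U0}. card (line U0 S) \<le> 3}"
    have "card (line U0 U1 \<union> ?L) \<le> CARD('a) + 3"
      using card_Un_le[of "line U0 U1" ?L] card_line_le[OF U] few_short_lines[OF U c1] by linarith
    moreover have "card F > CARD('a) + 3"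
    proof -
      have "CARD('a) * 7 \<le> CARD('a) * CARD('a)" using q_bound by (intro mult_le_mono2) linarith
      then show ?thesis using card_F_ge q_bound by linarith
    qed
    ultimately have "\<not> F \<subseteq> line U0 U1 \<union> ?L"
      by (meson card_mono finite leD order_le_less_trans)
    then obtain W where W: "W \<in> F" "W \<notin> line U0 U1" "W \<notin> ?L" by blast
    then have "W \<noteq> U0" using ends_in_line[OF U(1,2)] by blast
    then have "card (line U0 W) \<ge> 4" using W by auto
    then show ?thesis using W c1 by (auto simp: line_mem)
  qed
  then obtain W where W: "W \<in> F" "\<not> W \<subseteq> join U0 U1" "card (line U0 W) \<ge> 4"
      "card (line U0 U1) + card (line U0 W) \<ge> CARD('a) + 4" by blast
  show ?thesis using regulus_collinear[OF U(1,2) W(1) U(3) W(2) c W(3,4)] that by blast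
qed

text \<open>Only \<open>d + 1\<close> points of \<open>U0\<close> are on no other member.\<close>

lemma card_meets_in:
  assumes "U0 \<in> F" "vec.subspace l" "vec.dim l = 2" "l \<subseteq> U0"
  shows "card {S \<in> F - {U0}. S \<inter> U0 \<subseteq> l} + d \<ge> CARD('a)"
proof -
  let ?f = "\<lambda>S. S \<inter> U0"
  let ?C = "?f ` (F - {U0})" and ?D = "{S \<in> F - {U0}. S \<inter> U0 \<subseteq> l}"
  have C: "?C \<subseteq> points U0" using meet_points[OF _ assms(1)] by blast
  have "card ?C = card F - 1"
    using card_image[OF inj_meet[OF assms(1)]] assms(1) by simp
  moreover have "card (points U0) = card F + d"
    using card_points[OF subF[OF assms(1)]] dimF[OF assms(1)] card_F by simp
  moreover have "card F \<ge> 1" using assms(1) by (metis Suc_leI One_nat_def card_gt_0_iff empty_iff finite)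
  ultimately have "card (points U0 - ?C) = d + 1" using C by (simp add: card_Diff_subset)
  moreover have "points l - ?C \<subseteq> points U0 - ?C" using assms(4) by (auto simp: points_def)
  then have "card (points l - ?C) \<le> card (points U0 - ?C)" by (intro card_mono) auto
  moreover have "card (points l) = CARD('a) + 1"
    using card_points[OF assms(2)] assms(3) by (simp add: num_points_2)
  moreover have "card (points l) \<le> card (points l - ?C) + card (?f ` ?D)"
  proof -
    have "points l \<subseteq> (points l - ?C) \<union> ?f ` ?D" by (auto simp: points_def)
    then have "card (points l) \<le> card ((points l - ?C) \<union> ?f ` ?D)" by (intro card_mono) auto
    then show ?thesis using card_Un_le order_trans by blast
  qed
  moreover have "card (?f ` ?D) \<le> card ?D" by (rule card_image_le) simp
  ultimately show ?thesis by linarith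
qed

text \<open>
  Members whose points are off a given projective line of \<open>U0\<close> are enough to span \<open>U0\<close>, even if two
  of them are disregarded.
\<close>

lemma card_meets_outside:
  assumes "U0 \<in> F" "vec.subspace m" "vec.dim m = 2"
    and "card L \<le> 2"
  shows "card {S \<in> F - {U0} - L. \<not> S \<inter> U0 \<subseteq> m} > num_points CARD('a) n"
proof -
  let ?D = "{S \<in> F - {U0}. S \<inter> U0 \<subseteq> m}" and ?E = "{S \<in> F - {U0} - L. \<not> S \<inter> U0 \<subseteq> m}"
  have "card ?D \<le> num_points CARD('a) (vec.dim m)"
  proof (rule card_le_points[OF assms(2)])
    show "inj_on (\<lambda>S. S \<inter> U0) ?D" by (rule inj_on_subset[OF inj_meet[OF assms(1)]]) auto
    show "(\<lambda>S. S \<inter> U0) ` ?D \<subseteq> points m"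
      using meet_points[OF _ assms(1)] by (auto simp: points_def)
  qed
  then have "card ?D \<le> CARD('a) + 1" using assms(3) by (simp add: num_points_2)
  moreover have "F \<subseteq> {U0} \<union> (?D \<union> (?E \<union> L))" by blast
  then have "card F \<le> card ({U0} \<union> (?D \<union> (?E \<union> L)))" by (intro card_mono) auto
  then have "card F \<le> 1 + (card ?D + (card ?E + card L))"
    using card_Un_le[of "{U0}" "?D \<union> (?E \<union> L)"] card_Un_le[of ?D "?E \<union> L"] card_Un_le[of ?E L]
    by simp
  moreover have "card F + d = 1 + CARD('a) * num_points CARD('a) n"
    using card_F by (simp add: num_points_Suc)
  moreover have "CARD('a) * num_points CARD('a) n \<ge> 7 * num_points CARD('a) n"
    using q_bound by (intro mult_le_mono1) linarith
  ultimately show ?thesis using num_points_n_ge q_bound assms(4) by linarith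
qed

end

section \<open>Linear maps along a line\<close>

lemma lin_on_inj:
  assumes "vec.subspace X" "lin_on X f" "\<And>x. x \<in> X \<Longrightarrow> f x = 0 \<Longrightarrow> x = 0"
  shows "inj_on f X"
proof (rule inj_onI)
  fix x y assume xy: "x \<in> X" "y \<in> X" "f x = f y"
  have "f (1 *s x + (-1) *s y) = 0" using lin_onD[OF assms(2) xy(1,2), of 1 "-1"] xy(3) by simp
  moreover have "1 *s x + (-1) *s y \<in> X" using assms(1) xy by (intro lin_comb_mem)
  ultimately have "1 *s x + (-1) *s y = 0" using assms(3) by blast
  then show "x = y" by simp
qed

lemma lin_on_scale:
  assumes "lin_on X f" "x \<in> X"
  shows "f (c *s x) = c *s f x"
  using lin_onD[OF assms assms(2), of c 0] by simp

lemma lin_on_add: "lin_on X f \<Longrightarrow> x \<in> X \<Longrightarrow> y \<in> X \<Longrightarrow> f (x + y) = f x + f y"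
  using lin_onD[of X f x y 1 1] by simp

lemma lin_on_agree:
  assumes "vec.subspace X" "lin_on X f" "lin_on X g" "B \<subseteq> X" "X \<subseteq> vec.span B"
    and "\<And>b. b \<in> B \<Longrightarrow> f b = g b" "x \<in> X"
  shows "f x = g x"
proof -
  let ?E = "{x \<in> X. f x = g x}"
  have "0 \<in> ?E" using lin_on_scale[OF assms(2,7), of 0] lin_on_scale[OF assms(3,7), of 0]
      vec.subspace_0[OF assms(1)] by simp
  then have "vec.subspace ?E"
    unfolding vec.subspace_def using assms(1) lin_on_add[OF assms(2)] lin_on_add[OF assms(3)]
      lin_on_scale[OF assms(2)] lin_on_scale[OF assms(3)]
    by (auto simp: vec.subspace_add vec.subspace_scale)
  moreover have "B \<subseteq> ?E" using assms(4,6) by blast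
  ultimately have "vec.span B \<subseteq> ?E" by (intro vec.span_minimal)
  then show ?thesis using assms(5,7) by blast
qed

context partial_dual_arc
begin

lemma card_element: "U \<in> F \<Longrightarrow> card U = CARD('a) ^ (n + 1)"
  using card_subspace[OF subF[of U]] dimF[of U] by simp

text \<open>
  In the model \<open>uV\<close> is carried to \<open>vV\<close> by \<open>uy \<mapsto> vy\<close>, and \<open>uy + vy\<close> lies in the third element
  \<open>(u + v)V\<close> of their line.  Two further elements \<open>U2\<close> and \<open>U3\<close> of the line determine this map: \<open>p\<close>
  goes to the \<open>u\<close> with \<open>p + u \<in> U2\<close> and \<open>p + \<mu>u \<in> U3\<close>.  For a point \<open>p\<close> cut out by an element off
  the line there are such \<open>u\<close> and \<open>\<mu>\<close>.  Comparison along the lines of \<open>U0\<close> shows that \<open>\<mu>\<close> does not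
  depend on \<open>p\<close>, and the points \<open>p\<close> span \<open>U0\<close>.
\<close>

lemma line_map:
  assumes F: "U0 \<in> F" "U1 \<in> F" "U2 \<in> F" "U3 \<in> F"
    and ne: "U0 \<noteq> U1" "U0 \<noteq> U2" "U0 \<noteq> U3" "U1 \<noteq> U2" "U1 \<noteq> U3" "U2 \<noteq> U3"
    and on: "U2 \<subseteq> join U0 U1" "U3 \<subseteq> join U0 U1"
    and m0: "vec.subspace m0" "vec.dim m0 = 2" "m0 \<subseteq> U0"
      "\<And>S. S \<in> line U0 U1 - {U0} \<Longrightarrow> S \<inter> U0 \<subseteq> m0"
  obtains \<phi> where "lin_on U0 \<phi>" "\<phi> ` U0 = U1" "\<And>p. p \<in> U0 \<Longrightarrow> \<phi> p = 0 \<Longrightarrow> p = 0"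
    "\<And>p. p \<in> U0 \<Longrightarrow> p + \<phi> p \<in> U2" "\<And>p. p \<in> U0 \<Longrightarrow> p + \<phi> p = 0 \<Longrightarrow> p = 0"
    "\<And>p. p \<in> U0 \<Longrightarrow> \<phi> p \<in> U0 \<Longrightarrow> p \<in> m0"
    "\<And>S p. S \<in> F \<Longrightarrow> S \<noteq> U0 \<Longrightarrow> p \<in> S \<Longrightarrow> p \<in> U0 \<Longrightarrow> p \<notin> m0 \<Longrightarrow> \<phi> p \<in> S"
proof -
  note sF = subF[OF F(1)] subF[OF F(2)] subF[OF F(3)] subF[OF F(4)]
  have L: "U0 \<in> line U0 U1" "U1 \<in> line U0 U1" "U2 \<in> line U0 U1" "U3 \<in> line U0 U1"
    using ends_in_line[OF F(1,2)] on F by (auto simp: line_mem)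
  have "card {U0, U1, U2, U3} \<le> card (line U0 U1)" using L by (intro card_mono) auto
  then have c4: "card (line U1 U0) \<ge> 4" using ne by (simp add: line_commute)
  obtain m1 where m1: "vec.subspace m1" "vec.dim m1 = 2" "m1 \<subseteq> U1"
    "\<And>S. S \<in> line U1 U0 - {U1} \<Longrightarrow> S \<inter> U1 \<subseteq> m1"
    using collinear_meets[OF F(2,1) ne(1)[symmetric] c4] by blast
  have e1: "U0 \<inter> U1 \<subseteq> m0" "U2 \<inter> U0 \<subseteq> m0" "U3 \<inter> U0 \<subseteq> m0"
    using m0(4)[of U1] m0(4)[of U2] m0(4)[of U3] L ne by auto
  have e2: "U0 \<inter> U1 \<subseteq> m1" "U2 \<inter> U1 \<subseteq> m1" "U3 \<inter> U1 \<subseteq> m1"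
    using m1(4)[of U0] m1(4)[of U2] m1(4)[of U3] L ne by (auto simp: line_commute)
  obtain e01 where e01: "e01 \<in> U0" "e01 \<in> U1" "e01 \<noteq> 0" using ex_meet[OF F(1,2)] by blast
  obtain e12 where e12: "e12 \<in> U1" "e12 \<in> U2" "e12 \<noteq> 0" using ex_meet[OF F(2,3)] by blast
  obtain e02 where e02: "e02 \<in> U0" "e02 \<in> U2" "e02 \<noteq> 0" using ex_meet[OF F(1,3)] by blast
  obtain e03 where e03: "e03 \<in> U0" "e03 \<in> U3" "e03 \<noteq> 0" using ex_meet[OF F(1,4)] by blast
  have i1: "e12 \<notin> vec.span {e01}"
    by (rule meet_indep[of U1 U0 U2]) (use F ne e01 e12 in simp_all)
  have i02: "e02 \<notin> vec.span {e01}"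
    by (rule meet_indep[of U0 U1 U2]) (use F ne e01 e02 in simp_all)
  have i03: "e03 \<notin> vec.span {e01}"
    by (rule meet_indep[of U0 U1 U3]) (use F ne e01 e03 in simp_all)
  \<comment> \<open>The correspondence \<open>p \<mapsto> u\<close> defined by \<open>p + u \<in> U2\<close> is injective modulo \<open>m0\<close> and \<open>m1\<close>.\<close>
  have in_m0: "p \<in> m0" if p: "p \<in> U0" "u \<in> m1" "p + u \<in> U2" for p u
  proof -
    have "e01 \<in> m1" "e12 \<in> m1" using e2 e01 e12 by blast+
    then obtain a b where ab: "u = a *s e01 + b *s e12"
      using dim2_comb[OF m1(1,2) _ _ e01(3) i1 p(2)] by blast
    have "p + a *s e01 = (p + u) - b *s e12" by (simp add: ab)
    also have "\<dots> \<in> U2" using p(3) e12(2) sF(3) by (simp add: vec.subspace_diff vec.subspace_scale)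
    finally have "p + a *s e01 \<in> U2" .
    moreover have "p + a *s e01 \<in> U0" using p(1) e01(1) sF(1)
      by (simp add: vec.subspace_add vec.subspace_scale)
    ultimately have "p + a *s e01 \<in> m0" using e1(2) by blast
    moreover have "a *s e01 \<in> m0" using e1(1) e01 m0(1) by (meson IntI subsetD vec.subspace_scale)
    ultimately have "(p + a *s e01) - a *s e01 \<in> m0" using m0(1) by (intro vec.subspace_diff)
    then show ?thesis by simp
  qed
  have off_line: "\<not> S \<subseteq> join U0 U1" if S: "S \<in> F" "S \<noteq> U0" "p \<in> S" "p \<in> U0" "p \<notin> m0" for S p
    using m0(4)[of S] that by (auto simp: line_mem)
  have js: "U1 \<subseteq> join U0 U1" "U0 \<subseteq> join U0 U1" using join_upper(1)[of U0 U1] join_upper(2)[of U1 U0] by auto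
  define rel where "rel p u \<mu> \<longleftrightarrow> u \<in> U1 \<and> p + u \<in> U2 \<and> p + \<mu> *s u \<in> U3" for p u \<mu>
  have ex_rel: "\<exists>u \<mu>. u \<in> S \<and> rel p u \<mu>"
    if S: "S \<in> F" "S \<noteq> U0" "p \<in> S" "p \<in> U0" "p \<notin> m0" for S p
  proof -
    have offS: "\<not> S \<subseteq> join U0 U1" by (rule off_line[OF S])
    then have neS: "S \<noteq> U1" "S \<noteq> U2" "S \<noteq> U3" using on js by blast+
    have p0: "p \<noteq> 0" using S(5) m0(1) vec.subspace_0 by blast
    obtain w where w: "w \<in> S" "w \<in> U1" "w \<noteq> 0" using ex_meet[OF S(1) F(2)] by blast
    obtain y where y: "y \<in> S" "y \<in> U2" "y \<noteq> 0" using ex_meet[OF S(1) F(3)] by blast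
    obtain z where z: "z \<in> S" "z \<in> U3" "z \<noteq> 0" using ex_meet[OF S(1) F(4)] by blast
    have wp: "w \<notin> vec.span {p}"
      by (rule meet_indep[of S U0 U1]) (use S F neS ne w p0 in simp_all)
    have d2: "vec.dim (S \<inter> join U0 U1) = 2" by (rule dim_meet_join[OF F(1,2) S(1) ne(1) offS])
    have s2: "vec.subspace (S \<inter> join U0 U1)" using subF[OF S(1)] by (simp add: vec.subspace_inter)
    have pw: "p \<in> S \<inter> join U0 U1" "w \<in> S \<inter> join U0 U1" using S(3,4) w js by blast+
    have yz: "y \<in> S \<inter> join U0 U1" "z \<in> S \<inter> join U0 U1" using y z on by blast+
    obtain a b where ab: "y = a *s p + b *s w" using dim2_comb[OF s2 d2 pw p0 wp yz(1)] by blast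
    obtain a' b' where ab': "z = a' *s p + b' *s w" using dim2_comb[OF s2 d2 pw p0 wp yz(2)] by blast
    have a: "a \<noteq> 0"
    proof
      assume "a = 0"
      then have "y \<in> U1" using ab w sF(2) by (simp add: vec.subspace_scale)
      then show False using skewD[OF S(1) F(2,3) neS(1,2) ne(4)] y by blast
    qed
    have b: "b \<noteq> 0"
    proof
      assume "b = 0"
      then have "y \<in> U0" using ab S(4) sF(1) by (simp add: vec.subspace_scale)
      then show False using skewD[OF S(1) F(1,3) S(2) neS(2) ne(2)] y by blast
    qed
    have a': "a' \<noteq> 0"
    proof
      assume "a' = 0"
      then have "z \<in> U1" using ab' w sF(2) by (simp add: vec.subspace_scale)
      then show False using skewD[OF S(1) F(2,4) neS(1,3) ne(5)] z by blast
    qed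
    define u where "u = (b / a) *s w"
    have "p + u = inverse a *s y"
      using a by (simp add: u_def ab vec.scale_right_distrib divide_inverse mult.commute)
    then have 1: "p + u \<in> U2" using y sF(3) by (simp add: vec.subspace_scale)
    have "b' * a / (a' * b) * (b / a) = b' / a'" using a b by simp
    then have "p + (b' * a / (a' * b)) *s u = p + (b' / a') *s w" by (simp only: u_def vec.scale_scale)
    also have "\<dots> = inverse a' *s z"
      using a' by (simp add: ab' vec.scale_right_distrib divide_inverse mult.commute)
    finally have "p + (b' * a / (a' * b)) *s u = inverse a' *s z" .
    then have 2: "p + (b' * a / (a' * b)) *s u \<in> U3" using z sF(4) by (simp add: vec.subspace_scale)
    have "u \<in> S" "u \<in> U1" using w subF[OF S(1)] sF(2) by (simp_all add: u_def vec.subspace_scale)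
    then show ?thesis using 1 2 unfolding rel_def by blast
  qed
  have diff: "(s * (\<mu>'' - \<mu>)) *s u + (t * (\<mu>'' - \<mu>')) *s u' \<in> m1"
    if r: "rel p u \<mu>" "rel p' u' \<mu>'" "rel (s *s p + t *s p') u'' \<mu>''" for p u \<mu> p' u' \<mu>' s t u'' \<mu>''
  proof -
    note r = r[unfolded rel_def]
    define v where "v = u'' - (s *s u + t *s u')"
    define w where "w = \<mu>'' *s u'' - ((s * \<mu>) *s u + (t * \<mu>') *s u')"
    have "v = (s *s p + t *s p' + u'') - (s *s (p + u) + t *s (p' + u'))"
      by (simp add: v_def vec.scale_right_distrib)
    also have "\<dots> \<in> U2" using r sF(3) by (intro vec.subspace_diff lin_comb_mem) simp_all
    finally have "v \<in> U2" .
    moreover have "v \<in> U1" unfolding v_def using r sF(2) by (intro vec.subspace_diff lin_comb_mem) simp_all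
    ultimately have v: "v \<in> m1" using e2 by blast
    have "w = (s *s p + t *s p' + \<mu>'' *s u'') - (s *s (p + \<mu> *s u) + t *s (p' + \<mu>' *s u'))"
      by (simp add: w_def vec.scale_right_distrib)
    also have "\<dots> \<in> U3" using r sF(4) by (intro vec.subspace_diff lin_comb_mem) simp_all
    finally have "w \<in> U3" .
    moreover have "w \<in> U1" unfolding w_def using r sF(2)
      by (intro vec.subspace_diff lin_comb_mem vec.subspace_scale) simp_all
    ultimately have w: "w \<in> m1" using e2 by blast
    have "(s * (\<mu>'' - \<mu>)) *s u + (t * (\<mu>'' - \<mu>')) *s u' = w - \<mu>'' *s v"
      by (simp add: v_def w_def vec_eq_iff algebra_simps)
    then show ?thesis using v w m1(1) by (simp only: vec.subspace_diff vec.subspace_scale)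
  qed
  define good where "good p \<longleftrightarrow> p \<in> U0 \<and> p \<notin> m0 \<and> (\<exists>S\<in>F. S \<noteq> U0 \<and> p \<in> S)" for p
  \<comment> \<open>Points that are dependent modulo \<open>m0\<close> are compared directly, others through a third good
      point on their line.\<close>
  have same: "\<mu> = \<mu>'" if g: "good p" "good p'" and r: "rel p u \<mu>" "rel p' u' \<mu>'" for p p' u u' \<mu> \<mu>'
  proof (cases "\<exists>s. p' - s *s p \<in> m0")
    case True
    then obtain s where s: "p' - s *s p \<in> m0" by blast
    have s0: "s \<noteq> 0" using s g(2) by (auto simp: good_def)
    have pU: "p \<in> U0" "p \<notin> m0" using g(1) by (auto simp: good_def)
    have em: "e01 \<in> m0" "e02 \<in> m0" "e03 \<in> m0" "e01 \<in> m1" using e1 e2 e01 e02 e03 by blast+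
    obtain x y where xy: "p' - s *s p = x *s e01 + y *s e02"
      using dim2_comb[OF m0(1,2) em(1,2) e01(3) i02 s] by blast
    obtain x' y' where xy': "p' - s *s p = x' *s e01 + y' *s e03"
      using dim2_comb[OF m0(1,2) em(1,3) e01(3) i03 s] by blast
    note r = r[unfolded rel_def]
    have p': "p' = s *s p + (x *s e01 + y *s e02)" "p' = s *s p + (x' *s e01 + y' *s e03)"
      using xy xy' by (simp_all add: algebra_simps)
    have "x *s e01 + u' - s *s u = (p' + u') - (s *s (p + u) + y *s e02)"
      by (subst p'(1)) (simp add: vec.scale_right_distrib)
    moreover have "(p' + u') - (s *s (p + u) + y *s e02) \<in> U2"
      using r e02 sF(3) by (intro vec.subspace_diff lin_comb_mem) simp_all
    moreover have "x *s e01 + u' - s *s u \<in> U1" using r e01 sF(2)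
      by (simp add: vec.subspace_diff vec.subspace_add vec.subspace_scale)
    ultimately have v: "x *s e01 + u' - s *s u \<in> m1" using e2(2) by (metis IntI subsetD)
    have "x' *s e01 + \<mu>' *s u' - (s * \<mu>) *s u = (p' + \<mu>' *s u') - (s *s (p + \<mu> *s u) + y' *s e03)"
      by (subst p'(2)) (simp add: vec.scale_right_distrib)
    moreover have "(p' + \<mu>' *s u') - (s *s (p + \<mu> *s u) + y' *s e03) \<in> U3"
      using r e03 sF(4) by (intro vec.subspace_diff lin_comb_mem) simp_all
    moreover have "x' *s e01 + \<mu>' *s u' - (s * \<mu>) *s u \<in> U1" using r e01 sF(2)
      by (simp add: vec.subspace_diff vec.subspace_add vec.subspace_scale)
    ultimately have w: "x' *s e01 + \<mu>' *s u' - (s * \<mu>) *s u \<in> m1" using e2(3) by (metis IntI subsetD)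
    have "(s * (\<mu>' - \<mu>)) *s u = (x' *s e01 + \<mu>' *s u' - (s * \<mu>) *s u)
        - (\<mu>' *s (x *s e01 + u' - s *s u) + (x' - \<mu>' * x) *s e01)"
      by (simp add: vec_eq_iff algebra_simps)
    also have "\<dots> \<in> m1" by (rule vec.subspace_diff[OF m1(1) w lin_comb_mem[OF m1(1) v em(4)]])
    finally have su: "(s * (\<mu>' - \<mu>)) *s u \<in> m1" .
    show ?thesis
    proof (rule ccontr)
      assume "\<mu> \<noteq> \<mu>'"
      then have nz: "s * (\<mu>' - \<mu>) \<noteq> 0" using s0 by simp
      have "inverse (s * (\<mu>' - \<mu>)) *s ((s * (\<mu>' - \<mu>)) *s u) \<in> m1"
        by (rule vec.subspace_scale[OF m1(1) su])
      then have "u \<in> m1" by (simp only: vec.scale_scale left_inverse[OF nz] vec.scale_one)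
      then show False using in_m0[OF pU(1)] r pU(2) by blast
    qed
  next
    case False
    have p: "p \<in> U0" "p \<notin> m0" "p' \<in> U0" using g by (auto simp: good_def)
    have p0: "p \<noteq> 0" using p(2) m0(1) vec.subspace_0 by blast
    have ind: "p' \<notin> vec.span {p}"
    proof
      assume "p' \<in> vec.span {p}"
      then obtain c where "p' = c *s p" by (auto simp: span_singleton_mem)
      then have "p' - c *s p \<in> m0" using m0(1) by (simp add: vec.subspace_0)
      then show False using False by blast
    qed
    let ?l = "vec.span {p, p'}"
    have l: "vec.subspace ?l" "vec.dim ?l = 2" "?l \<subseteq> U0"
      using dim_span_pair[OF p0 ind] vec.span_minimal[OF _ sF(1), of "{p, p'}"] p by simp_all
    obtain S1 S2 where S12: "S1 \<in> F" "S1 \<noteq> U0" "p \<in> S1" "S2 \<in> F" "S2 \<noteq> U0" "p' \<in> S2"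
      using g by (auto simp: good_def)
    let ?D = "{S \<in> F - {U0}. S \<inter> U0 \<subseteq> ?l}"
    have "card ?D > 2" using card_meets_in[OF F(1) l] q_bound by linarith
    moreover have "card {S1, S2} \<le> 2" by (simp add: card_insert_if)
    ultimately have "\<not> ?D \<subseteq> {S1, S2}" using card_mono[of "{S1, S2}" ?D] by force
    then obtain S where S: "S \<in> F" "S \<noteq> U0" "S \<inter> U0 \<subseteq> ?l" "S \<noteq> S1" "S \<noteq> S2" by blast
    obtain p'' where p'': "p'' \<in> S" "p'' \<in> U0" "p'' \<noteq> 0" using ex_meet[OF S(1) F(1)] by blast
    then have "p'' \<in> ?l" using S(3) by blast
    then obtain s t where st: "p'' = s *s p + t *s p'" by (auto simp: span_pair_mem)
    have t0: "t \<noteq> 0"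
    proof
      assume "t = 0"
      then have "p'' \<in> S1" using st S12(3) subF[OF S12(1)] by (simp add: vec.subspace_scale)
      then show False using skewD[OF F(1) S(1) S12(1) S(2)[symmetric] S12(2)[symmetric] S(4)] p'' by blast
    qed
    have s0: "s \<noteq> 0"
    proof
      assume "s = 0"
      then have "p'' \<in> S2" using st S12(6) subF[OF S12(4)] by (simp add: vec.subspace_scale)
      then show False using skewD[OF F(1) S(1) S12(4) S(2)[symmetric] S12(5)[symmetric] S(5)] p'' by blast
    qed
    have not_m0: "c *s p + d' *s p' \<in> m0 \<Longrightarrow> c = 0 \<and> d' = 0" for c d'
    proof -
      assume cd: "c *s p + d' *s p' \<in> m0"
      have "d' = 0"
      proof (rule ccontr)
        assume d0: "d' \<noteq> 0"
        have "inverse d' *s (c *s p + d' *s p') \<in> m0" by (rule vec.subspace_scale[OF m0(1) cd])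
        then have "p' - (- (inverse d' * c)) *s p \<in> m0"
          using d0 by (simp add: vec.scale_right_distrib add.commute)
        then show False using False by blast
      qed
      moreover have "c = 0"
      proof (rule ccontr)
        assume c0: "c \<noteq> 0"
        have "c *s p \<in> m0" using cd \<open>d' = 0\<close> by simp
        then have "inverse c *s (c *s p) \<in> m0" by (rule vec.subspace_scale[OF m0(1)])
        then show False using c0 p(2) by simp
      qed
      ultimately show "c = 0 \<and> d' = 0" by simp
    qed
    have "p'' \<notin> m0" using not_m0[of s t] st s0 by blast
    then obtain u'' \<mu>'' where r'': "rel p'' u'' \<mu>''" using ex_rel[OF S(1,2) p''(1,2)] by blast
    define a b where "a = s * (\<mu>'' - \<mu>)" and "b = t * (\<mu>'' - \<mu>')"
    have "a *s u + b *s u' \<in> m1" using diff[OF r r''[unfolded st]] by (simp add: a_def b_def)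
    moreover have "a *s p + b *s p' + (a *s u + b *s u') \<in> U2"
    proof -
      have "a *s (p + u) + b *s (p' + u') \<in> U2" using r sF(3) unfolding rel_def by (intro lin_comb_mem) simp_all
      then show ?thesis by (simp add: vec.scale_right_distrib algebra_simps)
    qed
    moreover have "a *s p + b *s p' \<in> U0" using p sF(1) by (intro lin_comb_mem)
    ultimately have "a *s p + b *s p' \<in> m0" using in_m0 by blast
    then have "a = 0 \<and> b = 0" by (rule not_m0)
    then show ?thesis using s0 t0 by (auto simp: a_def b_def)
  qed
  let ?G = "{S \<in> F - {U0}. \<not> S \<inter> U0 \<subseteq> m0}"
  have goodG: "good x" if SG: "S \<in> ?G" and x0: "x \<in> S" "x \<in> U0" "x \<noteq> 0" for S x
  proof -
    have S: "S \<in> F" "S \<noteq> U0" using SG by auto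
    have "x \<notin> m0"
    proof
      assume x: "x \<in> m0"
      have "S \<inter> U0 \<subseteq> m0"
      proof
        fix y assume "y \<in> S \<inter> U0"
        then obtain c where "y = c *s x" using meet_multiple[OF S(1) F(1) S(2) x0] by blast
        then show "y \<in> m0" using x m0(1) by (simp add: vec.subspace_scale)
      qed
      then show False using SG by blast
    qed
    then show ?thesis using S x0 by (auto simp: good_def)
  qed
  have Gbig: "card ?G > num_points CARD('a) n"
    using card_meets_outside[OF F(1) m0(1,2), of "{}"] by (simp only: Diff_empty card.empty)
  have "?G \<noteq> {}"
  proof
    assume "?G = {}"
    then have "card ?G = 0" by (simp only: card.empty)
    then show False using Gbig by (simp only: not_less_zero)
  qed
  then obtain S where S: "S \<in> ?G" by (meson all_not_in_conv)
  then have "S \<in> F" by blast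
  then obtain p1 where p1: "p1 \<in> S" "p1 \<in> U0" "p1 \<noteq> 0" using ex_meet[OF _ F(1)] by blast
  have g1: "good p1" by (rule goodG[OF S p1])
  have p1': "p1 \<notin> m0" "S \<noteq> U0" using g1 S by (auto simp: good_def)
  obtain u1 \<mu> where u1: "u1 \<in> S" and r1: "rel p1 u1 \<mu>"
    using ex_rel[OF \<open>S \<in> F\<close> p1'(2) p1(1,2) p1'(1)] by blast
  have \<mu>1: "\<mu> \<noteq> 1"
  proof
    assume "\<mu> = 1"
    then have "p1 + u1 \<in> U2" "p1 + u1 \<in> U3" "p1 + u1 \<in> S"
      using r1 p1(1) u1 subF[OF \<open>S \<in> F\<close>] by (simp_all add: rel_def vec.subspace_add)
    moreover have "\<not> S \<subseteq> join U0 U1"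
      by (rule off_line[OF \<open>S \<in> F\<close> p1'(2) p1(1,2) p1'(1)])
    then have "U2 \<noteq> S" "U3 \<noteq> S" using on by blast+
    ultimately have "p1 + u1 = 0" using skewD[OF F(3,4) \<open>S \<in> F\<close> ne(6)] by blast
    then have "p1 = (- 1) *s u1" by (simp add: add_eq_0_iff2)
    then have "p1 \<in> U1" using r1 sF(2) vec.subspace_scale[OF sF(2), of u1 "- 1"] by (simp add: rel_def)
    then show False using e1(1) p1(2) p1'(1) by blast
  qed
  have r_good: "\<exists>u. u \<in> S \<and> rel p u \<mu>"
    if S: "S \<in> F" "S \<noteq> U0" "p \<in> S" "p \<in> U0" "p \<notin> m0" for S p
  proof -
    obtain u \<mu>' where u: "u \<in> S" "rel p u \<mu>'" using ex_rel[OF S] by blast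
    have "good p" using S unfolding good_def by blast
    then have "\<mu>' = \<mu>" using same[OF _ g1 u(2) r1] by blast
    then show ?thesis using u by blast
  qed
  define P where "P = {p \<in> U0. \<exists>u. rel p u \<mu>}"
  have relin: "rel (c *s p + d' *s p') (c *s u + d' *s u') \<mu>" if "rel p u \<mu>" "rel p' u' \<mu>" for p u p' u' c d'
  proof -
    have "c *s p + d' *s p' + (c *s u + d' *s u') = c *s (p + u) + d' *s (p' + u')"
      "c *s p + d' *s p' + \<mu> *s (c *s u + d' *s u') = c *s (p + \<mu> *s u) + d' *s (p' + \<mu> *s u')"
      by (simp_all add: vec_eq_iff algebra_simps)
    then show ?thesis using that sF(2,3,4) unfolding rel_def by (simp only: lin_comb_mem)
  qed
  have r0: "rel 0 0 \<mu>" using sF by (simp add: rel_def vec.subspace_0)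
  have subP: "vec.subspace P"
    unfolding vec.subspace_def
  proof (intro conjI ballI allI)
    show "0 \<in> P" using r0 sF(1) by (auto simp: P_def vec.subspace_0)
  next
    fix x y assume "x \<in> P" "y \<in> P"
    then obtain u v where "rel x u \<mu>" "rel y v \<mu>" "x \<in> U0" "y \<in> U0" by (auto simp: P_def)
    then show "x + y \<in> P" using relin[of x u y v 1 1] sF(1) by (auto simp: P_def vec.subspace_add)
  next
    fix c x assume "x \<in> P"
    then obtain u where "rel x u \<mu>" "x \<in> U0" by (auto simp: P_def)
    then show "c *s x \<in> P" using relin[OF _ r0, of x u c 0] sF(1) by (auto simp: P_def vec.subspace_scale)
  qed
  have "U0 \<subseteq> P"
  proof (rule many_points_span[OF sF(1) subP, of n "\<lambda>S. S \<inter> U0" ?G])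
    show "vec.dim U0 = Suc n" using dimF[OF F(1)] by simp
    show "inj_on (\<lambda>S. S \<inter> U0) ?G" by (rule inj_on_subset[OF inj_meet[OF F(1)]]) auto
    show "(\<lambda>S. S \<inter> U0) ` ?G \<subseteq> points U0" using meet_points[OF _ F(1)] by auto
    show "S \<inter> U0 \<subseteq> P" if "S \<in> ?G" for S
    proof
      fix x assume x: "x \<in> S \<inter> U0"
      show "x \<in> P"
      proof (cases "x = 0")
        case True
        then show ?thesis using subP by (simp add: vec.subspace_0)
      next
        case False
        then have "good x" using goodG[OF that] x by blast
        then show ?thesis using r_good[of S x] that x by (auto simp: P_def good_def)
      qed
    qed
    show "num_points CARD('a) n < card ?G" by (rule Gbig)
  qed
  then have ex: "\<exists>u. rel p u \<mu>" if "p \<in> U0" for p using that by (auto simp: P_def)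
  have \<mu>0: "\<mu> \<noteq> 0"
  proof
    assume "\<mu> = 0"
    then have "p1 \<in> U3" using r1 by (simp add: rel_def)
    then show False using e1(3) g1 by (auto simp: good_def)
  qed
  \<comment> \<open>Two solutions differ by a vector of \<open>U1 \<inter> U2 \<inter> U3\<close>.\<close>
  have uniq: "u = u'" if "rel p u \<mu>" "rel p u' \<mu>" for p u u'
  proof -
    note r = that[unfolded rel_def]
    have "u - u' \<in> U1" using r sF(2) by (simp add: vec.subspace_diff)
    moreover have "(p + u) - (p + u') \<in> U2" using r sF(3) by (intro vec.subspace_diff) simp_all
    moreover have "(p + \<mu> *s u) - (p + \<mu> *s u') \<in> U3" using r sF(4) by (intro vec.subspace_diff) simp_all
    then have "\<mu> *s (u - u') \<in> U3" by (simp add: vec.scale_right_diff_distrib)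
    then have "inverse \<mu> *s (\<mu> *s (u - u')) \<in> U3" by (rule vec.subspace_scale[OF sF(4)])
    then have "u - u' \<in> U3" using \<mu>0 by simp
    ultimately have "u - u' = 0" using skewD[OF F(2,3,4) ne(4,5,6), of "u - u'"] by simp
    then show ?thesis by simp
  qed
  define \<phi> where "\<phi> p = (THE u. rel p u \<mu>)" for p
  have \<phi>_eq: "\<phi> p = u" if "rel p u \<mu>" for p u
    unfolding \<phi>_def using that uniq by (intro the_equality) blast+
  have \<phi>: "rel p (\<phi> p) \<mu>" if "p \<in> U0" for p using ex[OF that] \<phi>_eq by metis
  have lin: "lin_on U0 \<phi>" unfolding lin_on_def using \<phi> relin \<phi>_eq by blast
  have zero: "p = 0" if "p \<in> U0" "\<phi> p = 0" for p
  proof -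
    have "p \<in> U2" "p \<in> U3" using \<phi>[OF that(1)] that(2) by (simp_all add: rel_def)
    then show ?thesis using skewD[OF F(1,3,4) ne(2,3,6)] that(1) by blast
  qed
  have inj: "inj_on \<phi> U0" by (rule lin_on_inj[OF sF(1) lin zero])
  have img: "\<phi> ` U0 = U1"
  proof (rule card_subset_eq)
    show "\<phi> ` U0 \<subseteq> U1" using \<phi> by (auto simp: rel_def)
    show "card (\<phi> ` U0) = card U1"
      using card_image[OF inj] card_element[OF F(1)] card_element[OF F(2)] by simp
  qed simp
  show ?thesis
  proof (rule that[OF lin img zero])
    show "p + \<phi> p \<in> U2" if "p \<in> U0" for p using \<phi>[OF that] by (simp add: rel_def)
    show "p = 0" if p: "p \<in> U0" "p + \<phi> p = 0" for p
    proof -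
      have neg: "\<phi> p = (- 1) *s p" using p(2) by (simp add: add_eq_0_iff)
      have "(1 - \<mu>) *s p = p + \<mu> *s \<phi> p" by (simp add: neg vec_eq_iff algebra_simps)
      then have "(1 - \<mu>) *s p \<in> U3" using \<phi>[OF p(1)] by (simp add: rel_def)
      then have "inverse (1 - \<mu>) *s ((1 - \<mu>) *s p) \<in> U3" by (rule vec.subspace_scale[OF sF(4)])
      then have "p \<in> U3" using \<mu>1 by simp
      moreover have "(- 1) *s \<phi> p \<in> U1"
        using \<phi>[OF p(1)] sF(2) by (intro vec.subspace_scale) (simp_all add: rel_def)
      then have "p \<in> U1" by (simp add: neg)
      ultimately show ?thesis using skewD[OF F(1,2,4) ne(1,3,5)] p(1) by blast
    qed
    show "p \<in> m0" if "p \<in> U0" "\<phi> p \<in> U0" for p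
    proof -
      have "\<phi> p \<in> m1" using \<phi>[OF that(1)] that(2) e2(1) by (auto simp: rel_def)
      then show ?thesis using in_m0[OF that(1)] \<phi>[OF that(1)] by (auto simp: rel_def)
    qed
    show "\<phi> p \<in> S" if "S \<in> F" "S \<noteq> U0" "p \<in> S" "p \<in> U0" "p \<notin> m0" for S p
      using r_good[OF that] \<phi>_eq by blast
  qed
qed

end

section \<open>Coordinates\<close>

lemma lin_on_sum:
  assumes "vec.subspace X" "lin_on X f" "finite B" "B \<subseteq> X"
  shows "f (\<Sum>b\<in>B. c b *s b) = (\<Sum>b\<in>B. c b *s f b)"
  using assms(3,4)
proof (induction B)
  case empty
  then show ?case using lin_on_scale[OF assms(2) vec.subspace_0[OF assms(1)], of 0] by simp
next
  case (insert b B)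
  have s: "(\<Sum>b\<in>B. c b *s b) \<in> X" using insert.prems assms(1)
    by (intro vec.subspace_sum vec.subspace_scale) auto
  show ?case using lin_onD[OF assms(2) _ s, of b "c b" 1] insert by simp
qed

lemma two_in_dim2:
  assumes "vec.subspace m" "vec.dim m = 2" "vec.subspace m'" "vec.dim m' = 2" "m \<noteq> m'"
    and "u \<in> m" "u \<in> m'" "v \<in> m" "v \<in> m'" "u \<noteq> 0"
  shows "v \<in> vec.span {u}"
proof (rule ccontr)
  assume "v \<notin> vec.span {u}"
  then have "m = vec.span {u, v}" "m' = vec.span {u, v}"
    using dim2_span assms by blast+
  then show False using assms(5) by simp
qed

locale base_element = partial_dual_arc F n d
  for F :: "('a::{field,finite} ^ 'v) set set" and n d +
  fixes U0 :: "('a ^ 'v) set"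
  assumes U0: "U0 \<in> F"
    and ex_full: "\<exists>U1\<in>F. U1 \<noteq> U0 \<and> card (line U0 U1) \<ge> CARD('a)"
begin

definition Long :: "('a ^ 'v) set set" where
  "Long = {S \<in> F - {U0}. card (line U0 S) \<ge> 4}"

text \<open>
  The projective line of \<open>U0\<close> on which the members of the line of \<open>U0\<close> and \<open>S\<close> cut \<open>U0\<close>.
  In the model it is \<open>u\<langle>u, s\<rangle>\<close>, which contains the contact point \<open>u\<^sup>2\<close>.
\<close>

definition axis :: "('a ^ 'v) set \<Rightarrow> ('a ^ 'v) set" where
  "axis S = (SOME m. vec.subspace m \<and> vec.dim m = 2 \<and> m \<subseteq> U0 \<and> (\<forall>R\<in>line U0 S - {U0}. R \<inter> U0 \<subseteq> m))"

lemma sU0: "vec.subspace U0" by (rule subF[OF U0])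

lemma LongD: "S \<in> Long \<Longrightarrow> S \<in> F" "S \<in> Long \<Longrightarrow> S \<noteq> U0" "S \<in> Long \<Longrightarrow> card (line U0 S) \<ge> 4"
  by (auto simp: Long_def)

lemma few_not_Long: "card (F - {U0} - Long) \<le> 2"
proof -
  obtain U1 where U1: "U1 \<in> F" "U1 \<noteq> U0" "card (line U0 U1) \<ge> CARD('a)" using ex_full by blast
  have "F - {U0} - Long = {S \<in> F - {U0}. card (line U0 S) \<le> 3}" by (auto simp: Long_def)
  then show ?thesis using few_short_lines[OF U0 U1(1) U1(2)[symmetric] U1(3)] by simp
qed

lemma axis:
  assumes "S \<in> Long"
  shows "vec.subspace (axis S)" "vec.dim (axis S) = 2" "axis S \<subseteq> U0"
    "\<And>R. R \<in> line U0 S - {U0} \<Longrightarrow> R \<inter> U0 \<subseteq> axis S"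
proof -
  have "\<exists>m. vec.subspace m \<and> vec.dim m = 2 \<and> m \<subseteq> U0 \<and> (\<forall>R\<in>line U0 S - {U0}. R \<inter> U0 \<subseteq> m)"
    using collinear_meets[OF U0 LongD(1)[OF assms] LongD(2)[OF assms, symmetric] LongD(3)[OF assms]]
    by metis
  from someI_ex[OF this]
  show "vec.subspace (axis S)" "vec.dim (axis S) = 2" "axis S \<subseteq> U0"
    "\<And>R. R \<in> line U0 S - {U0} \<Longrightarrow> R \<inter> U0 \<subseteq> axis S"
    unfolding axis_def[symmetric] by blast+
qed

lemma own_axis: "S \<in> Long \<Longrightarrow> S \<inter> U0 \<subseteq> axis S"
  using axis(4)[of S S] ends_in_line[OF U0 LongD(1)[of S]] LongD(2)[of S] by blast

lemma Long_line:
  assumes "S \<in> Long" "R \<in> line U0 S - {U0}"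
  shows "R \<in> Long" "axis R = axis S"
proof -
  have "line U0 R = line U0 S"
    using line_eq[OF U0 LongD(1)[OF assms(1)] LongD(2)[OF assms(1), symmetric], of R] assms(2) by simp
  then show "R \<in> Long" "axis R = axis S"
    using assms LongD(3)[OF assms(1)] by (auto simp: Long_def axis_def line_mem)
qed

lemma not_in_axis:
  assumes "S \<in> F" "S \<noteq> U0" "vec.subspace m" "\<not> S \<inter> U0 \<subseteq> m" "x \<in> S" "x \<in> U0" "x \<noteq> 0"
  shows "x \<notin> m"
proof
  assume x: "x \<in> m"
  have "S \<inter> U0 \<subseteq> m"
  proof
    fix y assume "y \<in> S \<inter> U0"
    then obtain c where "y = c *s x"
      using meet_multiple[OF assms(1) U0 assms(2,5-7)] by blast
    then show "y \<in> m" using x assms(3) by (simp add: vec.subspace_scale)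
  qed
  then show False using assms(4) by simp
qed

lemma three_on_Long:
  assumes "S \<in> Long"
  shows "card (line U0 S - {U0}) \<ge> 3"
  using LongD(3)[OF assms] card_Suc_Diff1[of "line U0 S" U0] ends_in_line[OF U0 LongD(1)[OF assms]]
  by simp

lemma ex_other_on_Long:
  assumes "S \<in> Long"
  shows "\<exists>Q. Q \<in> line U0 S - {U0} \<and> Q \<noteq> S"
  by (rule three_distinct[OF three_on_Long[OF assms]]) metis

text \<open>
  The properties of the map \<open>uy \<mapsto> sy\<close> from \<open>U0\<close> to \<open>S\<close>, where \<open>S'\<close> is the member \<open>(u + s)V\<close>.
\<close>

definition line_iso :: "('a ^ 'v) set \<Rightarrow> ('a ^ 'v) set \<Rightarrow> ('a ^ 'v \<Rightarrow> 'a ^ 'v) \<Rightarrow> bool" where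
  "line_iso S S' f \<longleftrightarrow> S \<in> Long \<and> S' \<in> line U0 S - {U0} \<and> S' \<noteq> S \<and>
     lin_on U0 f \<and> f ` U0 = S \<and> (\<forall>p\<in>U0. f p = 0 \<longrightarrow> p = 0) \<and> (\<forall>p\<in>U0. p + f p \<in> S') \<and>
     (\<forall>p\<in>U0. p + f p = 0 \<longrightarrow> p = 0) \<and> (\<forall>p\<in>U0. f p \<in> U0 \<longrightarrow> p \<in> axis S) \<and>
     (\<forall>R p. R \<in> F \<longrightarrow> R \<noteq> U0 \<longrightarrow> p \<in> R \<longrightarrow> p \<in> U0 \<longrightarrow> p \<notin> axis S \<longrightarrow> f p \<in> R)"

lemma ex_line_iso:
  assumes S: "S \<in> Long" and S': "S' \<in> line U0 S - {U0}" "S' \<noteq> S"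
  shows "\<exists>f. line_iso S S' f"
proof -
  have "\<not> line U0 S \<subseteq> {U0, S, S'}"
  proof
    assume "line U0 S \<subseteq> {U0, S, S'}"
    then have "card (line U0 S) \<le> card {U0, S, S'}" by (intro card_mono) auto
    also have "\<dots> \<le> 3" by (simp add: card_insert_if)
    finally show False using LongD(3)[OF S] by simp
  qed
  then obtain R where R: "R \<in> line U0 S" "R \<noteq> U0" "R \<noteq> S" "R \<noteq> S'" by blast
  have F: "S' \<in> F" "R \<in> F" "S' \<subseteq> join U0 S" "R \<subseteq> join U0 S" "S' \<noteq> U0" using S' R by (auto simp: line_mem)
  show ?thesis
  proof (rule line_map[OF U0 LongD(1)[OF S] F(1,2) LongD(2)[OF S, symmetric] F(5)[symmetric]
          R(2)[symmetric] S'(2)[symmetric] R(3)[symmetric] R(4)[symmetric] F(3,4) axis[OF S]])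
    fix f assume f: "lin_on U0 f" "f ` U0 = S" "\<And>p. p \<in> U0 \<Longrightarrow> f p = 0 \<Longrightarrow> p = 0"
      "\<And>p. p \<in> U0 \<Longrightarrow> p + f p \<in> S'" "\<And>p. p \<in> U0 \<Longrightarrow> p + f p = 0 \<Longrightarrow> p = 0"
      "\<And>p. p \<in> U0 \<Longrightarrow> f p \<in> U0 \<Longrightarrow> p \<in> axis S"
      "\<And>R p. R \<in> F \<Longrightarrow> R \<noteq> U0 \<Longrightarrow> p \<in> R \<Longrightarrow> p \<in> U0 \<Longrightarrow> p \<notin> axis S \<Longrightarrow> f p \<in> R"
    have "line_iso S S' f"
      unfolding line_iso_def by (intro conjI ballI allI impI) (rule S S' f; assumption)+
    then show "\<exists>f. line_iso S S' f" by blast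
  qed
qed

lemma line_isoD:
  assumes "line_iso S S' f"
  shows "S \<in> Long" "S' \<in> line U0 S" "S' \<noteq> U0" "S' \<noteq> S" "S' \<in> F" "lin_on U0 f" "f ` U0 = S"
    "\<And>p. p \<in> U0 \<Longrightarrow> f p = 0 \<Longrightarrow> p = 0" "\<And>p. p \<in> U0 \<Longrightarrow> p + f p \<in> S'"
    "\<And>p. p \<in> U0 \<Longrightarrow> p + f p = 0 \<Longrightarrow> p = 0" "\<And>p. p \<in> U0 \<Longrightarrow> f p \<in> U0 \<Longrightarrow> p \<in> axis S"
    "\<And>R p. R \<in> F \<Longrightarrow> R \<noteq> U0 \<Longrightarrow> p \<in> R \<Longrightarrow> p \<in> U0 \<Longrightarrow> p \<notin> axis S \<Longrightarrow> f p \<in> R"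
    "\<And>p. p \<in> U0 \<Longrightarrow> f p \<in> S"
  using assms unfolding line_iso_def by (auto simp: line_mem)

lemma line_iso_inj: "line_iso S S' f \<Longrightarrow> inj_on f U0"
  by (rule lin_on_inj[OF sU0 line_isoD(6)]) (auto dest: line_isoD(8))

text \<open>The preimage of the point of \<open>S\<close> on \<open>U0\<close> is the contact point \<open>u\<^sup>2\<close> of \<open>U0 = uV\<close>.\<close>

lemma contact_props:
  assumes iso: "line_iso S S' f" and x: "f a \<in> U0" "a \<in> U0" "a \<noteq> 0"
  shows "a \<in> axis S" "a + f a \<in> S'" "a + f a \<in> U0" "a + f a \<noteq> 0" "f a \<notin> vec.span {a}" "f a \<noteq> 0"
    "a + f a \<in> axis S" "f a \<in> axis S"
proof -
  note I = line_isoD[OF iso]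
  show "a \<in> axis S" by (rule I(11)[OF x(2,1)])
  show 1: "a + f a \<in> S'" by (rule I(9)[OF x(2)])
  show 2: "a + f a \<in> U0" using x sU0 by (simp add: vec.subspace_add)
  show 3: "a + f a \<noteq> 0" using I(10)[OF x(2)] x(3) by blast
  show 4: "f a \<noteq> 0" using I(8)[OF x(2)] x(3) by blast
  show 5: "f a \<in> axis S" using own_axis[OF I(1)] I(13)[OF x(2)] x(1) by blast
  show "a + f a \<in> axis S"
    using 5 I(11)[OF x(2,1)] axis(1)[OF I(1)] by (simp add: vec.subspace_add)
  show "f a \<notin> vec.span {a}"
  proof
    assume "f a \<in> vec.span {a}"
    then obtain c where c: "f a = c *s a" by (auto simp: span_singleton_mem)
    then have "c \<noteq> 0" using 4 by auto
    then have "a = inverse c *s f a" using c by simp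
    then have "a \<in> S" using I(13)[OF x(2)] subF[OF LongD(1)[OF I(1)]] vec.subspace_scale by metis
    then have "a + f a \<in> S" using I(13)[OF x(2)] subF[OF LongD(1)[OF I(1)]] by (simp add: vec.subspace_add)
    then show False
      using skewD[OF U0 LongD(1)[OF I(1)] I(5) LongD(2)[OF I(1), symmetric] I(3)[symmetric] I(4)[symmetric]]
        1 2 3 by blast
  qed
qed

lemma line_iso_contact:
  assumes "line_iso S S' f"
  shows "\<exists>a. a \<in> U0 \<and> a \<noteq> 0 \<and> f a \<in> U0"
proof -
  note I = line_isoD[OF assms]
  obtain x where x: "x \<in> S" "x \<in> U0" "x \<noteq> 0" using ex_meet[OF LongD(1)[OF I(1)] U0] by blast
  then obtain a where a: "a \<in> U0" "x = f a" using I(7) by blast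
  moreover have "a \<noteq> 0"
  proof
    assume "a = 0"
    then have "f a = 0" using lin_on_scale[OF I(6) a(1), of 0] by simp
    then show False using x a by simp
  qed
  ultimately show ?thesis using x by blast
qed

lemma one_meet_on_other_axis:
  assumes "S \<in> Long" "R0 \<in> Long" "axis S \<noteq> axis R0"
    and "R \<in> line U0 R0 - {U0}" "R' \<in> line U0 R0 - {U0}" "R \<noteq> R'" "R \<inter> U0 \<subseteq> axis S"
  shows "\<not> R' \<inter> U0 \<subseteq> axis S"
proof
  assume R': "R' \<inter> U0 \<subseteq> axis S"
  have F: "R \<in> F" "R' \<in> F" "R \<noteq> U0" "R' \<noteq> U0" using assms(4,5) by (auto simp: line_mem)
  obtain r where r: "r \<in> R" "r \<in> U0" "r \<noteq> 0" using ex_meet[OF F(1) U0] by blast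
  obtain r' where r': "r' \<in> R'" "r' \<in> U0" "r' \<noteq> 0" using ex_meet[OF F(2) U0] by blast
  have "r \<in> axis S" "r' \<in> axis S" using assms(7) R' r r' by blast+
  moreover have "r \<in> axis R0" "r' \<in> axis R0"
    using axis(4)[OF assms(2,4)] axis(4)[OF assms(2,5)] r r' by blast+
  ultimately have "r' \<in> vec.span {r}"
    using two_in_dim2[OF axis(1,2)[OF assms(1)] axis(1,2)[OF assms(2)] assms(3)] r(3) by blast
  moreover have "r' \<notin> vec.span {r}"
    by (rule meet_indep[OF U0 F(1,2) F(3)[symmetric] F(4)[symmetric] assms(6) r(2,1,3) r'(2,1,3)])
  ultimately show False by simp
qed

text \<open>
  The points where a member \<open>S\<close> of one line meets two members \<open>R\<close> and \<open>R'\<close> of another can be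
  computed from the maps of either line.  The comparison expresses the contact point \<open>a\<close> by vectors
  of the other axis.
\<close>

lemma contact_on_other_axis:
  assumes iso: "line_iso S S' f" and a: "a \<in> U0" "a \<noteq> 0" "f a \<in> U0"
    and R0: "R0 \<in> Long" "axis S \<noteq> axis R0" and off: "\<not> S \<inter> U0 \<subseteq> axis R0"
  shows "a \<in> axis R0"
proof -
  note I = line_isoD[OF iso]
  have S: "S \<in> F" "S \<noteq> U0" using LongD[OF I(1)] by simp_all
  obtain Q1 Q2 Q3 where Q: "Q1 \<in> line U0 R0 - {U0}" "Q2 \<in> line U0 R0 - {U0}"
    "Q3 \<in> line U0 R0 - {U0}" "Q1 \<noteq> Q2" "Q1 \<noteq> Q3" "Q2 \<noteq> Q3"
    by (rule three_distinct[OF three_on_Long[OF R0(1)]])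
  note one = one_meet_on_other_axis[OF I(1) R0]
  have "\<exists>R R'. R \<in> line U0 R0 - {U0} \<and> R' \<in> line U0 R0 - {U0} \<and> R \<noteq> R' \<and>
      \<not> R \<inter> U0 \<subseteq> axis S \<and> \<not> R' \<inter> U0 \<subseteq> axis S"
    using one[OF Q(1,2,4)] one[OF Q(1,3,5)] one[OF Q(2,3,6)] Q by metis
  then obtain R R' where R: "R \<in> line U0 R0 - {U0}" "R' \<in> line U0 R0 - {U0}" "R' \<noteq> R"
    "\<not> R \<inter> U0 \<subseteq> axis S" "\<not> R' \<inter> U0 \<subseteq> axis S" by metis
  have RL: "R \<in> Long" "axis R = axis R0" using Long_line[OF R0(1) R(1)] by simp_all
  have "line U0 R = line U0 R0"
    using line_eq[OF U0 LongD(1)[OF R0(1)] LongD(2)[OF R0(1), symmetric]] R(1) by blast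
  then obtain g where g: "line_iso R R' g" using ex_line_iso[OF RL(1) _ R(3)] R(2) by auto
  note J = line_isoD[OF g]
  have RF: "R \<in> F" "R \<noteq> U0" "R' \<in> F" "R' \<noteq> U0" using J LongD[OF RL(1)] by simp_all
  obtain b where b: "b \<in> U0" "b \<noteq> 0" "g b \<in> U0" using line_iso_contact[OF g] by blast
  note cb = contact_props[OF g b(3,1,2)]
  define x r where "x = f a" and "r = g b"
  note ca = contact_props[OF iso a(3,1,2), folded x_def]
  have x: "x \<in> S" "x \<in> U0" "x \<noteq> 0" using I(13)[OF a(1)] a(3) ca(6) by (simp_all add: x_def)
  have r: "r \<in> R" "r \<in> U0" "r \<noteq> 0" using J(13)[OF b(1)] b(3) cb(6) by (simp_all add: r_def)
  have x_off: "x \<notin> axis R" using not_in_axis[OF S axis(1)[OF R0(1)] off x] RL(2) by simp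
  have r_off: "r \<notin> axis S" by (rule not_in_axis[OF RF(1,2) axis(1)[OF I(1)] R(4) r])
  have br_off: "b + r \<notin> axis S"
    using not_in_axis[OF RF(3,4) axis(1)[OF I(1)] R(5)] cb(2,3,4) by (simp add: r_def)
  have SR: "S \<noteq> R" "S \<noteq> R'"
    using x_off own_axis[OF RL(1)] axis(4)[OF R0(1) R(2)] x RL(2) by blast+
  have gx: "g x \<in> S" "g x \<in> R" "x + g x \<in> S" "x + g x \<in> R'"
    using J(12)[OF S x(1,2) x_off] J(13)[OF x(2)] J(9)[OF x(2)] x(1) subF[OF S(1)]
    by (simp_all add: vec.subspace_add)
  have fr: "f r \<in> R" "f r \<in> S" using I(12)[OF RF(1,2) r(1,2) r_off] I(13)[OF r(2)] by simp_all
  have fbr: "f (b + r) \<in> R'" "f (b + r) \<in> S"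
    using I(12)[OF RF(3,4) _ _ br_off] cb(2,3) I(13)[of "b + r"] by (simp_all add: r_def)
  have "f r \<noteq> 0" using I(8)[OF r(2)] r(3) by blast
  then obtain l where l: "g x = l *s f r"
    using meet_multiple[OF S(1) RF(1) SR(1) fr(2,1) _ gx(1,2)] by blast
  have "f (b + r) \<noteq> 0" using I(8)[OF cb(3)] cb(4) by (auto simp: r_def)
  then obtain k where k: "x + g x = k *s f (b + r)"
    using meet_multiple[OF S(1) RF(3) SR(2) fbr(2,1) _ gx(3,4)] by blast
  have "f (k *s b + (k - l) *s r) = k *s f b + (k - l) *s f r"
    by (rule lin_onD[OF I(6) b(1) r(2)])
  also have "\<dots> = k *s f (b + r) - l *s f r"
    using lin_on_add[OF I(6) b(1) r(2)] by (simp add: vec_eq_iff algebra_simps)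
  also have "\<dots> = f a" using k l by (simp add: x_def algebra_simps)
  finally have "f (k *s b + (k - l) *s r) = f a" .
  then have "k *s b + (k - l) *s r = a"
    using inj_onD[OF line_iso_inj[OF iso]] lin_comb_mem[OF sU0 b(1) r(2)] a(1) by blast
  moreover have "k *s b + (k - l) *s r \<in> axis R0"
    using cb(1,8) axis(1)[OF R0(1)] RL(2) by (simp add: lin_comb_mem r_def)
  ultimately show ?thesis by simp
qed

text \<open>
  If \<open>S\<close> cut \<open>U0\<close> in the common point of two axes, another member \<open>Q\<close> of its line, with \<open>S\<close> in the role
  of the third member, would have its contact point \<open>a\<close> and the point \<open>a + f a\<close> of \<open>S\<close> on both axes,
  but these are different points.
\<close>

lemma meet_off_other_axis:
  assumes S: "S \<in> Long" and R0: "R0 \<in> Long" "axis S \<noteq> axis R0"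
  shows "\<not> S \<inter> U0 \<subseteq> axis R0"
proof
  assume on: "S \<inter> U0 \<subseteq> axis R0"
  have SF: "S \<in> F" "S \<noteq> U0" using LongD[OF S] by simp_all
  have Sl: "S \<in> line U0 S - {U0}" using ends_in_line[OF U0 SF(1)] SF(2) by simp
  obtain Q where Q: "Q \<in> line U0 S - {U0}" "Q \<noteq> S" using ex_other_on_Long[OF S] by metis
  have QL: "Q \<in> Long" "axis Q = axis S" using Long_line[OF S Q(1)] by simp_all
  have "line U0 Q = line U0 S"
    using line_eq[OF U0 SF(1) SF(2)[symmetric]] Q(1) by blast
  then obtain f where f: "line_iso Q S f" using ex_line_iso[OF QL(1), of S] Sl Q(2) by auto
  obtain a where a: "a \<in> U0" "a \<noteq> 0" "f a \<in> U0" using line_iso_contact[OF f] by blast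
  note ca = contact_props[OF f a(3,1,2)]
  have "\<not> Q \<inter> U0 \<subseteq> axis R0"
    using one_meet_on_other_axis[OF R0(1) S R0(2)[symmetric] Sl Q(1) Q(2)[symmetric] on] .
  then have aR: "a \<in> axis R0" using contact_on_other_axis[OF f a R0(1)] R0(2) QL(2) by simp
  have "a + f a \<in> axis R0" using on ca(2,3) by blast
  then have "(a + f a) - a \<in> axis R0" using aR axis(1)[OF R0(1)] by (intro vec.subspace_diff)
  then have "f a \<in> axis R0" by simp
  then have "f a \<in> vec.span {a}"
    using two_in_dim2[OF axis(1,2)[OF QL(1)] axis(1,2)[OF R0(1)] _ ca(1) aR ca(8) _ a(2)] R0(2) QL(2)
    by simp
  then show False using ca(5) by simp
qed

lemma contact_in_axes:
  assumes "line_iso S S' f" "a \<in> U0" "a \<noteq> 0" "f a \<in> U0" "R0 \<in> Long" "axis S \<noteq> axis R0"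
  shows "a \<in> axis R0"
  using contact_on_other_axis[OF assms meet_off_other_axis[OF line_isoD(1)[OF assms(1)] assms(5,6)]] .

lemma ex_Long_off:
  assumes "vec.subspace m" "vec.dim m = 2"
  shows "\<exists>S\<in>Long. \<not> S \<inter> U0 \<subseteq> m"
proof -
  let ?G = "{S \<in> F - {U0} - (F - {U0} - Long). \<not> S \<inter> U0 \<subseteq> m}"
  have "card ?G > num_points CARD('a) n" by (rule card_meets_outside[OF U0 assms few_not_Long])
  then have "card ?G \<noteq> 0" by linarith
  then have "?G \<noteq> {}" by (metis card.empty)
  then show ?thesis by blast
qed

text \<open>
  A contact point lies on its own axis and on every different one, and different axes share at most
  one point.
\<close>

lemma common_contact:
  obtains P where "P \<in> U0" "P \<noteq> 0" "\<And>S. S \<in> Long \<Longrightarrow> P \<in> axis S"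
    "\<And>S S' f. line_iso S S' f \<Longrightarrow> f P \<in> U0"
proof -
  obtain U1 where "U1 \<in> F" "U1 \<noteq> U0" "card (line U0 U1) \<ge> CARD('a)" using ex_full by blast
  then have S1: "U1 \<in> Long" using q_bound by (simp add: Long_def)
  obtain S2 where S2: "S2 \<in> Long" "\<not> S2 \<inter> U0 \<subseteq> axis U1"
    using ex_Long_off[OF axis(1,2)[OF S1]] by blast
  have ax12: "axis U1 \<noteq> axis S2" using S2 own_axis[OF S2(1)] by auto
  have ex_iso: "\<exists>S' f. line_iso S S' f" if S: "S \<in> Long" for S
    using ex_other_on_Long[OF S] ex_line_iso[OF S] by metis
  obtain S1' f1 where f1: "line_iso U1 S1' f1" using ex_iso[OF S1] by blast
  obtain P where P: "P \<in> U0" "P \<noteq> 0" "f1 P \<in> U0" using line_iso_contact[OF f1] by blast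
  have P1: "P \<in> axis U1" by (rule contact_props(1)[OF f1 P(3,1,2)])
  have P_other: "P \<in> axis S" if "S \<in> Long" for S
    using contact_in_axes[OF f1 P that] P1 by (cases "axis U1 = axis S") auto
  have "f P \<in> U0" if f: "line_iso S S' f" for S S' f
  proof -
    note I = line_isoD[OF f]
    obtain a where a: "a \<in> U0" "a \<noteq> 0" "f a \<in> U0" using line_iso_contact[OF f] by blast
    have aS: "a \<in> axis S" by (rule contact_props(1)[OF f a(3,1,2)])
    obtain R where R: "R \<in> Long" "axis S \<noteq> axis R"
      using S1 S2(1) ax12 by (cases "axis S = axis U1") auto
    have "a \<in> axis R" by (rule contact_in_axes[OF f a R])
    then have "P \<in> vec.span {a}"
      using two_in_dim2[OF axis(1,2)[OF I(1)] axis(1,2)[OF R(1)] R(2) aS] P_other[OF I(1)]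
        P_other[OF R(1)] a(2) by blast
    then obtain c where "P = c *s a" by (auto simp: span_singleton_mem)
    then show ?thesis using lin_on_scale[OF I(6) a(1)] a(3) sU0 by (simp add: vec.subspace_scale)
  qed
  then show ?thesis using that[OF P(1,2) P_other] by blast
qed

text \<open>
  The label \<open>f\<^sub>S(P)\<close> of a member \<open>S\<close> spans \<open>S \<inter> U0\<close>; in the model it is \<open>us\<close>.  The symmetry
  \<open>f\<^sub>S(r) = f\<^sub>R(s)\<close> for the labels \<open>r\<close> and \<open>s\<close> of \<open>R\<close> and \<open>S\<close> holds up to a factor because both sides
  span \<open>S \<inter> R\<close>, and the third member \<open>S'\<close> of the line of \<open>S\<close> fixes the factor.
\<close>

lemma coordinates:
  obtains \<beta> where "\<And>x. lin_on U0 (\<beta> x)" "\<And>y. y \<in> U0 \<Longrightarrow> lin_on U0 (\<lambda>x. \<beta> x y)"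
    "\<And>x y. x \<in> U0 \<Longrightarrow> y \<in> U0 \<Longrightarrow> \<beta> x y = \<beta> y x"
    "\<And>S. S \<in> insert U0 Long \<Longrightarrow> \<exists>x\<in>U0 - {0}. S = \<beta> x ` U0"
proof -
  obtain P where P: "P \<in> U0" "P \<noteq> 0" "\<And>S. S \<in> Long \<Longrightarrow> P \<in> axis S"
    "\<And>S S' f. line_iso S S' f \<Longrightarrow> f P \<in> U0"
    using common_contact by blast
  have ex_iso: "\<exists>f S'. line_iso S S' f" if S: "S \<in> Long" for S
    using ex_other_on_Long[OF S] ex_line_iso[OF S] by metis
  then obtain f S' where iso: "\<And>S. S \<in> Long \<Longrightarrow> line_iso S (S' S) (f S)" by metis
  define lab where "lab S = f S P" for S
  have I: "lin_on U0 (f S)" "f S ` U0 = S" "S' S \<in> F" "S' S \<in> line U0 S - {U0}" "S' S \<noteq> S"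
    "inj_on (f S) U0" "S \<in> F" "S \<noteq> U0" "S' S \<noteq> U0" if "S \<in> Long" for S
    using line_isoD[OF iso[OF that]] line_iso_inj[OF iso[OF that]] LongD[OF that] by auto
  have f_in: "f S p \<in> S" if "S \<in> Long" "p \<in> U0" for S p using line_isoD(13)[OF iso[OF that(1)] that(2)] .
  have f_nz: "f S p \<noteq> 0" if "S \<in> Long" "p \<in> U0" "p \<noteq> 0" for S p
    using line_isoD(8)[OF iso[OF that(1)] that(2)] that(3) by blast
  have f_add: "p + f S p \<in> S' S" if "S \<in> Long" "p \<in> U0" for S p
    using line_isoD(9)[OF iso[OF that(1)] that(2)] .
  have f_meet: "f S p \<in> R" if "S \<in> Long" "R \<in> F" "R \<noteq> U0" "p \<in> R" "p \<in> U0" "p \<notin> axis S" for S R p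
    using line_isoD(12)[OF iso[OF that(1)] that(2-6)] .
  have lab: "lab S \<in> U0" "lab S \<in> S" "lab S \<noteq> 0" "lab S \<notin> vec.span {P}" "lab S \<in> axis S"
    "P + lab S \<in> S' S" "P + lab S \<in> U0" "P + lab S \<noteq> 0" if "S \<in> Long" for S
    using contact_props[OF iso[OF that] P(4)[OF iso[OF that]] P(1,2)] P(4)[OF iso[OF that]]
      f_in[OF that P(1)] by (simp_all add: lab_def)
  have axis_off: "x \<notin> axis R"
    if "S \<in> Long" "R \<in> Long" "axis S \<noteq> axis R" "x \<in> S" "x \<in> U0" "x \<noteq> 0" for S R x
    using not_in_axis[OF I(7,8)[OF that(1)] axis(1)[OF that(2)] meet_off_other_axis[OF that(1-3)] that(4-6)] .
  have sym_off: "f S (lab R) = f R (lab S)"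
    if S: "S \<in> Long" and R: "R \<in> Long" and ne: "axis S \<noteq> axis R" for S R
  proof -
    have S': "S' S \<in> Long" "axis (S' S) = axis S" using Long_line[OF S I(4)[OF S]] by simp_all
    have offR: "lab R \<notin> axis S" by (rule axis_off[OF R S ne[symmetric] lab(2,1,3)[OF R]])
    have offS: "lab S \<notin> axis R" by (rule axis_off[OF S R ne lab(2,1,3)[OF S]])
    have offS': "P + lab S \<notin> axis R"
      by (rule axis_off[OF S'(1) R _ lab(6,7,8)[OF S]]) (use ne S'(2) in simp)
    have SR: "S \<noteq> R" "S' S \<noteq> R" using ne S'(2) by auto
    have 1: "f S (lab R) \<in> S" "f S (lab R) \<in> R"
      using f_in[OF S lab(1)[OF R]] f_meet[OF S I(7,8)[OF R] lab(2,1)[OF R] offR] by simp_all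
    have 2: "f R (lab S) \<in> S" "f R (lab S) \<in> R" "f R (lab S) \<noteq> 0"
      using f_in[OF R lab(1)[OF S]] f_meet[OF R I(7,8)[OF S] lab(2,1)[OF S] offS]
        f_nz[OF R lab(1)[OF S] lab(3)[OF S]] by simp_all
    obtain l where l: "f S (lab R) = l *s f R (lab S)"
      using meet_multiple[OF I(7)[OF S] I(7)[OF R] SR(1) 2 1] by blast
    have 3: "f R (P + lab S) \<in> S' S" "f R (P + lab S) \<in> R" "f R (P + lab S) \<noteq> 0"
      using f_in[OF R lab(7)[OF S]] f_meet[OF R I(3,9)[OF S] lab(6,7)[OF S] offS']
        f_nz[OF R lab(7)[OF S] lab(8)[OF S]] by simp_all
    have 4: "lab R + f S (lab R) \<in> S' S" "lab R + f S (lab R) \<in> R"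
      using f_add[OF S lab(1)[OF R]] 1(2) lab(2)[OF R] subF[OF I(7)[OF R]]
      by (simp_all add: vec.subspace_add)
    obtain k where k: "lab R + f S (lab R) = k *s f R (P + lab S)"
      using meet_multiple[OF I(3)[OF S] I(7)[OF R] SR(2) 3 4] by blast
    have "f R (1 *s P + l *s lab S) = lab R + f S (lab R)"
      using lin_onD[OF I(1)[OF R] P(1) lab(1)[OF S], of 1 l] l by (simp add: lab_def)
    also have "\<dots> = f R (k *s P + k *s lab S)"
      using k lin_on_scale[OF I(1)[OF R] lab(7)[OF S], of k] by (simp add: vec.scale_right_distrib)
    finally have "1 *s P + l *s lab S = k *s P + k *s lab S"
      using inj_onD[OF I(6)[OF R]] lin_comb_mem[OF sU0 P(1) lab(1)[OF S]] by blast
    then have "1 = k \<and> l = k" by (rule indep_comb_eq[OF P(2) lab(4)[OF S]])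
    then show ?thesis using l by simp
  qed
  have span_off: "U0 \<subseteq> vec.span {lab D |D. D \<in> Long \<and> axis D \<noteq> m}"
    if m: "vec.subspace m" "vec.dim m = 2" for m
  proof -
    let ?G = "{S \<in> F - {U0} - (F - {U0} - Long). \<not> S \<inter> U0 \<subseteq> m}"
    show ?thesis
    proof (rule many_points_span[OF sU0 vec.subspace_span, of n "\<lambda>S. S \<inter> U0" ?G])
      show "vec.dim U0 = Suc n" using dimF[OF U0] by simp
      show "inj_on (\<lambda>S. S \<inter> U0) ?G" by (rule inj_on_subset[OF inj_meet[OF U0]]) auto
      show "(\<lambda>S. S \<inter> U0) ` ?G \<subseteq> points U0" using meet_points[OF _ U0] by auto
      show "num_points CARD('a) n < card ?G" by (rule card_meets_outside[OF U0 m few_not_Long])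
      show "S \<inter> U0 \<subseteq> vec.span {lab D |D. D \<in> Long \<and> axis D \<noteq> m}" if S: "S \<in> ?G" for S
      proof
        fix y assume y: "y \<in> S \<inter> U0"
        have SL: "S \<in> Long" "axis S \<noteq> m" using S own_axis[of S] by blast+
        then obtain c where "y = c *s lab S"
          using meet_multiple[OF I(7)[OF SL(1)] U0 I(8)[OF SL(1)] lab(2,1,3)[OF SL(1)]] y by blast
        moreover have "lab S \<in> vec.span {lab D |D. D \<in> Long \<and> axis D \<noteq> m}"
          using SL by (intro vec.span_base) blast
        ultimately show "y \<in> vec.span {lab D |D. D \<in> Long \<and> axis D \<noteq> m}"
          by (simp add: vec.span_scale)
      qed
    qed
  qed
  \<comment> \<open>On a common axis, \<open>lab R\<close> is \<open>s P + t lab S\<close>; the case already done shows that \<open>f R\<close> is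
      \<open>s id + t f S\<close>.\<close>
  have sym_on: "f S (lab R) = f R (lab S)"
    if S: "S \<in> Long" and R: "R \<in> Long" and eq: "axis S = axis R" for S R
  proof -
    obtain s t where st: "lab R = s *s P + t *s lab S"
      using dim2_comb[OF axis(1,2)[OF S] P(3)[OF S] lab(5)[OF S] P(2) lab(4)[OF S]] lab(5)[OF R] eq by metis
    let ?g = "\<lambda>p. s *s p + t *s f S p"
    have lin: "lin_on U0 ?g"
      using I(1)[OF S] unfolding lin_on_def by (simp add: vec_eq_iff algebra_simps)
    have "f R (lab S) = ?g (lab S)"
    proof (rule lin_on_agree[OF sU0 I(1)[OF R] lin _ span_off[OF axis(1,2)[OF S]] _ lab(1)[OF S]])
      show "{lab D |D. D \<in> Long \<and> axis D \<noteq> axis S} \<subseteq> U0" using lab(1) by blast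
      fix b assume "b \<in> {lab D |D. D \<in> Long \<and> axis D \<noteq> axis S}"
      then obtain D where D: "b = lab D" "D \<in> Long" "axis D \<noteq> axis S" by blast
      have "f R (lab D) = f D (lab R)" using sym_off[OF R D(2)] D(3) eq by simp
      also have "\<dots> = s *s lab D + t *s f D (lab S)"
        using lin_onD[OF I(1)[OF D(2)] P(1) lab(1)[OF S], of s t] st by (simp add: lab_def)
      also have "f D (lab S) = f S (lab D)" by (rule sym_off[OF D(2) S D(3)])
      finally show "f R b = ?g b" using D(1) by simp
    qed
    also have "\<dots> = f S (lab R)"
      using lin_onD[OF I(1)[OF S] P(1) lab(1)[OF S], of s t] st by (simp add: lab_def)
    finally show ?thesis by simp
  qed
  have sym: "f S (lab R) = f R (lab S)" if "S \<in> Long" "R \<in> Long" for S R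
    using sym_on[OF that] sym_off[OF that] by blast
  obtain U1 where "U1 \<in> F" "U1 \<noteq> U0" "card (line U0 U1) \<ge> CARD('a)" using ex_full by blast
  then have U1: "U1 \<in> Long" using q_bound by (simp add: Long_def)
  let ?L = "lab ` Long"
  have L: "U0 \<subseteq> vec.span ?L" "?L \<subseteq> U0"
  proof -
    have "vec.span {lab D |D. D \<in> Long \<and> axis D \<noteq> axis U1} \<subseteq> vec.span ?L"
      by (rule vec.span_mono) blast
    then show "U0 \<subseteq> vec.span ?L" using span_off[OF axis(1,2)[OF U1]] by simp
    show "?L \<subseteq> U0" using lab(1) by blast
  qed
  obtain B where B: "B \<subseteq> ?L" "vec.independent B" "?L \<subseteq> vec.span B"
    by (rule vec.basis_exists[of ?L])
  have spanB: "vec.span B = U0"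
  proof
    show "vec.span B \<subseteq> U0" using B(1) L(2) sU0 by (intro vec.span_minimal) auto
    have "vec.span ?L \<subseteq> vec.span B" using B(3) by (intro vec.span_minimal) auto
    then show "U0 \<subseteq> vec.span B" using L(1) by blast
  qed
  define D where "D b = (SOME S. S \<in> Long \<and> lab S = b)" for b
  have D: "D b \<in> Long" "lab (D b) = b" if "b \<in> B" for b
  proof -
    have "\<exists>S. S \<in> Long \<and> lab S = b" using that B(1) by blast
    from someI_ex[OF this] show "D b \<in> Long" "lab (D b) = b" by (simp_all add: D_def)
  qed
  define \<beta> where "\<beta> v w = (\<Sum>b\<in>B. vec.representation B v b *s f (D b) w)" for v w
  have lin2: "lin_on U0 (\<beta> v)" for v
  proof -
    have "\<beta> v (c *s x + d' *s y) = c *s \<beta> v x + d' *s \<beta> v y" if xy: "x \<in> U0" "y \<in> U0" for c d' x y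
    proof -
      have "\<beta> v (c *s x + d' *s y) =
        (\<Sum>b\<in>B. vec.representation B v b *s (c *s f (D b) x + d' *s f (D b) y))"
        unfolding \<beta>_def by (rule sum.cong[OF refl]) (simp only: lin_onD[OF I(1)[OF D(1)] xy])
      also have "\<dots> = c *s \<beta> v x + d' *s \<beta> v y"
        unfolding \<beta>_def vec.scale_sum_right sum.distrib[symmetric]
        by (rule sum.cong[OF refl]) (simp add: vec_eq_iff algebra_simps)
      finally show ?thesis .
    qed
    then show ?thesis by (simp add: lin_on_def)
  qed
  have lin1: "lin_on U0 (\<lambda>v. \<beta> v w)" for w
  proof -
    have "\<beta> (c *s x + d' *s y) w = c *s \<beta> x w + d' *s \<beta> y w" if xy: "x \<in> U0" "y \<in> U0" for c d' x y
    proof -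
      have "vec.representation B (c *s x + d' *s y) b =
          c * vec.representation B x b + d' * vec.representation B y b" for b
      proof -
        have s: "x \<in> vec.span B" "y \<in> vec.span B" using xy spanB by simp_all
        show ?thesis
          using vec.representation_add[OF B(2) vec.span_scale[OF s(2)] vec.span_scale[OF s(1)], of c d']
            vec.representation_scale[OF B(2) s(1), of c] vec.representation_scale[OF B(2) s(2), of d']
          by simp
      qed
      then show ?thesis
        unfolding \<beta>_def vec.scale_sum_right sum.distrib[symmetric]
        by (intro sum.cong[OF refl]) (simp add: vec_eq_iff algebra_simps)
    qed
    then show ?thesis by (simp add: lin_on_def)
  qed
  have \<beta>_lab: "\<beta> v (lab R) = f R v" if v: "v \<in> U0" and R: "R \<in> Long" for v R
  proof -
    have "\<beta> v (lab R) = (\<Sum>b\<in>B. vec.representation B v b *s f R b)"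
      unfolding \<beta>_def by (rule sum.cong[OF refl]) (use sym[OF D(1) R] D(2) in simp)
    also have "\<dots> = f R (\<Sum>b\<in>B. vec.representation B v b *s b)"
      by (rule lin_on_sum[symmetric, OF sU0 I(1)[OF R]]) (use B(1) L(2) in auto)
    also have "(\<Sum>b\<in>B. vec.representation B v b *s b) = v"
      using vec.sum_representation_eq[OF B(2), of v B] v spanB by simp
    finally show ?thesis .
  qed
  have \<beta>_S: "\<beta> (lab S) w = f S w" if S: "S \<in> Long" and w: "w \<in> U0" for S w
    by (rule lin_on_agree[OF sU0 lin2 I(1)[OF S] L(2,1) _ w])
      (use \<beta>_lab[OF lab(1)[OF S]] sym[OF S] in auto)
  have \<beta>_P: "\<beta> P w = w" if w: "w \<in> U0" for w
  proof -
    have "lin_on U0 (\<lambda>w. w)" by (simp add: lin_on_def)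
    then show ?thesis
      by (rule lin_on_agree[OF sU0 lin2 _ L(2,1) _ w]) (use \<beta>_lab[OF P(1)] in \<open>auto simp: lab_def\<close>)
  qed
  have \<beta>_sym: "\<beta> v w = \<beta> w v" if v: "v \<in> U0" and w: "w \<in> U0" for v w
    by (rule lin_on_agree[OF sU0 lin2 lin1 L(2,1) _ w]) (use \<beta>_lab[OF v] \<beta>_S[OF _ v] in auto)
  show ?thesis
  proof (rule that[OF lin2 lin1 \<beta>_sym])
    fix S assume "S \<in> insert U0 Long"
    then show "\<exists>x\<in>U0 - {0}. S = \<beta> x ` U0"
    proof
      assume "S = U0"
      then show ?thesis using \<beta>_P P(1,2) by (intro bexI[of _ P]) auto
    next
      assume S: "S \<in> Long"
      have "\<beta> (lab S) ` U0 = f S ` U0" using \<beta>_S[OF S] by (intro image_cong) auto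
      then show ?thesis using I(2)[OF S] lab(1,3)[OF S] by (intro bexI[of _ "lab S"]) auto
    qed
  qed
qed

end

section \<open>The symmetric square\<close>

lemma lin_on_span_mem:
  assumes "vec.subspace X" "lin_on X f" "B \<subseteq> X" "vec.subspace S" "\<And>b. b \<in> B \<Longrightarrow> f b \<in> S"
    and "z \<in> vec.span B"
  shows "f z \<in> S"
proof -
  let ?E = "{x \<in> X. f x \<in> S}"
  have "f 0 = 0" using lin_on_scale[OF assms(2) vec.subspace_0[OF assms(1)], of 0] by simp
  then have "vec.subspace ?E"
    unfolding vec.subspace_def using assms(1,4) lin_on_add[OF assms(2)] lin_on_scale[OF assms(2)]
    by (auto simp: vec.subspace_add vec.subspace_scale vec.subspace_0)
  moreover have "B \<subseteq> ?E" using assms(3,5) by blast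
  ultimately have "vec.span B \<subseteq> ?E" by (intro vec.span_minimal)
  then show ?thesis using assms(6) by blast
qed

lemma triangle_card: "2 * card {(i, j). i \<le> j \<and> j < (n::nat)} = n * (n + 1)"
proof -
  have "{(i, j). i \<le> j \<and> j < n} = prod.swap ` (SIGMA j:{..<n}. {..j})" by force
  moreover have "inj_on prod.swap (SIGMA j:{..<n}. {..j})" by simp
  ultimately have "card {(i, j). i \<le> j \<and> j < n} = (\<Sum>j<n. j + 1)"
    by (simp add: card_image card_SigmaI)
  moreover have "2 * (\<Sum>j<n. j + 1) = n * (n + 1)" by (induction n) auto
  ultimately show ?thesis by simp
qed

text \<open>
  Enlarge \<open>Y\<close> by one dimension at a time.  A bad choice lies in the span of \<open>Y\<close> and \<open>x\<close> or of \<open>Y\<close> and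
  \<open>y\<close>, and two such subspaces do not cover \<open>X\<close>.
\<close>

lemma ex_avoiding_hyperplane:
  fixes X :: "('a::{field,finite} ^ 'v) set"
  assumes X: "vec.subspace X" "vec.dim X = n + 1"
    and Y: "vec.subspace Y" "Y \<subseteq> X" "vec.dim Y \<le> n" "x \<notin> Y" "y \<notin> Y" and xy: "x \<in> X" "y \<in> X"
    and q: "CARD('a) \<ge> 3"
  shows "\<exists>Z. vec.subspace Z \<and> Z \<subseteq> X \<and> vec.dim Z = n \<and> Y \<subseteq> Z \<and> x \<notin> Z \<and> y \<notin> Z"
  using Y
proof (induction "n - vec.dim Y" arbitrary: Y)
  case 0
  then show ?case by (intro exI[of _ Y]) auto
next
  case (Suc k)
  let ?x = "join Y (vec.span {x})" and ?y = "join Y (vec.span {y})"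
  have card_join: "card (join Y (vec.span {z})) \<le> CARD('a) ^ (vec.dim Y + 1)" for z
  proof -
    have "vec.dim (vec.span {z}) \<le> 1" by (cases "z = 0") simp_all
    then have "vec.dim (join Y (vec.span {z})) \<le> vec.dim Y + 1"
      using dim_join[OF Suc.prems(1) vec.subspace_span, of "{z}"] by linarith
    then show ?thesis using card_subspace[OF subspace_join, of Y "vec.span {z}"] q
      by (simp only:) (intro power_increasing, simp_all)
  qed
  have "card (?x \<union> ?y) \<le> 2 * CARD('a) ^ (vec.dim Y + 1)"
    using card_Un_le[of ?x ?y] card_join[of x] card_join[of y] by linarith
  also have "\<dots> < 3 * CARD('a) ^ (vec.dim Y + 1)" by simp
  also have "\<dots> \<le> CARD('a) * CARD('a) ^ (vec.dim Y + 1)" using q by (rule mult_le_mono1)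
  also have "\<dots> = CARD('a) ^ (vec.dim Y + 2)" by simp
  also have "\<dots> \<le> CARD('a) ^ (n + 1)" using Suc.hyps(2) q by (intro power_increasing) auto
  also have "\<dots> = card X" using card_subspace[OF X(1)] X(2) by simp
  finally have "\<not> X \<subseteq> ?x \<union> ?y" using card_mono[of "?x \<union> ?y" X] by auto
  then obtain t where t: "t \<in> X" "t \<notin> ?x" "t \<notin> ?y" by blast
  let ?Y = "join Y (vec.span {t})"
  have mem: "z \<in> join Y (vec.span {w}) \<longleftrightarrow> (\<exists>a\<in>Y. \<exists>c. z = a + c *s w)" for z w
    unfolding join_mem_iff[OF Suc.prems(1) vec.subspace_span] by (metis span_singleton_mem)
  have avoid: "z \<notin> ?Y" if "z \<notin> Y" "t \<notin> join Y (vec.span {z})" for z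
  proof
    assume "z \<in> ?Y"
    then obtain a c where ac: "a \<in> Y" "z = a + c *s t" by (auto simp: mem)
    have "c \<noteq> 0" using ac that(1) by auto
    have "t = inverse c *s (c *s t)" using \<open>c \<noteq> 0\<close> by simp
    also have "\<dots> = (- inverse c) *s a + inverse c *s z"
      by (simp add: ac(2) vec.scale_right_distrib)
    finally have "t \<in> join Y (vec.span {z})"
      using vec.subspace_scale[OF Suc.prems(1) ac(1)] unfolding mem by blast
    then show False using that(2) by simp
  qed
  have tY: "t \<notin> Y" using t(2) join_upper(1)[of Y "vec.span {x}"] by blast
  then have "t \<noteq> 0" using Suc.prems(1) vec.subspace_0 by blast
  have "Y \<inter> vec.span {t} = {0}"
  proof -
    have "z = 0" if z: "z \<in> Y" "z \<in> vec.span {t}" for z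
    proof (rule ccontr)
      assume "z \<noteq> 0"
      obtain c where c: "z = c *s t" using z(2) by (auto simp: span_singleton_mem)
      then have "inverse c *s z = t" using \<open>z \<noteq> 0\<close> by auto
      then show False using tY z(1) Suc.prems(1) by (metis vec.subspace_scale)
    qed
    then show ?thesis using Suc.prems(1) by (auto simp: vec.subspace_0)
  qed
  then have dimY: "vec.dim ?Y = vec.dim Y + 1"
    using dim_join[OF Suc.prems(1) vec.subspace_span, of "{t}"] \<open>t \<noteq> 0\<close> by simp
  have "?Y \<subseteq> X" using Suc.prems(2) t(1) X(1) by (intro join_least) (simp_all add: vec.span_minimal)
  moreover have "k = n - vec.dim ?Y" "vec.dim ?Y \<le> n" using dimY Suc.hyps(2) by linarith+
  ultimately obtain Z where "vec.subspace Z" "Z \<subseteq> X" "vec.dim Z = n" "?Y \<subseteq> Z" "x \<notin> Z" "y \<notin> Z"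
    using Suc.hyps(1)[of ?Y] avoid[OF Suc.prems(4) t(2)] avoid[OF Suc.prems(5) t(3)] by auto
  then show ?case using join_upper(1)[of Y "vec.span {t}"] by blast
qed

text \<open>
  The product maps \<open>S\<^sup>2X\<close> onto the ambient space, which has the same dimension, so this is an
  isomorphism.  The isomorphism is used in the form that products of two vectors off a hyperplane
  \<open>Z\<close> of \<open>X\<close> are not in \<open>Z \<cdot> X\<close>, which is \<open>multiples Z\<close> below.
\<close>

locale symmetric_square =
  fixes X :: "('a::{field,finite} ^ 'v) set" and n :: nat
    and \<beta> :: "'a ^ 'v \<Rightarrow> 'a ^ 'v \<Rightarrow> 'a ^ 'v"
  assumes X: "vec.subspace X" "vec.dim X = n + 1"
    and n: "n \<ge> 2" and q7: "CARD('a) \<ge> 7"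
    and ambient: "CARD('v) = n * (n + 3) div 2 + 1"
    and lin2: "\<And>x. lin_on X (\<beta> x)" and lin1: "\<And>y. y \<in> X \<Longrightarrow> lin_on X (\<lambda>x. \<beta> x y)"
    and sym: "\<And>x y. x \<in> X \<Longrightarrow> y \<in> X \<Longrightarrow> \<beta> x y = \<beta> y x"
    and span: "vec.span {\<beta> x y |x y. x \<in> X \<and> y \<in> X} = UNIV"
begin

lemma card_X: "card X = CARD('a) ^ (n + 1)"
  using card_subspace[OF X(1)] X(2) by simp

lemmas beta_add2 = lin_on_add[OF lin2] and beta_scale2 = lin_on_scale[OF lin2]
  and beta_add1 = lin_on_add[OF lin1] and beta_scale1 = lin_on_scale[OF lin1]

definition multiples :: "('a ^ 'v) set \<Rightarrow> ('a ^ 'v) set" where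
  "multiples Z = vec.span {\<beta> z x |z x. z \<in> Z \<and> x \<in> X}"

lemma decompose:
  assumes Z: "vec.subspace Z" "Z \<subseteq> X" "vec.dim Z = n" and v: "v \<in> X" "v \<notin> Z" and x: "x \<in> X"
  shows "\<exists>z\<in>Z. \<exists>c. x = z + c *s v"
proof -
  have "Z \<subset> join Z (vec.span {v})"
    using join_upper(1)[of Z "vec.span {v}"] join_upper(2)[of "vec.span {v}" Z] v(2)
      vec.span_base[of v "{v}"] by blast
  then have "vec.dim (join Z (vec.span {v})) > n"
    using vec.dim_psubset[of Z "join Z (vec.span {v})"] Z(1,3)
    by (simp add: vec.span_eq_iff[THEN iffD2])
  moreover have "join Z (vec.span {v}) \<subseteq> X"
    using Z(2) v(1) X(1) by (intro join_least) (simp_all add: vec.span_minimal)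
  ultimately have "join Z (vec.span {v}) = X" using X by (intro subspace_eqI) simp_all
  then have "\<exists>z\<in>Z. \<exists>y\<in>vec.span {v}. x = z + y"
    using x join_mem_iff[OF Z(1) vec.subspace_span, of x "{v}"] by simp
  then show ?thesis by (metis span_singleton_mem)
qed

text \<open>
  Products of basis vectors of \<open>X\<close>, with one from \<open>Z\<close>, number one less than the dimension of the ambient
  space.
\<close>

lemma multiples_proper:
  assumes Z: "vec.subspace Z" "Z \<subseteq> X" "vec.dim Z = n" and v: "v \<in> X" "v \<notin> Z"
  shows "multiples Z \<noteq> UNIV"
proof
  assume U: "multiples Z = UNIV"
  obtain B where B: "B \<subseteq> Z" "vec.independent B" "Z \<subseteq> vec.span B" "card B = vec.dim Z"
    by (rule vec.basis_exists)
  have B_X: "B \<subseteq> X" using B(1) Z(2) by blast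
  have "finite B" by simp
  then obtain f where f: "bij_betw f {..<n} B"
    using ex_bij_betw_nat_finite[of B] B(4) Z(3) by (auto simp: atLeast0LessThan)
  let ?T = "{(i, j). i \<le> j \<and> j < n}"
  let ?P = "(\<lambda>(i, j). \<beta> (f i) (f j)) ` ?T \<union> (\<lambda>b. \<beta> b v) ` B"
  have BB: "\<beta> b b' \<in> vec.span ?P" if bb: "b \<in> B" "b' \<in> B" for b b'
  proof -
    obtain i j where ij: "i < n" "j < n" "b = f i" "b' = f j"
      using bb f by (metis bij_betw_def imageE lessThan_iff)
    have bX: "b \<in> X" "b' \<in> X" using bb B_X by blast+
    have "\<beta> b b' \<in> (\<lambda>(i, j). \<beta> (f i) (f j)) ` ?T"
    proof (cases "i \<le> j")
      case True
      then show ?thesis using ij by (intro image_eqI[of _ _ "(i, j)"]) auto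
    next
      case False
      then show ?thesis using ij sym[OF bX] by (intro image_eqI[of _ _ "(j, i)"]) auto
    qed
    then show ?thesis by (intro vec.span_base) blast
  qed
  have Bv: "\<beta> b v \<in> vec.span ?P" if "b \<in> B" for b using that by (intro vec.span_base) blast
  have zv: "\<beta> z v \<in> vec.span ?P" if "z \<in> Z" for z
    using lin_on_span_mem[OF X(1) lin1[OF v(1)] B_X vec.subspace_span Bv] that B(3) by blast
  have zb: "\<beta> z b \<in> vec.span ?P" if "z \<in> Z" "b \<in> B" for z b
    using lin_on_span_mem[OF X(1) lin1[of b] B_X vec.subspace_span BB[OF _ that(2)], of z] that B(3) B_X
    by blast
  have zz: "\<beta> z z' \<in> vec.span ?P" if "z \<in> Z" "z' \<in> Z" for z z'
    using lin_on_span_mem[OF X(1) lin2 B_X vec.subspace_span zb[OF that(1)], of z'] that(2) B(3) by blast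
  have "multiples Z \<subseteq> vec.span ?P"
    unfolding multiples_def
  proof (rule vec.span_minimal[OF _ vec.subspace_span], rule subsetI)
    fix y assume "y \<in> {\<beta> z x |z x. z \<in> Z \<and> x \<in> X}"
    then obtain z x where zx: "y = \<beta> z x" "z \<in> Z" "x \<in> X" by blast
    obtain z' c where d: "z' \<in> Z" "x = 1 *s z' + c *s v" using decompose[OF Z v zx(3)] by auto
    have "\<beta> z x = 1 *s \<beta> z z' + c *s \<beta> z v"
      unfolding d(2) using lin_onD[OF lin2] d(1) Z(2) v(1) by blast
    then show "y \<in> vec.span ?P" using zz[OF zx(2) d(1)] zv[OF zx(2)] zx(1)
      by (simp only: lin_comb_mem vec.subspace_span)
  qed
  then have "vec.dim (UNIV :: ('a ^ 'v) set) \<le> card ?P"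
    using U by (intro vec.dim_le_card) auto
  also have "\<dots> \<le> card ?T + card B"
  proof -
    have "finite ?T" by (rule finite_subset[of _ "{..<n} \<times> {..<n}"]) auto
    then have "card ((\<lambda>(i, j). \<beta> (f i) (f j)) ` ?T) \<le> card ?T" by (rule card_image_le)
    moreover have "card ((\<lambda>b. \<beta> b v) ` B) \<le> card B" by (rule card_image_le) simp
    ultimately show ?thesis
      using card_Un_le[of "(\<lambda>(i, j). \<beta> (f i) (f j)) ` ?T" "(\<lambda>b. \<beta> b v) ` B"] by linarith
  qed
  finally have "CARD('v) \<le> card ?T + n" using B(4) Z(3) by (simp add: card_cart_basis)
  then have "2 * CARD('v) \<le> n * (n + 1) + 2 * n" using triangle_card[of n] by linarith
  moreover have "n * (n + 3) = n * (n + 1) + 2 * n" by (simp add: algebra_simps)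
  moreover have "even (n * (n + 3))" by simp
  then have "2 * (n * (n + 3) div 2) = n * (n + 3)" by (rule dvd_mult_div_cancel)
  ultimately show False using ambient by linarith
qed

text \<open>
  Modulo \<open>Z \<cdot> X\<close> all products are multiples of \<open>v\<^sup>2\<close>, and \<open>vw\<close> is a nonzero one.
\<close>

lemma product_not_multiple:
  assumes Z: "vec.subspace Z" "Z \<subseteq> X" "vec.dim Z = n"
    and v: "v \<in> X" "v \<notin> Z" and w: "w \<in> X" "w \<notin> Z"
  shows "\<beta> v w \<notin> multiples Z"
proof
  assume vw: "\<beta> v w \<in> multiples Z"
  have sub: "vec.subspace (multiples Z)" by (simp add: multiples_def)
  have zx: "\<beta> z x \<in> multiples Z" "\<beta> x z \<in> multiples Z" if "z \<in> Z" "x \<in> X" for z x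
  proof -
    show "\<beta> z x \<in> multiples Z" unfolding multiples_def using that by (intro vec.span_base) blast
    then show "\<beta> x z \<in> multiples Z" using sym[of x z] that Z(2) by auto
  qed
  obtain z c where zc: "z \<in> Z" "w = z + c *s v" using decompose[OF Z v w(1)] by blast
  have zX: "z \<in> X" using zc(1) Z(2) by blast
  have "c \<noteq> 0" using zc w(2) by auto
  have "\<beta> v w - \<beta> v z = c *s \<beta> v v"
    unfolding zc(2) using beta_add2[OF zX] beta_scale2[OF v(1)] v(1) X(1)
    by (simp add: vec.subspace_scale)
  moreover have "\<beta> v w - \<beta> v z \<in> multiples Z" using vw zx(2)[OF zc(1) v(1)] sub by (intro vec.subspace_diff)
  ultimately have "inverse c *s (c *s \<beta> v v) \<in> multiples Z" using sub by (simp only: vec.subspace_scale)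
  then have vv: "\<beta> v v \<in> multiples Z" using \<open>c \<noteq> 0\<close> by simp
  have "\<beta> x y \<in> multiples Z" if xy: "x \<in> X" "y \<in> X" for x y
  proof -
    obtain a s where a: "a \<in> Z" "x = a + s *s v" using decompose[OF Z v xy(1)] by blast
    obtain b t where b: "b \<in> Z" "y = b + t *s v" using decompose[OF Z v xy(2)] by blast
    have aX: "a \<in> X" "b \<in> X" using a(1) b(1) Z(2) by blast+
    have "\<beta> x y = \<beta> a y + s *s \<beta> v y"
      unfolding a(2) using beta_add1[OF xy(2) aX(1)] beta_scale1[OF xy(2) v(1)] v(1) X(1)
      by (simp add: vec.subspace_scale)
    moreover have "\<beta> v y = \<beta> v b + t *s \<beta> v v"
      unfolding b(2) using beta_add2[OF aX(2)] beta_scale2[OF v(1)] v(1) X(1)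
      by (simp add: vec.subspace_scale)
    ultimately show ?thesis
      using zx(1)[OF a(1) xy(2)] zx(2)[OF b(1) v(1)] vv sub
      by (simp only: vec.subspace_add vec.subspace_scale)
  qed
  then have "vec.span {\<beta> x y |x y. x \<in> X \<and> y \<in> X} \<subseteq> multiples Z"
    using sub by (intro vec.span_minimal) auto
  then have "multiples Z = UNIV" using span by auto
  then show False using multiples_proper[OF Z v] by simp
qed

text \<open>
  Unique factorisation: a hyperplane \<open>Z\<close> through \<open>z\<close> that contains neither \<open>x\<close> nor \<open>y\<close> separates the
  multiple \<open>zw\<close> from \<open>xy\<close>.
\<close>

lemma product_third_factor:
  assumes "x \<in> X" "y \<in> X" "z \<in> X" "w \<in> X" "x \<notin> vec.span {z}" "y \<notin> vec.span {z}"
  shows "\<beta> x y \<noteq> \<beta> z w"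
proof
  assume eq: "\<beta> x y = \<beta> z w"
  have "vec.dim (vec.span {z}) \<le> n" using n by (cases "z = 0") simp_all
  then obtain Z where Z: "vec.subspace Z" "Z \<subseteq> X" "vec.dim Z = n" "vec.span {z} \<subseteq> Z" "x \<notin> Z" "y \<notin> Z"
    using ex_avoiding_hyperplane[OF X vec.subspace_span, of "{z}" x y] assms q7 X(1)
    by (auto simp: vec.span_minimal)
  have "z \<in> Z" using Z(4) vec.span_base[of z "{z}"] by blast
  then have "\<beta> z w \<in> multiples Z" unfolding multiples_def using assms(4) by (intro vec.span_base) blast
  then show False using product_not_multiple[OF Z(1-3) assms(1) Z(5) assms(2) Z(6)] eq by simp
qed

lemma product_nonzero:
  assumes "x \<in> X" "y \<in> X" "x \<noteq> 0" "y \<noteq> 0"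
  shows "\<beta> x y \<noteq> 0"
proof -
  have "0 \<in> X" using X(1) by (rule vec.subspace_0)
  then have "\<beta> x y \<noteq> \<beta> 0 0"
    using assms by (intro product_third_factor) simp_all
  moreover have "\<beta> 0 (0 *s 0) = 0" using beta_scale2[OF \<open>0 \<in> X\<close>, of 0 0] by simp
  ultimately show ?thesis by simp
qed

definition el :: "'a ^ 'v \<Rightarrow> ('a ^ 'v) set" where
  "el x = \<beta> x ` X"

lemma el_mem: "v \<in> el x \<longleftrightarrow> (\<exists>y\<in>X. v = \<beta> x y)"
  by (auto simp: el_def)

lemma lin_image_subspace:
  assumes "lin_on X f"
  shows "vec.subspace (f ` X)"
  unfolding vec.subspace_def
proof (intro conjI ballI allI)
  have "f (0 *s 0) = 0" using lin_on_scale[OF assms vec.subspace_0[OF X(1)], of 0] by simp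
  then show "0 \<in> f ` X" using vec.subspace_0[OF X(1)] by (metis image_eqI vec.scale_zero_left)
next
  fix a b assume "a \<in> f ` X" "b \<in> f ` X"
  then obtain x y where "x \<in> X" "y \<in> X" "a = f x" "b = f y" by blast
  then show "a + b \<in> f ` X" using lin_on_add[OF assms, of x y] X(1)
    by (metis image_eqI vec.subspace_add)
next
  fix c a assume "a \<in> f ` X"
  then obtain x where "x \<in> X" "a = f x" by blast
  then show "c *s a \<in> f ` X" using lin_on_scale[OF assms, of x c] X(1)
    by (metis image_eqI vec.subspace_scale)
qed

lemma dim_from_card:
  fixes U :: "('a ^ 'v) set"
  assumes "vec.subspace U" "card U = CARD('a) ^ k"
  shows "vec.dim U = k"
proof -
  have "CARD('a) ^ vec.dim U = CARD('a) ^ k" using card_subspace[OF assms(1)] assms(2) by simp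
  then show ?thesis using q7 power_inject_exp[of "CARD('a)" "vec.dim U" k] by simp
qed

lemma subspace_el: "vec.subspace (el x)"
  unfolding el_def by (rule lin_image_subspace[OF lin2])

lemma dim_el:
  assumes "x \<in> X" "x \<noteq> 0"
  shows "vec.dim (el x) = n + 1"
proof (rule dim_from_card[OF subspace_el])
  have "inj_on (\<beta> x) X" by (rule lin_on_inj[OF X(1) lin2]) (use product_nonzero assms in blast)
  then show "card (el x) = CARD('a) ^ (n + 1)" using card_X by (simp add: el_def card_image)
qed

lemma el_meet:
  assumes "x \<in> X" "y \<in> X" "x \<noteq> 0" "y \<notin> vec.span {x}"
  shows "el x \<inter> el y = vec.span {\<beta> x y}"
proof (intro equalityI subsetI)
  fix v assume "v \<in> el x \<inter> el y"
  then obtain a b where ab: "a \<in> X" "b \<in> X" "v = \<beta> x a" "v = \<beta> y b" by (auto simp: el_mem)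
  have y0: "y \<noteq> 0" by (rule not_span_nonzero[OF assms(4)])
  have "x \<notin> vec.span {y}" by (rule not_span_sym[OF assms(4,3)])
  then have "a \<in> vec.span {y}"
    using product_third_factor[OF assms(1) ab(1) assms(2) ab(2)] ab by metis
  then obtain c where "a = c *s y" by (auto simp: span_singleton_mem)
  then show "v \<in> vec.span {\<beta> x y}" using ab(3) beta_scale2[OF assms(2)] by (auto simp: span_singleton_mem)
next
  fix v assume "v \<in> vec.span {\<beta> x y}"
  then obtain c where "v = c *s \<beta> x y" by (auto simp: span_singleton_mem)
  moreover have "\<beta> x y \<in> el x" "\<beta> x y \<in> el y"
    using assms(1,2) sym[OF assms(1,2)] unfolding el_mem by blast+
  ultimately show "v \<in> el x \<inter> el y" using subspace_el by (auto intro: vec.subspace_scale)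
qed

lemma el_skew:
  assumes "x \<in> X" "y \<in> X" "z \<in> X" "x \<noteq> 0" "y \<noteq> 0"
    and "y \<notin> vec.span {x}" "z \<notin> vec.span {x}" "z \<notin> vec.span {y}"
  shows "el x \<inter> el y \<inter> el z = {0}"
proof -
  have "v = 0" if v: "v \<in> el x \<inter> el y" "v \<in> el z" for v
  proof (rule ccontr)
    assume "v \<noteq> 0"
    obtain c where c: "v = c *s \<beta> x y" using v(1) el_meet[OF assms(1,2,4,6)] by (auto simp: span_singleton_mem)
    then have "\<beta> x y = inverse c *s v" using \<open>v \<noteq> 0\<close> by auto
    then have "\<beta> x y \<in> el z" using v(2) subspace_el by (simp add: vec.subspace_scale)
    then obtain w where "w \<in> X" "\<beta> x y = \<beta> z w" by (auto simp: el_mem)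
    then show False
      using product_third_factor[OF assms(1-3)] not_span_sym[OF assms(7,4)] not_span_sym[OF assms(8,5)] by blast
  qed
  then show ?thesis using subspace_el by (auto simp: vec.subspace_0)
qed

lemma el_scale:
  assumes "x \<in> X" "c \<noteq> 0"
  shows "el (c *s x) = el x"
proof -
  have "\<beta> (c *s x) y = \<beta> x (c *s y)" if "y \<in> X" for y
    using beta_scale1[OF that assms(1)] beta_scale2[OF that] by simp
  then have "el (c *s x) \<subseteq> el x" using X(1) unfolding el_mem subset_iff by (metis vec.subspace_scale)
  moreover have "\<beta> x y = \<beta> (c *s x) (inverse c *s y)" if "y \<in> X" for y
    using beta_scale1[OF _ assms(1), of "inverse c *s y" c] beta_scale2[OF that, of x "inverse c"] that assms X(1)
    by (simp add: vec.subspace_scale)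
  then have "el x \<subseteq> el (c *s x)" using X(1) unfolding el_mem subset_iff by (metis vec.subspace_scale)
  ultimately show ?thesis by blast
qed

lemma el_eq_iff:
  assumes "x \<in> X" "y \<in> X" "x \<noteq> 0" "y \<noteq> 0"
  shows "el x = el y \<longleftrightarrow> y \<in> vec.span {x}"
proof
  assume eq: "el x = el y"
  show "y \<in> vec.span {x}"
  proof (rule ccontr)
    assume "y \<notin> vec.span {x}"
    then have "el x = vec.span {\<beta> x y}" using el_meet[OF assms(1-3)] eq by simp
    then have "vec.dim (el x) \<le> 1" by (simp split: if_splits)
    then show False using dim_el[OF assms(1,3)] n by simp
  qed
next
  assume "y \<in> vec.span {x}"
  then obtain c where "y = c *s x" by (auto simp: span_singleton_mem)
  then show "el x = el y" using el_scale[OF assms(1), of c] assms(4) by auto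
qed

lemma card_el_image:
  assumes "K \<subseteq> X - {0}" "\<And>x c. x \<in> K \<Longrightarrow> c \<noteq> 0 \<Longrightarrow> c *s x \<in> K"
  shows "card K = (CARD('a) - 1) * card (el ` K)"
proof -
  have "card K = (\<Sum>x\<in>K. 1)" by simp
  also have "\<dots> = (\<Sum>U\<in>el ` K. \<Sum>x\<in>{x \<in> K. el x = U}. 1)" by (rule sum.image_gen) simp
  also have "\<dots> = (\<Sum>U\<in>el ` K. CARD('a) - 1)"
  proof (rule sum.cong[OF refl])
    fix U assume "U \<in> el ` K"
    then obtain x where x: "x \<in> K" "U = el x" by blast
    then have xX: "x \<in> X" "x \<noteq> 0" using assms(1) by auto
    have "{y \<in> K. el y = U} = vec.span {x} - {0}"
    proof (intro equalityI subsetI)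
      fix y assume y: "y \<in> {y \<in> K. el y = U}"
      then have "y \<in> X" "y \<noteq> 0" using assms(1) by auto
      then show "y \<in> vec.span {x} - {0}" using el_eq_iff[OF xX(1) _ xX(2)] y x(2) by auto
    next
      fix y assume y: "y \<in> vec.span {x} - {0}"
      then obtain c where c: "y = c *s x" by (auto simp: span_singleton_mem)
      then have "c \<noteq> 0" using y by auto
      then show "y \<in> {y \<in> K. el y = U}" using assms(2)[OF x(1)] el_scale[OF xX(1)] c x(2) by auto
    qed
    then show "(\<Sum>x\<in>{x \<in> K. el x = U}. 1) = CARD('a) - 1"
      using card_subspace[of "vec.span {x}"] xX(2) by (simp add: card_Diff_singleton vec.span_zero)
  qed
  finally show ?thesis by (simp add: mult.commute)
qed

lemma card_model: "card (el ` (X - {0})) = num_points CARD('a) (n + 1)"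
proof -
  have "card (X - {0}) = (CARD('a) - 1) * card (el ` (X - {0}))"
    by (rule card_el_image) (use X(1) in \<open>auto simp: vec.subspace_scale\<close>)
  moreover have "card (X - {0}) + 1 = CARD('a) ^ (n + 1)"
    using card_X vec.subspace_0[OF X(1)] card_Suc_Diff1[of X 0] by simp
  moreover have "(CARD('a) - 1) * num_points CARD('a) (n + 1) + 1 = CARD('a) ^ (n + 1)"
    using q7 by (intro num_points_mult) simp
  ultimately have "(CARD('a) - 1) * card (el ` (X - {0})) = (CARD('a) - 1) * num_points CARD('a) (n + 1)"
    by linarith
  then show ?thesis using q7 by simp
qed

definition squares :: "('a ^ 'v) set" where
  "squares = (\<lambda>x. \<beta> x x) ` X"

lemma square_comb:
  assumes "x \<in> X" "y \<in> X"
  shows "\<beta> (s *s x + t *s y) (s *s x + t *s y)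
    = (s * s) *s \<beta> x x + (t * t) *s \<beta> y y + (2 * s * t) *s \<beta> x y"
proof -
  have m: "s *s x + t *s y \<in> X" by (rule lin_comb_mem[OF X(1) assms])
  have "\<beta> (s *s x + t *s y) (s *s x + t *s y)
      = s *s \<beta> x (s *s x + t *s y) + t *s \<beta> y (s *s x + t *s y)"
    by (rule lin_onD[OF lin1[OF m] assms])
  also have "\<dots> = s *s (s *s \<beta> x x + t *s \<beta> x y) + t *s (s *s \<beta> y x + t *s \<beta> y y)"
    by (simp only: lin_onD[OF lin2 assms])
  also have "\<beta> y x = \<beta> x y" by (rule sym[OF assms(2,1)])
  finally show ?thesis by (simp add: vec_eq_iff algebra_simps)
qed

end

lemma char2_from_even_card:
  assumes "even CARD('a::{field,finite})"
  shows "(2 :: 'a) = 0"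
proof (rule ccontr)
  assume two: "(2 :: 'a) \<noteq> 0"
  have "even (card (UNIV - {0 :: 'a}))"
  proof (rule even_card_involution[of _ uminus])
    fix x :: 'a assume x: "x \<in> UNIV - {0}"
    show "- x \<noteq> x"
    proof
      assume "- x = x"
      then have "2 * x = 0" by (metis mult_2 neg_eq_iff_add_eq_0)
      then show False using two x by simp
    qed
  qed auto
  then show False using assms CARD_field_ge2[where 'a='a] by simp
qed

lemma char2_square_root:
  assumes "(2 :: 'a::{field,finite}) = 0"
  shows "\<exists>s. s * s = (c :: 'a)"
proof -
  have "inj (\<lambda>s :: 'a. s * s)"
  proof (rule injI)
    fix x y :: 'a assume eq: "x * x = y * y"
    have "(x - y) * (x - y) = x * x + y * y - 2 * (x * y)" by (simp add: algebra_simps)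
    also have "\<dots> = 2 * (y * y)" using eq assms by simp
    finally show "x = y" using assms by simp
  qed
  then have "surj (\<lambda>s :: 'a. s * s)" by (rule finite_UNIV_inj_surj[OF finite])
  then show ?thesis by (metis surjD)
qed

context symmetric_square
begin

lemma proper_card:
  assumes "vec.subspace S" "S \<subseteq> X" "S \<noteq> X"
  shows "card (S - {0}) + 1 \<le> CARD('a) ^ n"
proof -
  have "vec.dim S \<le> n"
    using subspace_eqI[OF assms(1) X(1) assms(2)] assms(3) X(2) by force
  then have "card S \<le> CARD('a) ^ n"
    unfolding card_subspace[OF assms(1)] using q7 by (intro power_increasing) auto
  then show ?thesis using card_Suc_Diff1[of S 0] vec.subspace_0[OF assms(1)] by simp
qed

lemma dim_squares:
  assumes "(2 :: 'a) = 0"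
  shows "vec.subspace squares" "vec.dim squares = n + 1"
proof -
  have comb: "\<beta> (s *s x + t *s y) (s *s x + t *s y) = (s * s) *s \<beta> x x + (t * t) *s \<beta> y y"
    if "x \<in> X" "y \<in> X" for s t x y
    using square_comb[OF that, of s t] assms by simp
  show sub: "vec.subspace squares"
    unfolding vec.subspace_def
  proof (intro conjI ballI allI)
    have "0 = \<beta> 0 0" using beta_scale2[OF vec.subspace_0[OF X(1)], of 0 0] by simp
    then show "0 \<in> squares" unfolding squares_def by (rule image_eqI[OF _ vec.subspace_0[OF X(1)]])
  next
    fix a b assume "a \<in> squares" "b \<in> squares"
    then obtain x y where xy: "x \<in> X" "y \<in> X" "a = \<beta> x x" "b = \<beta> y y" by (auto simp: squares_def)
    then have "a + b = \<beta> (x + y) (x + y)" using comb[OF xy(1,2), of 1 1] by simp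
    then show "a + b \<in> squares" using xy X(1) by (auto simp: squares_def vec.subspace_add)
  next
    fix c :: 'a and a assume "a \<in> squares"
    then obtain x where x: "x \<in> X" "a = \<beta> x x" by (auto simp: squares_def)
    obtain s where "s * s = c" using char2_square_root[OF assms] by blast
    then have "c *s a = \<beta> (s *s x) (s *s x)" using comb[OF x(1) x(1), of s 0] x(2) by simp
    then show "c *s a \<in> squares" using x(1) X(1) by (auto simp: squares_def vec.subspace_scale)
  qed
  have "inj_on (\<lambda>x. \<beta> x x) X"
  proof (rule inj_onI, rule ccontr)
    fix x y assume xy: "x \<in> X" "y \<in> X" "\<beta> x x = \<beta> y y" "x \<noteq> y"
    have m: "1 *s x + (-1) *s y \<in> X" by (rule lin_comb_mem[OF X(1) xy(1,2)])
    have "\<beta> (1 *s x + (-1) *s y) (1 *s x + (-1) *s y) = 2 *s \<beta> y y"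
      using comb[OF xy(1,2), of 1 "-1"] xy(3) by (simp add: vec_eq_iff algebra_simps)
    then have "\<beta> (1 *s x + (-1) *s y) (1 *s x + (-1) *s y) = 0" using assms by simp
    then show False using product_nonzero[OF m m] xy(4) by auto
  qed
  then show "vec.dim squares = n + 1"
    by (intro dim_from_card[OF sub]) (simp add: squares_def card_image card_X)
qed

lemma squares_meet:
  assumes "x \<in> X" "x \<noteq> 0"
  shows "squares \<inter> el x \<subseteq> vec.span {\<beta> x x}" "\<beta> x x \<in> squares \<inter> el x"
proof -
  show "squares \<inter> el x \<subseteq> vec.span {\<beta> x x}"
  proof
    fix v assume "v \<in> squares \<inter> el x"
    then obtain y w where yw: "y \<in> X" "v = \<beta> y y" "w \<in> X" "v = \<beta> x w"
      by (auto simp: squares_def el_mem)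
    then have "y \<in> vec.span {x}" using product_third_factor[OF yw(1) yw(1) assms(1) yw(3)] by metis
    then obtain c where "y = c *s x" by (auto simp: span_singleton_mem)
    then have "v = (c * c) *s \<beta> x x"
      using yw(2) square_comb[OF assms(1) assms(1), of c 0] by simp
    then show "v \<in> vec.span {\<beta> x x}" by (auto simp: span_singleton_mem)
  qed
  show "\<beta> x x \<in> squares \<inter> el x" using assms(1) unfolding squares_def el_def by blast
qed

lemma squares_skew:
  assumes "x \<in> X" "y \<in> X" "x \<noteq> 0" "y \<notin> vec.span {x}"
  shows "squares \<inter> el x \<inter> el y \<subseteq> {0}"
proof
  fix v assume v: "v \<in> squares \<inter> el x \<inter> el y"
  have "v \<in> vec.span {\<beta> x x}" using squares_meet(1)[OF assms(1,3)] v by blast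
  then obtain c where c: "v = c *s \<beta> x x" by (auto simp: span_singleton_mem)
  obtain w where w: "w \<in> X" "v = \<beta> y w" using v by (auto simp: el_mem)
  have "c = 0"
  proof (rule ccontr)
    assume "c \<noteq> 0"
    then have "\<beta> x x = inverse c *s v" using c by simp
    also have "\<dots> = \<beta> y (inverse c *s w)" using w beta_scale2[OF w(1)] by simp
    finally have "\<beta> x x = \<beta> y (inverse c *s w)" .
    moreover have "inverse c *s w \<in> X" using w(1) X(1) by (simp add: vec.subspace_scale)
    moreover have "x \<notin> vec.span {y}" by (rule not_span_sym[OF assms(4,3)])
    ultimately show False using product_third_factor[OF assms(1,1,2)] by blast
  qed
  then show "v \<in> {0}" using c by simp
qed

text \<open>
  Here \<open>K\<close> consists of the vectors \<open>x\<close> whose element \<open>xX\<close> is known.  A further element \<open>U\<close> meets \<open>xX\<close> in a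
  point \<open>xg\<close>.  Since no point is on three elements, \<open>g\<close> is not in \<open>K\<close>, unless it is a multiple
  of \<open>x\<close>.  For fixed \<open>g\<close>, the \<open>x\<close> with \<open>xg \<in> U\<close> form a subspace, and \<open>U = gX\<close> if it is \<open>X\<close>;
  proper subspaces are too small to cover \<open>K\<close> with the few \<open>g\<close> outside \<open>K\<close>.  The \<open>x\<close> with
  \<open>x\<^sup>2 \<in> U\<close> do not help: in characteristic two they form a subspace, which is \<open>X\<close> only if \<open>U\<close> is the
  space of squares, and in odd characteristic a line with three of them would yield a product \<open>xy \<in> U\<close>
  with \<open>x\<close> and \<open>y\<close> in \<open>K\<close>.
\<close>

lemma recognise:
  assumes U: "vec.subspace U" "vec.dim U = n + 1"
    and K: "K \<subseteq> X - {0}" "\<And>x c. x \<in> K \<Longrightarrow> c \<noteq> 0 \<Longrightarrow> c *s x \<in> K"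
    and meet: "\<And>x. x \<in> K \<Longrightarrow> vec.dim (U \<inter> el x) = 1"
    and skew: "\<And>x y. x \<in> K \<Longrightarrow> y \<in> K \<Longrightarrow> y \<notin> vec.span {x} \<Longrightarrow> U \<inter> el x \<inter> el y = {0}"
    and few: "card (X - {0} - K) \<le> (CARD('a) - 1) * e" "2 * e + 3 \<le> CARD('a)"
  shows "(\<exists>y\<in>X - {0}. U = el y) \<or> ((2 :: 'a) = 0 \<and> U = squares)"
proof (rule ccontr)
  assume no: "\<not> ?thesis"
  define C where "C = X - {0} - K"
  define S where "S y = {x \<in> X. \<beta> x y \<in> U}" for y
  define Q where "Q = {x \<in> X. \<beta> x x \<in> U}"
  have KX: "x \<in> X" "x \<noteq> 0" if "x \<in> K" for x using K(1) that by auto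
  have C_scale: "c *s x \<in> C" if "x \<in> C" "c \<noteq> 0" for x c
  proof -
    have "c *s x \<notin> K"
    proof
      assume "c *s x \<in> K"
      then have "inverse c *s (c *s x) \<in> K" using K(2) that(2) by (metis nonzero_imp_inverse_nonzero)
      then show False using that by (simp add: C_def)
    qed
    then show ?thesis using that X(1) by (simp add: C_def vec.subspace_scale)
  qed
  have S: "card (S y - {0}) + 1 \<le> CARD('a) ^ n" if y: "y \<in> C" for y
  proof (rule proper_card)
    have yX: "y \<in> X" "y \<noteq> 0" using y by (auto simp: C_def)
    show "S y \<subseteq> X" by (auto simp: S_def)
    show "vec.subspace (S y)"
      unfolding vec.subspace_def
    proof (intro conjI ballI allI)
      have "\<beta> (0 *s 0) y = 0" using beta_scale1[OF yX(1) vec.subspace_0[OF X(1)], of 0] by simp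
      then show "0 \<in> S y" using U(1) X(1) by (simp add: S_def vec.subspace_0)
    next
      fix a b assume "a \<in> S y" "b \<in> S y"
      then show "a + b \<in> S y"
        using U(1) X(1) beta_add1[OF yX(1), of a b] by (simp add: S_def vec.subspace_add)
    next
      fix c a assume "a \<in> S y"
      then show "c *s a \<in> S y"
        using U(1) X(1) beta_scale1[OF yX(1), of a c] by (simp add: S_def vec.subspace_scale)
    qed
    show "S y \<noteq> X"
    proof
      assume eq: "S y = X"
      have "el y \<subseteq> U"
      proof
        fix v assume "v \<in> el y"
        then obtain x where x: "x \<in> X" "v = \<beta> y x" by (auto simp: el_mem)
        then have "x \<in> S y" using eq by simp
        then show "v \<in> U" using x sym[OF x(1) yX(1)] by (simp add: S_def)
      qed
      then have "el y = U" using dim_el[OF yX] U subspace_el by (intro subspace_eqI) simp_all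
      then show False using no yX by auto
    qed
  qed
  have ex_factor: "\<exists>g\<in>C. \<beta> x g \<in> U" if x: "x \<in> K" "x \<notin> Q" for x
  proof -
    note xX = KX[OF x(1)]
    obtain v where v: "v \<in> U" "v \<in> el x" "v \<noteq> 0"
      using dim_pos_ex[of "U \<inter> el x"] meet[OF x(1)] U(1) subspace_el by (auto simp: vec.subspace_inter)
    then obtain g where g: "g \<in> X" "v = \<beta> x g" by (auto simp: el_mem)
    have g0: "g \<noteq> 0"
    proof
      assume "g = 0"
      then have "\<beta> x g = 0" using beta_scale2[OF g(1), of x 0] by simp
      then show False using v g by simp
    qed
    have "g \<notin> K"
    proof
      assume gK: "g \<in> K"
      have "g \<in> vec.span {x}"
      proof (rule ccontr)
        assume "g \<notin> vec.span {x}"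
        then have "U \<inter> el x \<inter> el g = {0}" by (rule skew[OF x(1) gK])
        moreover have "v \<in> el g" unfolding el_mem g(2) using sym[OF xX(1) g(1)] xX(1) by blast
        ultimately show False using v by blast
      qed
      then obtain c where c: "g = c *s x" by (auto simp: span_singleton_mem)
      then have "v = c *s \<beta> x x" using g(2) beta_scale2[OF xX(1)] by simp
      moreover have "c \<noteq> 0" using c g0 by auto
      ultimately have "\<beta> x x = inverse c *s v" by simp
      then have "x \<in> Q" using v(1) U(1) xX(1) by (simp add: Q_def vec.subspace_scale)
      then show False using x(2) by simp
    qed
    then show ?thesis using g g0 v(1) by (auto simp: C_def)
  qed
  \<comment> \<open>Count the pairs \<open>(x, y)\<close> with \<open>xy \<in> U\<close>; each \<open>x\<close> occurs with all \<open>q - 1\<close> multiples of a factor.\<close>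
  have "(CARD('a) - 1) * card (K - Q) \<le> card (Sigma (K - Q) (\<lambda>x. {y \<in> C. \<beta> x y \<in> U}))"
  proof -
    have "CARD('a) - 1 \<le> card {y \<in> C. \<beta> x y \<in> U}" if x: "x \<in> K - Q" for x
    proof -
      obtain g where g: "g \<in> C" "\<beta> x g \<in> U" using ex_factor x by blast
      have gX: "g \<in> X" "g \<noteq> 0" using g(1) by (auto simp: C_def)
      have "vec.span {g} - {0} \<subseteq> {y \<in> C. \<beta> x y \<in> U}"
      proof
        fix y assume y: "y \<in> vec.span {g} - {0}"
        then obtain c where c: "y = c *s g" by (auto simp: span_singleton_mem)
        then have "c \<noteq> 0" using y by auto
        moreover have "\<beta> x y \<in> U" using c beta_scale2[OF gX(1)] g(2) U(1) by (simp add: vec.subspace_scale)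
        ultimately show "y \<in> {y \<in> C. \<beta> x y \<in> U}" using C_scale[OF g(1)] c by simp
      qed
      then have "card (vec.span {g} - {0}) \<le> card {y \<in> C. \<beta> x y \<in> U}" by (intro card_mono) auto
      then show ?thesis
        using card_subspace[of "vec.span {g}"] gX(2) by (simp add: card_Diff_singleton vec.span_zero)
    qed
    then have "(\<Sum>x\<in>K - Q. CARD('a) - 1) \<le> (\<Sum>x\<in>K - Q. card {y \<in> C. \<beta> x y \<in> U})"
      by (intro sum_mono) simp
    then show ?thesis by (simp add: card_SigmaI mult.commute)
  qed
  also have "\<dots> \<le> card (prod.swap ` Sigma C (\<lambda>y. S y - {0}))"
  proof (rule card_mono)
    show "Sigma (K - Q) (\<lambda>x. {y \<in> C. \<beta> x y \<in> U}) \<subseteq> prod.swap ` Sigma C (\<lambda>y. S y - {0})"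
    proof (rule subsetI)
      fix p assume "p \<in> Sigma (K - Q) (\<lambda>x. {y \<in> C. \<beta> x y \<in> U})"
      then obtain x y where "p = (x, y)" "x \<in> K" "y \<in> C" "\<beta> x y \<in> U" by blast
      then show "p \<in> prod.swap ` Sigma C (\<lambda>y. S y - {0})"
        using KX[of x] by (intro image_eqI[of _ _ "(y, x)"]) (auto simp: S_def)
    qed
  qed simp
  also have "\<dots> \<le> card (Sigma C (\<lambda>y. S y - {0}))" by (rule card_image_le) simp
  also have "\<dots> = (\<Sum>y\<in>C. card (S y - {0}))" by (simp add: card_SigmaI)
  also have "\<dots> \<le> (\<Sum>y\<in>C. CARD('a) ^ n - 1)" using S by (intro sum_mono) fastforce
  also have "\<dots> = card C * (CARD('a) ^ n - 1)" by simp
  also have "\<dots> \<le> (CARD('a) - 1) * e * (CARD('a) ^ n - 1)" using few(1) unfolding C_def by (rule mult_le_mono1)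
  finally have "(CARD('a) - 1) * card (K - Q) \<le> (CARD('a) - 1) * (e * (CARD('a) ^ n - 1))"
    by (simp add: mult.assoc)
  then have cKQ: "card (K - Q) \<le> e * (CARD('a) ^ n - 1)" using q7 by simp
  have cQ: "card (K \<inter> Q) + 1 \<le> CARD('a) ^ n + (CARD('a) - 1)"
  proof (cases "(2 :: 'a) = 0")
    case True
    have comb: "\<beta> (s *s x + t *s y) (s *s x + t *s y) = (s * s) *s \<beta> x x + (t * t) *s \<beta> y y"
      if "x \<in> X" "y \<in> X" for s t x y
      using square_comb[OF that, of s t] True by simp
    have "card (Q - {0}) + 1 \<le> CARD('a) ^ n"
    proof (rule proper_card)
      show "Q \<subseteq> X" by (auto simp: Q_def)
      show "vec.subspace Q"
        unfolding vec.subspace_def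
      proof (intro conjI ballI allI)
        have "\<beta> 0 0 = 0" using beta_scale2[OF vec.subspace_0[OF X(1)], of 0 0] by simp
        then show "0 \<in> Q" using U(1) X(1) by (simp add: Q_def vec.subspace_0)
      next
        fix a b assume "a \<in> Q" "b \<in> Q"
        then show "a + b \<in> Q"
          using comb[of a b 1 1] U(1) X(1) by (simp add: Q_def vec.subspace_add)
      next
        fix c a assume "a \<in> Q"
        then show "c *s a \<in> Q"
          using comb[of a a c 0] U(1) X(1) by (simp add: Q_def vec.subspace_scale)
      qed
      show "Q \<noteq> X"
      proof
        assume "Q = X"
        then have "squares \<subseteq> U" by (auto simp: Q_def squares_def)
        then have "squares = U" using dim_squares[OF True] U by (intro subspace_eqI) simp_all
        then show False using no True by auto
      qed
    qed
    moreover have "card (K \<inter> Q) \<le> card (Q - {0})" using KX by (intro card_mono) auto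
    ultimately show ?thesis by linarith
  next
    case two: False
    show ?thesis
    proof (cases "K \<inter> Q = {}")
      case True
      then show ?thesis using q7 by (simp add: Suc_leI)
    next
      case False
      then obtain z where z: "z \<in> K" "z \<in> Q" by blast
      note zX = KX[OF z(1)]
      have no_three: False
        if v: "v \<in> K \<inter> Q" "v \<notin> vec.span {z}" and w: "v + c *s z \<in> K \<inter> Q" and c: "c \<noteq> 0" for v c
      proof -
        have vX: "v \<in> X" "v \<noteq> 0" using KX v(1) by auto
        have "\<beta> (1 *s v + c *s z) (1 *s v + c *s z) \<in> U" using w by (simp add: Q_def)
        then have "(1 * 1) *s \<beta> v v + (c * c) *s \<beta> z z + (2 * 1 * c) *s \<beta> v z \<in> U"
          by (simp only: square_comb[OF vX(1) zX(1)])
        moreover have "(1 * 1) *s \<beta> v v + (c * c) *s \<beta> z z \<in> U"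
          using v(1) z(2) U(1) by (intro lin_comb_mem) (auto simp: Q_def)
        ultimately have "((1 * 1) *s \<beta> v v + (c * c) *s \<beta> z z + (2 * 1 * c) *s \<beta> v z)
            - ((1 * 1) *s \<beta> v v + (c * c) *s \<beta> z z) \<in> U" using U(1) by (intro vec.subspace_diff)
        then have "(2 * c) *s \<beta> v z \<in> U" by simp
        then have "inverse (2 * c) *s ((2 * c) *s \<beta> v z) \<in> U" by (rule vec.subspace_scale[OF U(1)])
        then have "\<beta> v z \<in> U" using c two by simp
        moreover have "\<beta> v z \<in> el v" "\<beta> v z \<in> el z"
          using zX(1) vX(1) sym[OF vX(1) zX(1)] unfolding el_mem by blast+
        moreover have "U \<inter> el z \<inter> el v = {0}" using skew[OF z(1) _ v(2)] v(1) by blast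
        ultimately have "\<beta> v z = 0" by blast
        then show False using product_nonzero[OF vX(1) zX(1) vX(2) zX(2)] by simp
      qed
      \<comment> \<open>The cosets of \<open>\<langle>z\<rangle>\<close> contain at most one of these vectors each.\<close>
      let ?D = "K \<inter> Q - vec.span {z}"
      let ?h = "\<lambda>(v, c). v + c *s z"
      have "inj_on ?h (?D \<times> UNIV)"
      proof (rule inj_onI, clarify)
        fix v c v' c' assume v: "v \<in> K" "v \<in> Q" "v \<notin> vec.span {z}" and v': "v' \<in> K" "v' \<in> Q"
          and eq: "v + c *s z = v' + c' *s z"
        have "v' = v + (c - c') *s z"
          using eq by (simp add: vec.scale_left_diff_distrib algebra_simps)
        then have "c - c' = 0" using no_three[of v "c - c'"] v v' by auto
        then show "v = v' \<and> c = c'" using eq by simp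
      qed
      then have "card ?D * CARD('a) = card (?h ` (?D \<times> UNIV))"
        by (simp add: card_image card_cartesian_product)
      also have "\<dots> \<le> card (X - vec.span {z})"
      proof (rule card_mono)
        show "?h ` (?D \<times> UNIV) \<subseteq> X - vec.span {z}"
        proof (rule subsetI)
          fix p assume "p \<in> ?h ` (?D \<times> UNIV)"
          then obtain v c where p: "p = v + c *s z" "v \<in> K" "v \<notin> vec.span {z}" by auto
          have "p \<in> X" using p(1) KX(1)[OF p(2)] zX(1) X(1) by (simp add: vec.subspace_add vec.subspace_scale)
          moreover have "p \<notin> vec.span {z}"
          proof
            assume "p \<in> vec.span {z}"
            moreover have "c *s z \<in> vec.span {z}" by (auto simp: span_singleton_mem)
            ultimately have "p - c *s z \<in> vec.span {z}" by (rule vec.span_diff)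
            then show False using p by simp
          qed
          ultimately show "p \<in> X - vec.span {z}" by simp
        qed
      qed simp
      also have "\<dots> = CARD('a) ^ (n + 1) - CARD('a)"
        using card_subspace[of "vec.span {z}"] zX card_X X(1)
        by (simp add: card_Diff_subset vec.span_minimal)
      also have "\<dots> = (CARD('a) ^ n - 1) * CARD('a)" by (simp add: algebra_simps)
      finally have D: "card ?D \<le> CARD('a) ^ n - 1" using q7 by simp
      have "card (K \<inter> Q) \<le> card (?D \<union> (vec.span {z} - {0}))" using KX by (intro card_mono) auto
      also have "\<dots> \<le> card ?D + card (vec.span {z} - {0})" by (rule card_Un_le)
      also have "card (vec.span {z} - {0}) = CARD('a) - 1"
        using card_subspace[of "vec.span {z}"] zX(2) by (simp add: card_Diff_singleton vec.span_zero)
      finally have "card (K \<inter> Q) \<le> (CARD('a) ^ n - 1) + (CARD('a) - 1)" using D by linarith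
      moreover have "CARD('a) ^ n \<ge> 1" using q7 by (simp add: Suc_leI)
      ultimately show ?thesis by linarith
    qed
  qed
  define A where "A = CARD('a) ^ n"
  have "CARD('a) ^ (n + 1) = card X" by (simp add: card_X)
  also have "\<dots> = card (insert 0 (C \<union> ((K - Q) \<union> (K \<inter> Q))))"
  proof -
    have "X = insert 0 (C \<union> ((K - Q) \<union> (K \<inter> Q)))"
      using vec.subspace_0[OF X(1)] K(1) by (auto simp: C_def)
    then show ?thesis by simp
  qed
  also have "\<dots> \<le> 1 + (card C + (card (K - Q) + card (K \<inter> Q)))"
    using card_Un_le[of C "(K - Q) \<union> (K \<inter> Q)"] card_Un_le[of "K - Q" "K \<inter> Q"]
    by (simp add: card_insert_if)
  also have "\<dots> \<le> (CARD('a) - 1) * e + e * (A - 1) + A + (CARD('a) - 1)"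
    using few(1) cKQ cQ unfolding C_def A_def by linarith
  finally have main: "CARD('a) * A \<le> (CARD('a) - 1) * e + e * (A - 1) + A + (CARD('a) - 1)"
    by (simp add: A_def)
  have "CARD('a) ^ 2 \<le> A" unfolding A_def using n q7 by (intro power_increasing) auto
  then have A: "CARD('a) * CARD('a) \<le> A" by (simp add: power2_eq_square)
  have "(CARD('a) - 1) * e + (CARD('a) - 1) \<le> CARD('a) * (e + 1)"
    by (simp add: algebra_simps)
  also have "\<dots> \<le> CARD('a) * CARD('a)" using few(2) by (intro mult_le_mono2) linarith
  finally have "CARD('a) * A \<le> e * A + A + A"
    using main A mult_le_mono2[of "A - 1" A e] by linarith
  then have "CARD('a) * A \<le> (e + 2) * A" by (simp add: algebra_simps)
  moreover have "A > 0" unfolding A_def using q7 by simp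
  ultimately have "CARD('a) \<le> e + 2" by (simp only: mult_le_cancel2)
  then show False using few(2) q7 by linarith
qed

end

section \<open>The extension\<close>

text \<open>
  The conditions on intersections that dual arcs and dual hyperovals share.
\<close>

definition dual_family :: "nat \<Rightarrow> ('a::field ^ 'v) set set \<Rightarrow> bool" where
  "dual_family n D \<longleftrightarrow> (\<forall>U\<in>D. vec.subspace U \<and> vec.dim U = n + 1) \<and>
     (\<forall>U\<in>D. \<forall>V\<in>D. U \<noteq> V \<longrightarrow> vec.dim (U \<inter> V) = 1) \<and>
     (\<forall>U\<in>D. \<forall>V\<in>D. \<forall>W\<in>D. U \<noteq> V \<and> U \<noteq> W \<and> V \<noteq> W \<longrightarrow> U \<inter> V \<inter> W = {0})"

lemma dual_familyD:
  assumes "dual_family n D"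
  shows "U \<in> D \<Longrightarrow> vec.subspace U" "U \<in> D \<Longrightarrow> vec.dim U = n + 1"
    "U \<in> D \<Longrightarrow> V \<in> D \<Longrightarrow> U \<noteq> V \<Longrightarrow> vec.dim (U \<inter> V) = 1"
    "U \<in> D \<Longrightarrow> V \<in> D \<Longrightarrow> W \<in> D \<Longrightarrow> U \<noteq> V \<Longrightarrow> U \<noteq> W \<Longrightarrow> V \<noteq> W \<Longrightarrow> U \<inter> V \<inter> W = {0}"
  using assms by (simp_all add: dual_family_def)

lemma dual_familyI:
  assumes "\<And>U. U \<in> D \<Longrightarrow> vec.subspace U" "\<And>U. U \<in> D \<Longrightarrow> vec.dim U = n + 1"
    "\<And>U V. U \<in> D \<Longrightarrow> V \<in> D \<Longrightarrow> U \<noteq> V \<Longrightarrow> vec.dim (U \<inter> V) = 1"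
    "\<And>U V W. U \<in> D \<Longrightarrow> V \<in> D \<Longrightarrow> W \<in> D \<Longrightarrow> U \<noteq> V \<Longrightarrow> U \<noteq> W \<Longrightarrow> V \<noteq> W \<Longrightarrow> U \<inter> V \<inter> W = {0}"
  shows "dual_family n D"
  using assms by (simp add: dual_family_def)

lemma dual_family_subset:
  assumes "dual_family n D" "E \<subseteq> D"
  shows "dual_family n E"
  by (rule dual_familyI; rule dual_familyD[OF assms(1)]; (rule subsetD[OF assms(2)])?; assumption)

context symmetric_square
begin

lemma dual_family_model: "dual_family n (el ` (X - {0}))"
proof (rule dual_familyI)
  fix U assume "U \<in> el ` (X - {0})"
  then show "vec.subspace U" "vec.dim U = n + 1" using subspace_el dim_el by auto
next
  fix U V assume *: "U \<in> el ` (X - {0})" "V \<in> el ` (X - {0})" "U \<noteq> V"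
  then obtain x y where xy: "x \<in> X" "x \<noteq> 0" "U = el x" "y \<in> X" "y \<noteq> 0" "V = el y" by auto
  then have "y \<notin> vec.span {x}" using el_eq_iff[OF xy(1,4,2,5)] *(3) by simp
  then show "vec.dim (U \<inter> V) = 1"
    using el_meet[OF xy(1,4,2)] xy dim_span_singleton[OF product_nonzero[OF xy(1,4,2,5)]] by simp
next
  fix U V W assume *: "U \<in> el ` (X - {0})" "V \<in> el ` (X - {0})" "W \<in> el ` (X - {0})"
    and ne: "U \<noteq> V" "U \<noteq> W" "V \<noteq> W"
  obtain x y z where xyz: "x \<in> X" "x \<noteq> 0" "U = el x" "y \<in> X" "y \<noteq> 0" "V = el y" "z \<in> X" "z \<noteq> 0" "W = el z"
    using *(1-3) by auto
  then show "U \<inter> V \<inter> W = {0}"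
    using el_skew[OF xyz(1,4,7,2,5)] el_eq_iff[OF xyz(1,4,2,5)] el_eq_iff[OF xyz(1,7,2,8)]
      el_eq_iff[OF xyz(4,7,5,8)] ne by simp
qed

lemma dual_family_with_squares:
  assumes two: "(2 :: 'a) = 0"
  shows "dual_family n (insert squares (el ` (X - {0})))" "squares \<notin> el ` (X - {0})"
proof -
  let ?D = "el ` (X - {0})"
  note D = dual_familyD[OF dual_family_model]
  note N = dim_squares[OF two]
  have N1: "vec.dim (squares \<inter> U) = 1" if U: "U \<in> ?D" for U
  proof -
    obtain x where x: "x \<in> X" "x \<noteq> 0" "U = el x" using U by auto
    have "squares \<inter> el x = vec.span {\<beta> x x}"
      using squares_meet[OF x(1,2)] N(1) subspace_el
      by (intro equalityI span_singleton_subset) (simp_all add: vec.subspace_inter)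
    then show ?thesis using x dim_span_singleton[OF product_nonzero[OF x(1,1,2,2)]] by simp
  qed
  have N2: "squares \<inter> U \<inter> V = {0}" if UV: "U \<in> ?D" "V \<in> ?D" "U \<noteq> V" for U V
  proof -
    obtain x y where xy: "x \<in> X" "x \<noteq> 0" "U = el x" "y \<in> X" "y \<noteq> 0" "V = el y" using UV by auto
    then have "y \<notin> vec.span {x}" using el_eq_iff[OF xy(1,4,2,5)] UV(3) by simp
    then have "squares \<inter> U \<inter> V \<subseteq> {0}" using squares_skew[OF xy(1,4,2)] xy by simp
    then show ?thesis using N(1) subspace_el xy by (auto simp: vec.subspace_0)
  qed
  show "squares \<notin> ?D"
  proof
    assume "squares \<in> ?D"
    from N1[OF this] show False using N(2) n by simp
  qed
  show "dual_family n (insert squares ?D)"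
  proof (rule dual_familyI)
    fix U assume U: "U \<in> insert squares ?D"
    show "vec.subspace U" using U D(1) N(1) by (metis insertE)
    show "vec.dim U = n + 1" using U D(2) N(2) by (metis insertE)
  next
    fix U V assume "U \<in> insert squares ?D" "V \<in> insert squares ?D" "U \<noteq> V"
    then show "vec.dim (U \<inter> V) = 1" using N1 D(3) by (metis Int_commute insertE)
  next
    fix U V W assume *: "U \<in> insert squares ?D" "V \<in> insert squares ?D" "W \<in> insert squares ?D"
      "U \<noteq> V" "U \<noteq> W" "V \<noteq> W"
    consider "U = squares" | "V = squares" | "W = squares" | "U \<in> ?D" "V \<in> ?D" "W \<in> ?D" using * by blast
    then show "U \<inter> V \<inter> W = {0}"
    proof cases
      case 1
      then show ?thesis using N2[of V W] * by (metis insertE)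
    next
      case 2
      then have "squares \<inter> U \<inter> W = {0}" using N2[of U W] * by (metis insertE)
      then show ?thesis unfolding 2 by (simp only: Int_commute)
    next
      case 3
      then have "squares \<inter> U \<inter> V = {0}" using N2[of U V] * by (metis insertE)
      then show ?thesis unfolding 3 by (metis Int_assoc Int_commute)
    next
      case 4
      then show ?thesis using D(4) *(4-6) by blast
    qed
  qed
qed

end

context partial_dual_arc
begin

text \<open>
  All but two members are in the model by \<open>coordinates\<close>.  They cut every member in too many points
  for their span to miss anything, so the product generates the ambient space, and \<open>recognise\<close>
  places the last two.
\<close>

lemma extension:
  assumes "U0 \<in> F" "U1 \<in> F" "U0 \<noteq> U1" "card (line U0 U1) \<ge> 3"
  obtains D where "F \<subseteq> D" "dual_family n D" "card D = num_points CARD('a) (n + 1)"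
    "(2 :: 'a) = 0 \<Longrightarrow> \<exists>H. D \<subseteq> H \<and> dual_family n H \<and> card H = card D + 1"
proof -
  obtain U2 where "U2 \<in> F" "U2 \<noteq> U0" "card (line U0 U2) \<ge> CARD('a)"
    using ex_long_line[OF assms] by blast
  then interpret b: base_element F n d U0 using assms(1) by unfold_locales auto
  let ?K = "insert U0 b.Long"
  obtain \<beta> where \<beta>: "\<And>x. lin_on U0 (\<beta> x)" "\<And>y. y \<in> U0 \<Longrightarrow> lin_on U0 (\<lambda>x. \<beta> x y)"
    "\<And>x y. x \<in> U0 \<Longrightarrow> y \<in> U0 \<Longrightarrow> \<beta> x y = \<beta> y x"
    "\<And>S. S \<in> ?K \<Longrightarrow> \<exists>x\<in>U0 - {0}. S = \<beta> x ` U0"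
    using b.coordinates by blast
  have K_F: "?K \<subseteq> F" using assms(1) by (auto simp: b.Long_def)
  have cK: "card ?K + 2 \<ge> card F"
  proof -
    have "F \<subseteq> ?K \<union> (F - {U0} - b.Long)" by blast
    then have "card F \<le> card (?K \<union> (F - {U0} - b.Long))" by (intro card_mono) auto
    also have "\<dots> \<le> card ?K + card (F - {U0} - b.Long)" by (rule card_Un_le)
    finally show ?thesis using b.few_not_Long by linarith
  qed
  let ?Y = "vec.span {\<beta> x y |x y. x \<in> U0 \<and> y \<in> U0}"
  have K_Y: "S \<subseteq> ?Y" if S: "S \<in> ?K" for S
  proof
    fix v assume v: "v \<in> S"
    obtain x where x: "x \<in> U0" "S = \<beta> x ` U0" using \<beta>(4)[OF S] by blast
    then obtain y where "y \<in> U0" "v = \<beta> x y" using v by blast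
    then show "v \<in> ?Y" using x(1) by (intro vec.span_base) blast
  qed
  have "W \<subseteq> ?Y" if W: "W \<in> F" for W
  proof (rule many_points_span[OF subF[OF W] vec.subspace_span, of n "\<lambda>S. S \<inter> W" "?K - {W}"])
    show "vec.dim W = Suc n" using dimF[OF W] by simp
    show "inj_on (\<lambda>S. S \<inter> W) (?K - {W})" by (rule inj_on_subset[OF inj_meet[OF W]]) (use K_F in blast)
    show "(\<lambda>S. S \<inter> W) ` (?K - {W}) \<subseteq> points W" using meet_points[OF _ W] K_F by blast
    show "S \<inter> W \<subseteq> ?Y" if "S \<in> ?K - {W}" for S using K_Y[of S] that by blast
    have "card (?K - {W}) + 3 \<ge> card F" using cK card_Diff1_le[of ?K W] card_Suc_Diff1[of ?K W]
      by (cases "W \<in> ?K") auto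
    moreover have "card F + d = 1 + CARD('a) * num_points CARD('a) n"
      using card_F by (simp add: num_points_Suc)
    moreover have "CARD('a) * num_points CARD('a) n \<ge> 7 * num_points CARD('a) n"
      using q_bound by (intro mult_le_mono1) linarith
    ultimately show "num_points CARD('a) n < card (?K - {W})" using num_points_n_ge q_bound by linarith
  qed
  then have "vec.span (\<Union>F) \<subseteq> ?Y" by (intro vec.span_minimal vec.subspace_span) blast
  then have "?Y = UNIV" using span_F by blast
  then interpret m: symmetric_square U0 n \<beta>
    using subF[OF assms(1)] dimF[OF assms(1)] n2 q_bound ambient \<beta>(1-3) by unfold_locales auto
  define Kv where "Kv = {x \<in> U0 - {0}. m.el x \<in> ?K}"
  have Kv_sub: "Kv \<subseteq> U0 - {0}" by (auto simp: Kv_def)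
  have el_Kv: "m.el ` Kv = ?K"
  proof
    show "m.el ` Kv \<subseteq> ?K" by (auto simp: Kv_def)
    show "?K \<subseteq> m.el ` Kv"
    proof
      fix S assume S: "S \<in> ?K"
      then obtain x where "x \<in> U0 - {0}" "S = m.el x" using \<beta>(4)[OF S] by (auto simp: m.el_def)
      then show "S \<in> m.el ` Kv" using S by (auto simp: Kv_def)
    qed
  qed
  have Kv_scale: "c *s x \<in> Kv" if "x \<in> Kv" "c \<noteq> 0" for x c
    using that m.el_scale[of x c] subF[OF assms(1)] by (simp add: Kv_def vec.subspace_scale)
  have few: "card (U0 - {0} - Kv) \<le> (CARD('a) - 1) * (d + 2)"
  proof -
    have "card Kv = (CARD('a) - 1) * card (m.el ` Kv)"
      by (rule m.card_el_image[OF Kv_sub Kv_scale])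
    then have "card Kv = (CARD('a) - 1) * card ?K" by (simp only: el_Kv)
    moreover have "card (U0 - {0}) = (CARD('a) - 1) * card (m.el ` (U0 - {0}))"
      by (rule m.card_el_image) (use subF[OF assms(1)] in \<open>auto simp: vec.subspace_scale\<close>)
    moreover have "card (m.el ` (U0 - {0})) \<le> card ?K + (d + 2)" using m.card_model card_F cK by linarith
    then have "(CARD('a) - 1) * card (m.el ` (U0 - {0}))
        \<le> (CARD('a) - 1) * card ?K + (CARD('a) - 1) * (d + 2)"
      unfolding distrib_left[symmetric] by (rule mult_le_mono2)
    moreover have "card (U0 - {0} - Kv) = card (U0 - {0}) - card Kv"
      by (rule card_Diff_subset) (auto simp: Kv_def)
    ultimately show ?thesis by (simp only: le_diff_conv diff_le_mono add.commute)
  qed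
  let ?D = "m.el ` (U0 - {0})"
  have rec: "U \<in> ?D \<or> ((2 :: 'a) = 0 \<and> U = m.squares)" if U: "U \<in> F" for U
  proof (cases "U \<in> ?K")
    case True
    then have "U \<in> m.el ` Kv" by (simp only: el_Kv)
    then have "U \<in> ?D" using image_mono[OF Kv_sub, of m.el] by (rule rev_subsetD)
    then show ?thesis ..
  next
    case False
    have el_F: "m.el x \<in> F" "m.el x \<noteq> U" if "x \<in> Kv" for x
    proof -
      have "m.el x \<in> ?K" using that by (simp add: Kv_def)
      then show "m.el x \<in> F" "m.el x \<noteq> U" using K_F False by blast+
    qed
    have "(\<exists>y\<in>U0 - {0}. U = m.el y) \<or> ((2 :: 'a) = 0 \<and> U = m.squares)"
    proof (rule m.recognise[OF subF[OF U] dimF[OF U] _ Kv_scale _ _ few])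
      show "Kv \<subseteq> U0 - {0}" by (rule Kv_sub)
      show "vec.dim (U \<inter> m.el x) = 1" if "x \<in> Kv" for x
        using dim_meet[OF U el_F(1)[OF that] el_F(2)[OF that, symmetric]] .
      show "U \<inter> m.el x \<inter> m.el y = {0}" if xy: "x \<in> Kv" "y \<in> Kv" "y \<notin> vec.span {x}" for x y
      proof -
        have "x \<in> U0" "y \<in> U0" "x \<noteq> 0" "y \<noteq> 0" using xy by (auto simp: Kv_def)
        then have "m.el x \<noteq> m.el y" using m.el_eq_iff xy(3) by blast
        then show ?thesis
          using skew[OF U el_F(1)[OF xy(1)] el_F(1)[OF xy(2)] el_F(2)[OF xy(1), symmetric]
              el_F(2)[OF xy(2), symmetric]] by blast
      qed
      show "2 * (d + 2) + 3 \<le> CARD('a)" using q_bound by simp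
    qed
    then show ?thesis by blast
  qed
  show ?thesis
  proof (cases "(2 :: 'a) = 0")
    case False
    then have "F \<subseteq> ?D" using rec by blast
    then show ?thesis using that[of ?D] m.dual_family_model m.card_model False by blast
  next
    case True
    \<comment> \<open>The arc cannot always be the model itself, since \<open>F\<close> may contain the space of squares.\<close>
    let ?H = "insert m.squares ?D"
    note H = m.dual_family_with_squares[OF True]
    have FH: "F \<subseteq> ?H" using rec by blast
    have cH: "card ?H = num_points CARD('a) (n + 1) + 1" using H(2) m.card_model by simp
    then have "\<not> ?H \<subseteq> F" using card_mono[of F ?H] card_F by force
    then obtain T where T: "T \<in> ?H" "T \<notin> F" by blast
    have sub: "?H - {T} \<subseteq> ?H" by blast
    have cHT: "card (?H - {T}) = num_points CARD('a) (n + 1)"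
      using T(1) cH by (simp add: card_Diff_singleton)
    show ?thesis
    proof (rule that[of "?H - {T}"])
      show "F \<subseteq> ?H - {T}" using FH T(2) by blast
      show "dual_family n (?H - {T})" by (rule dual_family_subset[OF H(1) sub])
      show "card (?H - {T}) = num_points CARD('a) (n + 1)" by (rule cHT)
      have "?H - {T} \<subseteq> ?H \<and> dual_family n ?H \<and> card ?H = card (?H - {T}) + 1"
        using sub H(1) cH cHT by simp
      then show "\<exists>H. ?H - {T} \<subseteq> H \<and> dual_family n H \<and> card H = card (?H - {T}) + 1" by blast
    qed
  qed
qed

end


lemma real_num_points:
  assumes "q \<ge> 2"
  shows "real (num_points q k) = (real q ^ k - 1) / (real q - 1)"
proof -
  have "real ((q - 1) * num_points q k + 1) = real (q ^ k)"
    using num_points_mult[of q k] assms by simp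
  then have "(real q - 1) * real (num_points q k) = real q ^ k - 1"
    using assms by (simp add: of_nat_diff algebra_simps)
  then show ?thesis using assms by (simp add: field_simps)
qed

lemma proj_subspace_iff:
  "proj_subspace (int k - 1) U \<longleftrightarrow> vec.subspace U \<and> vec.dim U = k"
  by (auto simp: proj_subspace_def pdim_def)

lemma regular_dual_arcI:
  fixes D :: "('a::{field,finite} ^ 'v) set set"
  assumes D: "dual_family n D" "card D = num_points CARD('a) (n + 1)" "vec.span (\<Union>D) = UNIV"
    and n: "n \<ge> 2" and ambient: "CARD('v) = n * (n + 3) div 2 + 1"
  shows "regular_generalised_dual_arc 1 [int (n * (n + 3) div 2), int n, 0] D"
proof -
  let ?ms = "[int (n * (n + 3) div 2), int n, 0]"
  note F = dual_familyD[OF D(1)]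
  have sub: "proj_subspace (int n) U" if "U \<in> D" for U
    using F(1,2)[OF that] proj_subspace_iff[of "n + 1" U] by simp
  have two: "proj_subspace 0 (U \<inter> V)" if "U \<in> D" "V \<in> D" "U \<noteq> V" for U V
    using F(3)[OF that] F(1)[OF that(1)] F(1)[OF that(2)] proj_subspace_iff[of 1 "U \<inter> V"]
    by (simp add: vec.subspace_inter)
  have three: "proj_subspace (- 1) (U \<inter> V \<inter> W)"
    if "U \<in> D" "V \<in> D" "W \<in> D" "U \<noteq> V" "U \<noteq> W" "V \<noteq> W" for U V W
    using F(4)[OF that] proj_subspace_iff[of 0 "U \<inter> V \<inter> W"] by simp
  have "n * 5 \<le> n * (n + 3)" using n by (intro mult_le_mono2) simp
  then have n_less: "n < n * (n + 3) div 2" using n by linarith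
  have inters: "proj_subspace (?ms ! j) (\<Inter>G)" if j: "j \<in> {1..1 + 1}" and G: "G \<subseteq> D" "card G = j" for j G
  proof -
    consider "j = 1" | "j = 2" using j by force
    then show ?thesis
    proof cases
      case 1
      then obtain U where "G = {U}" using G(2) by (metis card_1_singletonE)
      then show ?thesis using 1 sub G(1) by simp
    next
      case 2
      then obtain U V where "G = {U, V}" "U \<noteq> V" using G(2) by (meson card_2_iff)
      then show ?thesis using 2 two[of U V] G(1) by simp
    qed
  qed
  have triple: "proj_subspace (- 1) (\<Inter>G)" if G: "G \<subseteq> D" "card G = 1 + 2" for G
  proof -
    have "card G = 3" using G(2) by simp
    then obtain U V W where "G = {U, V, W}" "U \<noteq> V" "U \<noteq> W" "V \<noteq> W" unfolding card_3_iff by blast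
    then show ?thesis using three[of U V W] G(1) by (simp add: Int_assoc)
  qed
  have arc: "generalised_dual_arc 1 ?ms D"
    unfolding generalised_dual_arc_def
  proof (intro conjI allI impI ballI)
    show "?ms ! (j + 1) < ?ms ! j" if "j \<le> 1" for j
      using that n n_less by (cases j) auto
  qed (use ambient sub inters triple in auto)
  have span_meets: "U = proj_span {U \<inter> W |W. W \<in> D - {U}}" if U: "U \<in> D" for U
  proof
    let ?Y = "proj_span {U \<inter> W |W. W \<in> D - {U}}"
    show "U \<subseteq> ?Y"
    proof (rule many_points_span[OF F(1)[OF U], of ?Y n "\<lambda>W. W \<inter> U" "D - {U}"])
      show "vec.subspace ?Y" by (simp add: proj_span_def)
      show "vec.dim U = Suc n" using F(2)[OF U] by simp
      show pts: "(\<lambda>W. W \<inter> U) ` (D - {U}) \<subseteq> points U"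
        using F(1) F(1)[OF U] F(3)[OF _ U] by (auto simp: points_def vec.subspace_inter)
      show "inj_on (\<lambda>W. W \<inter> U) (D - {U})"
      proof (rule inj_onI, rule ccontr)
        fix V W assume *: "V \<in> D - {U}" "W \<in> D - {U}" "V \<inter> U = W \<inter> U" "V \<noteq> W"
        then have "V \<inter> U = {0}" using F(4)[of U V W] U by blast
        then show False using F(3)[of V U] * U by simp
      qed
      show "W \<inter> U \<subseteq> ?Y" if "W \<in> D - {U}" for W
      proof -
        have "U \<inter> W \<subseteq> \<Union>{U \<inter> W |W. W \<in> D - {U}}" using that by blast
        then show ?thesis unfolding proj_span_def using vec.span_superset by blast
      qed
      have "card (D - {U}) = CARD('a) * num_points CARD('a) n"
        using U D(2) by (simp add: card_Diff_singleton num_points_Suc)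
      moreover have "CARD('a) * num_points CARD('a) n \<ge> 2 * num_points CARD('a) n"
        using CARD_field_ge2[where 'a='a] by (rule mult_le_mono1)
      moreover have "num_points CARD('a) n \<ge> 1" using num_points_mono[of 1 n "CARD('a)"] n by simp
      ultimately show "num_points CARD('a) n < card (D - {U})" by linarith
    qed
    show "?Y \<subseteq> U" unfolding proj_span_def using F(1)[OF U] by (intro vec.span_minimal) auto
  qed
  show ?thesis
    unfolding regular_generalised_dual_arc_def
  proof (intro conjI ballI allI impI)
    show "proj_span D = UNIV" using D(3) by (simp add: proj_span_def)
    fix j :: nat and G assume "j \<in> {1..1}" "G \<subseteq> D" "card G = j"
    then obtain U where "G = {U}" "U \<in> D"
      by (metis atLeastAtMost_singleton card_1_singletonE insert_subset singletonD)
    then show "\<Inter>G = proj_span {\<Inter>G \<inter> W |W. W \<in> D - G}" using span_meets[of U] by simp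
  qed (rule arc)
qed

lemma dual_hyperovalI:
  fixes H :: "('a::{field,finite} ^ 'v) set set"
  assumes H: "dual_family n H" "card H = num_points CARD('a) (n + 1) + 1" "vec.span (\<Union>H) = UNIV"
    and "CARD('v) \<ge> 3"
  shows "dual_hyperoval n H"
proof -
  note F = dual_familyD[OF H(1)]
  have "real (card H) = (real CARD('a) ^ (n + 1) - 1) / (real CARD('a) - 1) + 1"
    using H(2) real_num_points[OF CARD_field_ge2[where 'a='a], of "n + 1"] by simp
  moreover have "proj_subspace (int n) U" if "U \<in> H" for U
    using F(1,2)[OF that] proj_subspace_iff[of "n + 1" U] by simp
  moreover have "proj_subspace 0 (U \<inter> V)" if "U \<in> H" "V \<in> H" "U \<noteq> V" for U V
    using F(3)[OF that] F(1)[OF that(1)] F(1)[OF that(2)] proj_subspace_iff[of 1 "U \<inter> V"]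
    by (simp add: vec.subspace_inter)
  moreover have "proj_subspace (- 1) (U \<inter> V \<inter> W)"
    if "U \<in> H" "V \<in> H" "W \<in> H" "U \<noteq> V \<and> U \<noteq> W \<and> V \<noteq> W" for U V W
    using F(4)[of U V W] that proj_subspace_iff[of 0 "U \<inter> V \<inter> W"] by simp
  ultimately show ?thesis using assms(3,4) unfolding dual_hyperoval_def proj_span_def by simp
qed

text \<open>
  The admissible dimensions of spans are the partial sums of \<open>(n + 1) + n + (n - 1) + \<dots>\<close>.  A span
  that exceeds the second sum \<open>2n + 1\<close> has at least the third.
\<close>

lemma third_span_dim:
  fixes D i n :: nat
  assumes "D > 2 * n + 1" "i \<le> n" "int D - 1 = int i * (2 * int n - int i + 3) div 2 - 1"
  shows "D \<ge> 3 * n"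
proof -
  have D: "int D = int i * (2 * int n - int i + 3) div 2" using assms(3) by simp
  have "i \<ge> 3"
  proof (rule ccontr)
    assume "\<not> ?thesis"
    then consider "i = 0" | "i = 1" | "i = 2" by linarith
    then have "int D \<le> 2 * int n + 1" using D by cases auto
    then show False using assms(1) by simp
  qed
  then have "(int i - 3) * (2 * int n - int i) \<ge> 0" using assms(2) by (intro mult_nonneg_nonneg) auto
  then have "int i * (2 * int n - int i + 3) \<ge> 6 * int n" by (simp add: algebra_simps)
  then show ?thesis using D by linarith
qed

theorem theorem13:
  fixes q n \<delta> :: nat
    and \<F> :: "('a::{field,finite} ^ 'v) set set"
  assumes q: "CARD('a) = q"
    and n: "n \<ge> 2"
    and ambient: "CARD('v) = n * (n + 3) div 2 + 1"
    and delta_odd: "odd q \<Longrightarrow> real \<delta> \<le> (real q - 7) / 2"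
    and delta_even: "even q \<Longrightarrow> real \<delta> \<le> (real q - 8) / 2"
    and size: "real (card \<F>) = (real q ^ (n + 1) - 1) / (real q - 1) - real \<delta>"
    and elements: "\<And>U. U \<in> \<F> \<Longrightarrow> proj_subspace (int n) U"
    and prop1: "\<And>U V. U \<in> \<F> \<Longrightarrow> V \<in> \<F> \<Longrightarrow> U \<noteq> V \<Longrightarrow> proj_subspace 0 (U \<inter> V)"
    and prop2: "\<And>U V W. U \<in> \<F> \<Longrightarrow> V \<in> \<F> \<Longrightarrow> W \<in> \<F> \<Longrightarrow> U \<noteq> V \<Longrightarrow> U \<noteq> W \<Longrightarrow> V \<noteq> W \<Longrightarrow>
                  proj_subspace (-1) (U \<inter> V \<inter> W)"
    and prop3: "proj_span \<F> = UNIV"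
    and prop4: "\<And>\<G>. \<G> \<subseteq> \<F> \<Longrightarrow> proj_span \<G> \<noteq> UNIV \<Longrightarrow>
                  \<exists>i\<in>{0..n}. pdim (proj_span \<G>) = int i * (2 * int n - int i + 3) div 2 - 1"
    and prop5: "even q \<Longrightarrow>
                  \<exists>U\<in>\<F>. \<exists>V\<in>\<F>. U \<noteq> V \<and> card {W \<in> \<F>. W \<subseteq> proj_span {U, V}} > 2"
  shows "\<exists>\<D>. \<F> \<subseteq> \<D> \<and>
           regular_generalised_dual_arc 1 [int (n * (n + 3) div 2), int n, 0] \<D> \<and>
           real (card \<D>) = (real q ^ (n + 1) - 1) / (real q - 1) \<and>
           (even q \<longrightarrow> (\<exists>\<H>. \<D> \<subseteq> \<H> \<and> dual_hyperoval n \<H>))"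
proof -
  have q2: "q \<ge> 2" using CARD_field_ge2[where 'a='a] q by simp
  have qd: "2 * \<delta> + 7 \<le> q"
  proof (cases "odd q")
    case True
    then have "real (2 * \<delta> + 7) \<le> real q" using delta_odd by simp
    then show ?thesis by (simp only: of_nat_le_iff)
  next
    case False
    then have "real (2 * \<delta> + 7) \<le> real q" using delta_even by simp
    then show ?thesis by (simp only: of_nat_le_iff)
  qed
  have sub: "vec.subspace U" "vec.dim U = n + 1" if "U \<in> \<F>" for U
    using elements[OF that] proj_subspace_iff[of "n + 1" U] by simp_all
  have meet: "vec.dim (U \<inter> V) = 1" if "U \<in> \<F>" "V \<in> \<F>" "U \<noteq> V" for U V
    using prop1[OF that] proj_subspace_iff[of 1 "U \<inter> V"] by simp
  have skew: "U \<inter> V \<inter> W = {0}"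
    if "U \<in> \<F>" "V \<in> \<F>" "W \<in> \<F>" "U \<noteq> V" "U \<noteq> W" "V \<noteq> W" for U V W
  proof -
    have "vec.subspace (U \<inter> V \<inter> W)" "vec.dim (U \<inter> V \<inter> W) = 0"
      using prop2[OF that] proj_subspace_iff[of 0 "U \<inter> V \<inter> W"] by simp_all
    then show ?thesis by (metis subspace_eqI vec.dim_eq_0 vec.subspace_0 empty_subsetI insert_subset
          subset_antisym order_refl)
  qed
  have meet_join: "vec.dim (W \<inter> join U V) = 2"
    if U: "U \<in> \<F>" "V \<in> \<F>" "W \<in> \<F>" "U \<noteq> V" and off: "\<not> W \<subseteq> join U V" for U V W
  proof -
    have ne: "W \<noteq> U" "W \<noteq> V" using off join_upper(1)[of U V] join_upper(2)[of V U] by blast+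
    have UV: "vec.dim (join U V) = 2 * n + 1" using dim_join[of U V] sub U meet by simp
    have sW: "vec.subspace (W \<inter> join U V)" using sub U(3) by (simp add: vec.subspace_inter)
    have ge: "vec.dim (W \<inter> join U V) \<ge> 2"
    proof -
      have "join (W \<inter> U) (W \<inter> V) \<subseteq> W \<inter> join U V"
        using join_upper(1)[of U V] join_upper(2)[of V U] sW by (intro join_least) auto
      then have "vec.dim (join (W \<inter> U) (W \<inter> V)) \<le> vec.dim (W \<inter> join U V)" by (rule vec.dim_subset)
      moreover have "W \<inter> U \<inter> (W \<inter> V) = {0}" using skew[OF U(3,1,2) ne U(4)] by blast
      ultimately show ?thesis
        using dim_join[of "W \<inter> U" "W \<inter> V"] meet[OF U(3,1) ne(1)] meet[OF U(3,2) ne(2)] sub U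
        by (simp add: vec.subspace_inter)
    qed
    let ?Y = "proj_span {U, V, W}"
    have Y: "?Y = join (join U V) W"
    proof
      have "U \<subseteq> join (join U V) W" "V \<subseteq> join (join U V) W" "W \<subseteq> join (join U V) W"
        using join_upper(1)[of U V] join_upper(2)[of V U] join_upper(1)[of "join U V" W]
          join_upper(2)[of W "join U V"] by blast+
      then show "?Y \<subseteq> join (join U V) W" unfolding proj_span_def
        by (intro vec.span_minimal subspace_join) simp
      have "U \<subseteq> ?Y" "V \<subseteq> ?Y" "W \<subseteq> ?Y"
        using vec.span_superset[of "\<Union>{U, V, W}"] unfolding proj_span_def by simp_all
      then show "join (join U V) W \<subseteq> ?Y"
        by (intro join_least) (simp_all add: proj_span_def)
    qed
    have dY: "vec.dim ?Y + vec.dim (W \<inter> join U V) = 3 * n + 2"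
      using dim_join[of "join U V" W] UV sub[OF U(3)] by (simp add: Y Int_commute)
    have "\<not> vec.dim (W \<inter> join U V) \<ge> n + 1"
    proof
      assume "vec.dim (W \<inter> join U V) \<ge> n + 1"
      then have "W \<inter> join U V = W" using sW sub[OF U(3)] by (intro subspace_eqI) auto
      then show False using off by blast
    qed
    then have "vec.dim ?Y > 2 * n + 1" using dY by linarith
    have "vec.dim ?Y \<ge> 3 * n"
    proof (cases "?Y = UNIV")
      case True
      then have "vec.dim ?Y = n * (n + 3) div 2 + 1" using ambient by (simp add: card_cart_basis)
      moreover have "3 * n \<le> n * (n + 3) div 2 + 1"
      proof -
        obtain k where "n = 2 + k" using le_Suc_ex[OF n] by blast
        then have "6 * n \<le> n * (n + 3) + 2" by (simp add: algebra_simps)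
        then show ?thesis by linarith
      qed
      ultimately show ?thesis by simp
    next
      case False
      then obtain i where "i \<in> {0..n}" "pdim ?Y = int i * (2 * int n - int i + 3) div 2 - 1"
        using prop4[of "{U, V, W}", OF _ False] U(1-3) by blast
      then show ?thesis
        using third_span_dim[OF \<open>vec.dim ?Y > 2 * n + 1\<close>, of i] by (simp add: pdim_def)
    qed
    then show ?thesis using dY ge by linarith
  qed
  have "real (card \<F> + \<delta>) = real (num_points q (n + 1))"
    using size real_num_points[OF q2, of "n + 1"] by simp
  then have cardF: "card \<F> + \<delta> = num_points CARD('a) (n + 1)" using q by (simp only: of_nat_eq_iff)
  have spanF: "vec.span (\<Union>\<F>) = UNIV" using prop3 by (simp add: proj_span_def)
  interpret partial_dual_arc \<F> n \<delta>
    by unfold_locales (use n qd q ambient cardF sub meet skew spanF meet_join in auto)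
  have "\<exists>U\<in>\<F>. \<exists>V\<in>\<F>. U \<noteq> V \<and> card (line U V) \<ge> 3"
  proof (cases "odd q")
    case True
    then show ?thesis using ex_three_on_line q by simp
  next
    case False
    then obtain U V where UV: "U \<in> \<F>" "V \<in> \<F>" "U \<noteq> V" "card {W \<in> \<F>. W \<subseteq> proj_span {U, V}} > 2"
      using prop5 by auto
    have "proj_span {U, V} = join U V" by (simp add: proj_span_def join_def)
    then have "card (line U V) \<ge> 3" using UV(4) by (simp add: line_def)
    then show ?thesis using UV by blast
  qed
  then obtain U V where "U \<in> \<F>" "V \<in> \<F>" "U \<noteq> V" "card (line U V) \<ge> 3" by blast
  then obtain D where D: "\<F> \<subseteq> D" "dual_family n D" "card D = num_points CARD('a) (n + 1)"
    "(2 :: 'a) = 0 \<Longrightarrow> \<exists>H. D \<subseteq> H \<and> dual_family n H \<and> card H = card D + 1"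
    using extension by blast
  have span_up: "vec.span (\<Union>E) = UNIV" if "\<F> \<subseteq> E" for E
    using spanF vec.span_mono[OF Union_mono[OF that]] by auto
  have "regular_generalised_dual_arc 1 [int (n * (n + 3) div 2), int n, 0] D"
    by (rule regular_dual_arcI[OF D(2,3) span_up[OF D(1)] n ambient])
  moreover have "real (card D) = (real q ^ (n + 1) - 1) / (real q - 1)"
    using D(3) real_num_points[OF q2, of "n + 1"] q by simp
  moreover have "\<exists>\<H>. D \<subseteq> \<H> \<and> dual_hyperoval n \<H>" if "even q"
  proof -
    have "(2 :: 'a) = 0" using char2_from_even_card that q by blast
    then obtain H where H: "D \<subseteq> H" "dual_family n H" "card H = card D + 1" using D(4) by blast
    have "n * 5 \<le> n * (n + 3)" using n by (intro mult_le_mono2) simp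
    then have "CARD('v) \<ge> 3" using ambient n by linarith
    moreover have "\<F> \<subseteq> H" using D(1) H(1) by blast
    ultimately have "dual_hyperoval n H"
      using dual_hyperovalI[OF H(2) _ span_up] H(3) D(3) by simp
    then show ?thesis using H(1) by blast
  qed
  ultimately show ?thesis using D(1) by blast
qed

end
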